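(* Let $Q, Q'$ be $B_{n-1}$-orbits on $\mathcal{B}_n$. Then $$Q'\subset\overline{Q}\iff \mathcal{S}h(Q')\le \mathcal{S}h(Q).$$
   Context: Let $n\ge 2$, $G=GL(n,\mathbb{C})$, and let $\mathcal{B}_n$ be the variety of full flags in $\mathbb{C}^n$ with its natural $G$-action. Let $e_1,\dots,e_n$ be the standard basis; $(v_1\subset v_2\subset\dots\subset v_n)$ denotes the full flag whose $i$-th subspace is $\mathrm{span}\{v_1,\dots,v_i\}$. Embed $GL(n-1,\mathbb{C})$ in $G$ in the top left corner, $x\mapsto \mathrm{diag}(x,1)$, and let $B_{n-1}$ be the upper triangular Borel subgroup of $GL(n-1,\mathbb{C})$, viewed as a subgroup of $G$. It acts on $\mathcal{B}_n$ with finitely many orbits. Put $\mathcal{E}_+=(e_1\subset e_2\subset\dots\subset e_n)$ and $\mathcal{E}^*=(e_n\subset e_1\subset e_2\subset\dots\subset e_{n-1})$, with stabilizers $B$ (the upper triangular matrices) and $B^*$ in $G$, respectively. The Weyl group $W=\mathcal{S}_n$ acts by $w(e_i)=e_{w(i)}$, and hence acts on the flags spanned by permutations of the standard basis. For a $B_{n-1}$-orbit $Q$, $\mathcal{S}h(Q):=(w,u^* )\in W\times W$, where $w,u^*$ are the unique elements with $B\cdot Q=B\cdot w(\mathcal{E}_+)$ and $B^*\cdot Q=B^*\cdot u^*(\mathcal{E}^* )$. The order $\le$ on the image of $\mathcal{S}h$ is the restriction of the product order on $W\times W$, where the first factor carries the Bruhat order with respect to the standard simple reflections $S=\{(1,2),(2,3),\dots,(n-1,n)\}$,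 and the second factor carries the Bruhat order with respect to the simple reflections $S^*=\{s_1^*,\dots,s_{n-1}^*\}$, $s_1^*=(1,n)$ and $s_i^*=(i-1,i)$ for $i=2,\dots,n-1$. Thus $(y,v^* )\le(w,u^* )$ means $y\le w$ in $(W,S)$ and $v^*\le u^*$ in $(W,S^* )$. $\overline{Q}$ is the closure of $Q$ in $\mathcal{B}_n$. *)

theory Defs
  imports
    "HOL-Algebra.Group_Action"
    "HOL-Algebra.Sym_Groups"
    "HOL-Combinatorics.Transposition"
    "Jordan_Normal_Form.VS_Connect"
begin

section \<open>The general linear group and the flag variety\<close>

definition GL :: "nat \<Rightarrow> complex mat monoid" where
  "GL n = \<lparr> carrier = {g \<in> carrier_mat n n. invertible_mat g}, monoid.mult = (*), one = 1\<^sub>m n \<rparr>"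

text \<open>A full flag in \<open>C^n\<close> is the list of its \<open>n\<close> nonzero members, so the list entry with
  index \<open>i\<close> (counted from 0) is the subspace of dimension \<open>i + 1\<close>.\<close>

type_synonym flag = "complex vec set list"

definition flags :: "nat \<Rightarrow> flag set" where
  "flags n = {F. length F = n
     \<and> (\<forall>i<n. subspace class_ring (F ! i) (module_vec TYPE(complex) n)
            \<and> vectorspace.dim class_ring ((module_vec TYPE(complex) n)\<lparr>carrier := F ! i\<rparr>) = i + 1)
     \<and> (\<forall>i j. i < j \<and> j < n \<longrightarrow> F ! i \<subset> F ! j)}"

definition flag_act :: "complex mat \<Rightarrow> flag \<Rightarrow> flag" where
  "flag_act g F = map (\<lambda>U. (\<lambda>v. g *\<^sub>v v) ` U) F"

definition span_flag :: "nat \<Rightarrow> complex vec list \<Rightarrow> flag" where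
  "span_flag n vs =
     map (\<lambda>i. LinearCombinations.module.span class_ring (module_vec TYPE(complex) n) (set (take i vs)))
       [1..<n + 1]"

text \<open>The standard basis is numbered \<open>e_1, \<dots>, e_n\<close>, whereas \<^const>\<open>unit_vec\<close> counts from 0.\<close>

definition std_vec :: "nat \<Rightarrow> nat \<Rightarrow> complex vec" where
  "std_vec n i = unit_vec n (i - 1)"

definition E_plus :: "nat \<Rightarrow> flag" where
  "E_plus n = span_flag n (map (std_vec n) [1..<n + 1])"

definition E_star :: "nat \<Rightarrow> flag" where
  "E_star n = span_flag n (std_vec n n # map (std_vec n) [1..<n])"

text \<open>The linear map with \<open>e_i \<mapsto> e_{w(i)}\<close>.\<close>

definition perm_mat :: "nat \<Rightarrow> (nat \<Rightarrow> nat) \<Rightarrow> complex mat" where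
  "perm_mat n w = mat_of_cols n (map (\<lambda>i. std_vec n (w i)) [1..<n + 1])"

definition perm_act :: "nat \<Rightarrow> (nat \<Rightarrow> nat) \<Rightarrow> flag \<Rightarrow> flag" where
  "perm_act n w = flag_act (perm_mat n w)"

definition Borel :: "nat \<Rightarrow> complex mat set" where
  "Borel n = stabilizer (GL n) flag_act (E_plus n)"

definition Borel_star :: "nat \<Rightarrow> complex mat set" where
  "Borel_star n = stabilizer (GL n) flag_act (E_star n)"

text \<open>The Borel subgroup \<open>B_{n-1}\<close> of \<open>GL(n-1)\<close>, embedded in \<open>GL(n)\<close> by \<open>x \<mapsto> diag(x,1)\<close>.\<close>

definition Borel_minor :: "nat \<Rightarrow> complex mat set" where
  "Borel_minor n = {four_block_mat x (0\<^sub>m (n - 1) 1) (0\<^sub>m 1 (n - 1)) (1\<^sub>m 1) | x.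
     x \<in> carrier (GL (n - 1)) \<and> upper_triangular x}"

definition Borel_minor_orbits :: "nat \<Rightarrow> flag set set" where
  "Borel_minor_orbits n = orbits ((GL n)\<lparr>carrier := Borel_minor n\<rparr>) (flags n) flag_act"

section \<open>The Zariski topology\<close>

inductive_set poly_funs :: "nat \<Rightarrow> (complex mat \<Rightarrow> complex) set" for n :: nat where
  const: "(\<lambda>A. c) \<in> poly_funs n"
| entry: "i < n \<Longrightarrow> j < n \<Longrightarrow> (\<lambda>A. A $$ (i, j)) \<in> poly_funs n"
| add: "f \<in> poly_funs n \<Longrightarrow> g \<in> poly_funs n \<Longrightarrow> (\<lambda>A. f A + g A) \<in> poly_funs n"
| mult: "f \<in> poly_funs n \<Longrightarrow> g \<in> poly_funs n \<Longrightarrow> (\<lambda>A. f A * g A) \<in> poly_funs n"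

text \<open>The regular functions on \<open>GL(n)\<close> are polynomials in the entries divided by powers of the
  determinant, so polynomials already define all closed subsets.\<close>

definition closed_in_GL :: "nat \<Rightarrow> complex mat set \<Rightarrow> bool" where
  "closed_in_GL n Z \<longleftrightarrow> (\<exists>P \<subseteq> poly_funs n. Z = {g \<in> carrier (GL n). \<forall>p\<in>P. p g = 0})"

text \<open>The flag variety is the quotient variety \<open>GL(n)/B\<close> via \<open>g \<mapsto> g E_+\<close>; its Zariski topology is
  the quotient topology.\<close>

definition closed_in_flags :: "nat \<Rightarrow> flag set \<Rightarrow> bool" where
  "closed_in_flags n Z \<longleftrightarrow>
     Z \<subseteq> flags n \<and> closed_in_GL n {g \<in> carrier (GL n). flag_act g (E_plus n) \<in> Z}"

definition flag_closure :: "nat \<Rightarrow> flag set \<Rightarrow> flag set" where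
  "flag_closure n Q = closed_in_flags n hull Q"

section \<open>Bruhat orders\<close>

text \<open>For a Coxeter system \<open>(W, S)\<close>: length, reflections, and the reflexive transitive closure of
  \<open>x < x t\<close> for reflections \<open>t\<close> that increase the length.\<close>

definition cox_length :: "('a, 'b) monoid_scheme \<Rightarrow> 'a set \<Rightarrow> 'a \<Rightarrow> nat" where
  "cox_length W S w =
     (LEAST k. \<exists>ss. length ss = k \<and> set ss \<subseteq> S \<and> foldr (\<otimes>\<^bsub>W\<^esub>) ss \<one>\<^bsub>W\<^esub> = w)"

definition cox_reflections :: "('a, 'b) monoid_scheme \<Rightarrow> 'a set \<Rightarrow> 'a set" where
  "cox_reflections W S = {x \<otimes>\<^bsub>W\<^esub> s \<otimes>\<^bsub>W\<^esub> inv\<^bsub>W\<^esub> x | x s. x \<in> carrier W \<and> s \<in> S}"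

definition bruhat_le :: "('a, 'b) monoid_scheme \<Rightarrow> 'a set \<Rightarrow> 'a \<Rightarrow> 'a \<Rightarrow> bool" where
  "bruhat_le W S =
     (\<lambda>x y. x \<in> carrier W \<and> (\<exists>t \<in> cox_reflections W S. y = x \<otimes>\<^bsub>W\<^esub> t)
            \<and> cox_length W S x < cox_length W S y)\<^sup>*\<^sup>*"

definition S_std :: "nat \<Rightarrow> (nat \<Rightarrow> nat) set" where
  "S_std n = {transpose i (i + 1) | i. 1 \<le> i \<and> i \<le> n - 1}"

definition S_star :: "nat \<Rightarrow> (nat \<Rightarrow> nat) set" where
  "S_star n = insert (transpose 1 n) {transpose (i - 1) i | i. 2 \<le> i \<and> i \<le> n - 1}"

section \<open>The pair of Weyl group elements of an orbit\<close>

definition saturation :: "nat \<Rightarrow> complex mat set \<Rightarrow> flag set \<Rightarrow> flag set" where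
  "saturation n H Q = (\<Union>F\<in>Q. orbit ((GL n)\<lparr>carrier := H\<rparr>) flag_act F)"

definition Sh :: "nat \<Rightarrow> flag set \<Rightarrow> (nat \<Rightarrow> nat) \<times> (nat \<Rightarrow> nat)" where
  "Sh n Q =
     (THE w. w \<in> carrier (sym_group n) \<and>
        saturation n (Borel n) Q = saturation n (Borel n) {perm_act n w (E_plus n)},
      THE u. u \<in> carrier (sym_group n) \<and>
        saturation n (Borel_star n) Q = saturation n (Borel_star n) {perm_act n u (E_star n)})"

definition Sh_le :: "nat \<Rightarrow> (nat \<Rightarrow> nat) \<times> (nat \<Rightarrow> nat) \<Rightarrow> (nat \<Rightarrow> nat) \<times> (nat \<Rightarrow> nat) \<Rightarrow> bool" where
  "Sh_le n a b \<longleftrightarrow>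
     bruhat_le (sym_group n) (S_std n) (fst a) (fst b) \<and>
     bruhat_le (sym_group n) (S_star n) (snd a) (snd b)"

end

theory Submission
  imports Defs
begin

text \<open>
  Let \<open>B\<close> be the group of upper triangular matrices, \<open>B' = B_{n-1}\<close>, and \<open>r\<close> the permutation
  matrix that sends \<open>e_n\<close> to \<open>e_1\<close> and \<open>e_k\<close> to \<open>e_{k+1}\<close> for \<open>k < n\<close>. A flag is a coset \<open>g B\<close>, so
  an orbit is a double coset \<open>B' h B\<close> and closures can be computed in \<open>GL(n)\<close>. The stabilizer of
  \<open>E*\<close> is \<open>r^-1 B r\<close>, and \<open>r B' r^-1 \<subseteq> B\<close>; therefore \<open>Sh\<close> records the two Bruhat cells \<open>B w B\<close> and
  \<open>B v B\<close> that contain \<open>h\<close> and \<open>r h\<close>. Conjugation by \<open>r\<close> turns \<open>u*\<close> into \<open>v\<close> and \<open>S*\<close> into \<open>S\<close>.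
  The theorem thus states (\<open>closure_iff_dominated\<close>): if \<open>h\<close> has types \<open>(w, v)\<close> and \<open>g\<close> has types
  \<open>(y, u)\<close>, then \<open>g\<close> is in the closure of \<open>B' h B\<close> if and only if \<open>y \<le> w\<close> and \<open>u \<le> v\<close> in the
  standard Bruhat order. This order is used in the form of Ehresmann's criterion: \<open>y \<le> w\<close> means
  that the blocks in the lower left corner of the matrix of \<open>y\<close> have at most the rank of those of
  \<open>w\<close> (\<open>bruhat_le_iff_dominated\<close>).

  If \<open>g\<close> is in the closure, both inequalities hold because ranks of blocks do not increase in a
  closure (\<open>cell_closure_dominated\<close>).

  For the converse, a normal form of the double cosets is needed. It shows that the pair of types
  determines the orbit (\<open>types_determine_coset\<close>), and that the block ranks of \<open>w\<close> and \<open>v\<close> differ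
  by 0 or 1, monotonically (\<open>interlaced\<close>): the difference tells whether \<open>e_n\<close> lies in \<open>F_i + E_j\<close>.
  The flags that differ from a given one in a single member form a projective line. If \<open>w\<close> and \<open>v\<close>
  both descend at the corresponding position, each of the two cells contains all points of the
  line through \<open>h\<close> but one. The points that are not exceptional have the types of \<open>h\<close> and hence
  belong to its orbit, so the closure of the orbit contains the whole line, and it is a union of
  such lines (\<open>closure_parabolic_saturated\<close>). One may therefore replace \<open>h\<close> and \<open>g\<close> by exceptional
  points of their lines and use induction on the lengths. The lifting property of the Bruhat order
  supplies the inequalities, except when the line of \<open>g\<close> has two exceptional points and that of
  \<open>h\<close> only one; then the monotonicity of the rank differences makes one of the two choices for \<open>g\<close>
  succeed (\<open>interlaced_descent\<close>).

  If \<open>w\<close> and \<open>v\<close> have no common descent, the orbit of \<open>h\<close> contains a flag spanned by the standard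
  basis (\<open>no_common_descent_imp_singleton\<close>), and the inequalities force the same for \<open>g\<close> with
  \<open>e_n\<close> at the same position (\<open>dominated_singleton\<close>). Then \<open>y \<le> w\<close> is a chain of transpositions
  that do not move \<open>n\<close>, and each of them is an explicit degeneration along a line
  (\<open>transposition_degeneration\<close>).
\<close>

section \<open>Rank counts of permutations and the Bruhat order\<close>

text \<open>For the matrix of \<open>w\<close>, with columns \<open>e_{w(c)}\<close>, this is the rank of the block formed by the
  first \<open>i\<close> columns and the rows below the \<open>j\<close>-th. Equivalently \<open>i - exceed w i j\<close> is the
  dimension of \<open>F_i \<inter> E_j\<close> for every flag \<open>F\<close> in the orbit \<open>B w E_+\<close>.\<close>

definition exceed :: "(nat \<Rightarrow> nat) \<Rightarrow> nat \<Rightarrow> nat \<Rightarrow> nat" where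
  "exceed w i j = card {c \<in> {1..i}. j < w c}"

definition dominated :: "(nat \<Rightarrow> nat) \<Rightarrow> (nat \<Rightarrow> nat) \<Rightarrow> bool" where
  "dominated y w \<longleftrightarrow> (\<forall>i j. exceed y i j \<le> exceed w i j)"

text \<open>The simple reflection at the positions \<open>k + 1\<close> and \<open>k + 2\<close>; the shift makes \<open>k\<close> and \<open>k + 1\<close>
  the indices of the two matrix columns that it exchanges.\<close>

abbreviation simple :: "nat \<Rightarrow> nat \<Rightarrow> nat" where
  "simple k \<equiv> Transposition.transpose (Suc k) (Suc (Suc k))"

lemma exceed_0 [simp]: "exceed w 0 j = 0"
  by (simp add: exceed_def)

lemma exceed_Suc: "exceed w (Suc i) j = exceed w i j + of_bool (j < w (Suc i))"
proof -
  have "{c \<in> {1..Suc i}. j < w c} = (if j < w (Suc i) then insert (Suc i) {c \<in> {1..i}. j < w c}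
     else {c \<in> {1..i}. j < w c})" by (auto simp: le_Suc_eq)
  then show ?thesis by (simp add: exceed_def)
qed

lemma exceed_cong: "(\<And>c. 1 \<le> c \<Longrightarrow> c \<le> i \<Longrightarrow> y c = w c) \<Longrightarrow> exceed y i j = exceed w i j"
  unfolding exceed_def by (rule arg_cong[where f = card]) auto

text \<open>At a descent the middle one of three successive counts is as large as its two neighbours
  permit, and at an ascent it is as small as they permit. Both descriptions are monotone in the
  neighbours, which is why the lifting property of the Bruhat order is immediate for rank counts.\<close>

lemma exceed_descent:
  assumes "w (Suc (Suc k)) < w (Suc k)"
  shows "exceed w (Suc k) j = min (exceed w k j + 1) (exceed w (Suc (Suc k)) j)"
  using assms by (auto simp: exceed_Suc)

lemma exceed_ascent:
  assumes "w (Suc k) < w (Suc (Suc k))"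
  shows "exceed w (Suc k) j = max (exceed w k j) (exceed w (Suc (Suc k)) j - 1)"
  using assms by (auto simp: exceed_Suc)

lemma exceed_split:
  assumes "j \<le> j'"
  shows "exceed w i j = exceed w i j' + card {c \<in> {1..i}. j < w c \<and> w c \<le> j'}"
proof -
  have "{c \<in> {1..i}. j < w c} = {c \<in> {1..i}. j' < w c} \<union> {c \<in> {1..i}. j < w c \<and> w c \<le> j'}"
    using assms by auto
  then show ?thesis unfolding exceed_def
    by (simp add: card_Un_disjoint disjoint_iff)
qed

text \<open>Exchanging two values that are in increasing order changes the counts on one rectangle only,
  where it raises them by 1.\<close>

lemma exceed_comp_transpose:
  assumes "1 \<le> a" "a < b" "w a < w b"
  shows "exceed (w \<circ> Transposition.transpose a b) i j
    = exceed w i j + of_bool (a \<le> i \<and> i < b \<and> w a \<le> j \<and> j < w b)"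
proof (induction i)
  case (Suc i)
  consider "Suc i = a" | "Suc i = b" | "Suc i \<noteq> a" "Suc i \<noteq> b" by blast
  then show ?case
    using assms Suc
    by cases (auto simp: exceed_Suc)
qed (use assms in auto)

lemma exceed_comp_simple:
  assumes "i \<noteq> Suc k"
  shows "exceed (w \<circ> simple k) i j = exceed w i j"
proof (cases "w (Suc k) = w (Suc (Suc k))")
  case True
  then have "w \<circ> simple k = w"
    by (auto simp: fun_eq_iff Transposition.transpose_def)
  then show ?thesis by simp
next
  case False
  have *: "exceed (y \<circ> simple k) i j = exceed y i j" if "y (Suc k) < y (Suc (Suc k))" for y
    using exceed_comp_transpose[of "Suc k" "Suc (Suc k)" y i j] that assms by auto
  have "w (Suc k) < w (Suc (Suc k)) \<or>
      (w \<circ> simple k) (Suc k) < (w \<circ> simple k) (Suc (Suc k))" using False by auto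
  then show ?thesis using *[of w] *[of "w \<circ> simple k"] by (auto simp: comp_assoc)
qed

lemma permutes_comp_simple:
  assumes "w permutes {1..n}" "Suc k < n"
  shows "w \<circ> simple k permutes {1..n}"
  using assms by (intro permutes_compose permutes_swap_id) auto

lemma permutes_comp_transpose:
  assumes "w permutes {1..n}" "1 \<le> a" "a \<le> n" "1 \<le> b" "b \<le> n"
  shows "w \<circ> Transposition.transpose a b permutes {1..n}"
  using assms by (intro permutes_compose permutes_swap_id) auto

lemma permutes_neq: "w permutes A \<Longrightarrow> a \<noteq> b \<Longrightarrow> w a \<noteq> w b"
  using permutes_inj[of w A] by (auto dest: injD)

lemma permutes_ivl_le: "w permutes {1..n} \<Longrightarrow> 1 \<le> c \<Longrightarrow> c \<le> n \<Longrightarrow> 1 \<le> w c \<and> w c \<le> n"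
  using permutes_in_image[of w "{1..n}" c] by auto

text \<open>This and the next lemma are the lifting property of the Bruhat order. The count in row
  \<open>k + 1\<close> is at most the minimum formed from the rows \<open>k\<close> and \<open>k + 2\<close>, and \<open>w\<close> attains this
  minimum.\<close>

lemma dominated_simple_lift:
  assumes "dominated y w" "w (Suc (Suc k)) < w (Suc k)"
  shows "dominated (y \<circ> simple k) w"
proof -
  have "exceed (y \<circ> simple k) i j \<le> exceed w i j" for i j
  proof (cases "i = Suc k")
    case True
    have "exceed (y \<circ> simple k) (Suc k) j
        \<le> min (exceed (y \<circ> simple k) k j + 1) (exceed (y \<circ> simple k) (Suc (Suc k)) j)"
      by (auto simp: exceed_Suc)
    also have "\<dots> = min (exceed y k j + 1) (exceed y (Suc (Suc k)) j)"
      by (simp add: exceed_comp_simple)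
    also have "\<dots> \<le> min (exceed w k j + 1) (exceed w (Suc (Suc k)) j)"
      using assms(1) unfolding dominated_def by (intro min.mono) auto
    finally show ?thesis using True exceed_descent[OF assms(2)] by simp
  next
    case False
    then show ?thesis using assms(1) by (simp add: exceed_comp_simple dominated_def)
  qed
  then show ?thesis by (simp add: dominated_def)
qed

lemma dominated_simple_down:
  assumes "dominated y w" "w (Suc (Suc k)) < w (Suc k)" "y (Suc (Suc k)) < y (Suc k)"
  shows "dominated (y \<circ> simple k) (w \<circ> simple k)"
proof -
  have "exceed (y \<circ> simple k) i j \<le> exceed (w \<circ> simple k) i j" for i j
  proof (cases "i = Suc k")
    case True
    have *: "exceed (x \<circ> simple k) (Suc k) j = max (exceed x k j) (exceed x (Suc (Suc k)) j - 1)"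
      if "x (Suc (Suc k)) < x (Suc k)" for x
      using exceed_ascent[of "x \<circ> simple k" k j] that by (simp add: exceed_comp_simple)
    show ?thesis unfolding True *[OF assms(2)] *[OF assms(3)]
      using assms(1) unfolding dominated_def by (intro max.mono diff_le_mono) auto
  next
    case False
    then show ?thesis using assms(1) by (simp add: exceed_comp_simple dominated_def)
  qed
  then show ?thesis by (simp add: dominated_def)
qed

lemma dominated_refl [simp]: "dominated w w"
  by (simp add: dominated_def)

lemma dominated_trans: "dominated x y \<Longrightarrow> dominated y w \<Longrightarrow> dominated x w"
  unfolding dominated_def by (meson order_trans)

text \<open>Beyond the \<open>n\<close>-th row a permutation of \<open>{1..n}\<close> contributes the same counts as every other
  one, so the inequalities that come from actual matrix blocks suffice.\<close>

lemma dominated_bounded: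
  assumes "y permutes {1..n}" "w permutes {1..n}"
    and "\<And>i j. i \<le> n \<Longrightarrow> j < n \<Longrightarrow> exceed y i j \<le> exceed w i j"
  shows "dominated y w"
proof -
  have low: "exceed y i j \<le> exceed w i j" if "i \<le> n" for i j
  proof (cases "j < n")
    case False
    then have "{c \<in> {1..i}. j < y c} = {}"
      using permutes_ivl_le[OF assms(1)] that by (fastforce simp: not_less)
    then show ?thesis by (simp only: exceed_def card.empty le0)
  qed (use that assms(3) in auto)
  have "exceed y (n + d) j \<le> exceed w (n + d) j" for d j
  proof (induction d)
    case (Suc d)
    have "y (Suc (n + d)) = Suc (n + d)" "w (Suc (n + d)) = Suc (n + d)"
      using assms(1,2) by (auto intro!: permutes_not_in)
    with Suc show ?case by (simp add: exceed_Suc)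
  qed (simp add: low)
  then show ?thesis unfolding dominated_def using low by (metis le_add_diff_inverse nat_le_linear)
qed

text \<open>One step of Ehresmann's criterion: if \<open>y \<noteq> w\<close> is dominated by \<open>w\<close>, a transposition raises \<open>y\<close>
  and keeps it below \<open>w\<close>. It starts at the first position \<open>a\<close> where the two differ and exchanges
  \<open>y a\<close> with the next value to its right in the interval from \<open>y a\<close> to \<open>w a\<close>. The bound
  \<open>y b \<le> w a\<close> is recorded because it shows that the step never moves the value \<open>n\<close> when \<open>y\<close> and
  \<open>w\<close> have it at the same position.\<close>

lemma dominated_step:
  assumes y: "y permutes {1..n}" and w: "w permutes {1..n}" and dom: "dominated y w" and ne: "y \<noteq> w"
  obtains a b where "1 \<le> a" "a < b" "b \<le> n" "y a < y b" "y b \<le> w a" "y a \<noteq> w a"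
    "dominated (y \<circ> Transposition.transpose a b) w"
proof -
  define a where "a = (LEAST a. y a \<noteq> w a)"
  have "\<exists>a. y a \<noteq> w a" using ne by (auto simp: fun_eq_iff)
  then have a: "y a \<noteq> w a" unfolding a_def by (rule LeastI_ex)
  have below: "y c = w c" if "c < a" for c
    using not_less_Least[of c "\<lambda>a. y a \<noteq> w a"] that unfolding a_def by blast
  have "a \<in> {1..n}"
  proof (rule ccontr)
    assume "a \<notin> {1..n}"
    then show False using a permutes_not_in[OF y, of a] permutes_not_in[OF w, of a] by simp
  qed
  then have an: "1 \<le> a" "a \<le> n" by auto
  obtain a' where a': "a = Suc a'" using an by (cases a) auto
  have eqa': "exceed y a' j = exceed w a' j" for j
    by (rule exceed_cong) (simp add: below a')
  have lt: "y a < w a"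
  proof (rule ccontr)
    assume "\<not> ?thesis"
    then have "w a < y a" using a by auto
    then have "exceed y a (w a) > exceed w a (w a)" by (simp add: a' exceed_Suc eqa')
    then show False using dom by (simp add: dominated_def leD)
  qed
  let ?good = "\<lambda>b. a < b \<and> y a < y b \<and> y b \<le> w a"
  obtain b0 where b0: "y b0 = w a" using permutes_surj[OF y] by (metis surjD)
  have "\<not> b0 < a" using below[of b0] b0 permutes_neq[OF w, of b0 a] by auto
  then have good0: "?good b0" using b0 lt a by (cases "b0 = a") auto
  define b where "b = (LEAST b. ?good b)"
  have b: "?good b" unfolding b_def by (rule LeastI[of ?good, OF good0])
  have between: "\<not> (y a < y c \<and> y c \<le> w a)" if "a < c" "c < b" for c
    using not_less_Least[of c ?good] that unfolding b_def by auto
  have bn: "b \<le> n"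
  proof (rule ccontr)
    assume "\<not> ?thesis"
    then have "y b = b" using permutes_not_in[OF y, of b] by auto
    then show False using b \<open>\<not> b \<le> n\<close> permutes_ivl_le[OF w an] by auto
  qed
  (* On the rectangle where the count of y goes up by 1, the inequality for y is strict: compare with
     the count at w a, using that no position strictly between a and b has a value of y between y a and w a. *)
  have "exceed (y \<circ> Transposition.transpose a b) i j \<le> exceed w i j" for i j
  proof (cases "a \<le> i \<and> i < b \<and> y a \<le> j \<and> j < y b")
    case True
    then have jw: "j \<le> w a" using b by auto
    have "{c \<in> {1..i}. j < y c \<and> y c \<le> w a} \<subseteq> {c \<in> {1..a'}. j < w c \<and> w c \<le> w a}"
    proof
      fix c assume c: "c \<in> {c \<in> {1..i}. j < y c \<and> y c \<le> w a}"
      then have "c < a" using between[of c] True by (cases c a rule: linorder_cases) auto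
      then show "c \<in> {c \<in> {1..a'}. j < w c \<and> w c \<le> w a}" using c below a' by auto
    qed
    then have "card {c \<in> {1..i}. j < y c \<and> y c \<le> w a} \<le> card {c \<in> {1..a'}. j < w c \<and> w c \<le> w a}"
      by (intro card_mono) auto
    also have "\<dots> < card {c \<in> {1..i}. j < w c \<and> w c \<le> w a}"
    proof (rule psubset_card_mono)
      have "a \<in> {c \<in> {1..i}. j < w c \<and> w c \<le> w a}" using True b an by auto
      moreover have "a \<notin> {c \<in> {1..a'}. j < w c \<and> w c \<le> w a}" using a' by auto
      moreover have "{c \<in> {1..a'}. j < w c \<and> w c \<le> w a} \<subseteq> {c \<in> {1..i}. j < w c \<and> w c \<le> w a}"
        using True a' by auto
      ultimately show "{c \<in> {1..a'}. j < w c \<and> w c \<le> w a} \<subset> {c \<in> {1..i}. j < w c \<and> w c \<le> w a}"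
        by blast
    qed simp
    finally have "card {c \<in> {1..i}. j < y c \<and> y c \<le> w a} < card {c \<in> {1..i}. j < w c \<and> w c \<le> w a}" .
    note strict = this
    have "exceed y i j < exceed w i j"
    proof -
      have "exceed y i (w a) \<le> exceed w i (w a)" using dom by (simp add: dominated_def)
      then show ?thesis
        using exceed_split[OF jw, of y i] exceed_split[OF jw, of w i] strict by linarith
    qed
    then show ?thesis using b an by (simp add: exceed_comp_transpose)
  next
    case False
    then have "exceed (y \<circ> Transposition.transpose a b) i j = exceed y i j"
      using b an exceed_comp_transpose[of a b y i j] by simp
    then show ?thesis using dom by (simp only: dominated_def)
  qed
  then have "dominated (y \<circ> Transposition.transpose a b) w" by (simp add: dominated_def)
  then show thesis using that[of a b] b an bn a by auto
qed

definition inversions :: "nat \<Rightarrow> (nat \<Rightarrow> nat) \<Rightarrow> (nat \<times> nat) set" where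
  "inversions n w = {(a, b). 1 \<le> a \<and> a < b \<and> b \<le> n \<and> w b < w a}"

lemma finite_inversions [simp]: "finite (inversions n w)"
  by (rule finite_subset[of _ "{..n} \<times> {..n}"]) (auto simp: inversions_def)

lemma card_inversions_le: "card (inversions n w) \<le> n * n"
proof -
  have "inversions n w \<subseteq> {1..n} \<times> {1..n}" by (auto simp: inversions_def)
  from card_mono[OF _ this] show ?thesis by simp
qed

lemma inversions_comp_simple:
  assumes "w (Suc k) < w (Suc (Suc k))" "Suc k < n"
  shows "card (inversions n (w \<circ> simple k)) = Suc (card (inversions n w))"
proof -
  let ?s = "simple k" and ?m = "\<lambda>(a, b). (simple k a, simple k b)"
  have lt: "?s a < ?s b \<longleftrightarrow> a < b" if "(a, b) \<noteq> (Suc k, Suc (Suc k))" "(b, a) \<noteq> (Suc k, Suc (Suc k))" for a b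
    using that by (auto simp: Transposition.transpose_def)
  have rng: "1 \<le> ?s a \<and> ?s a \<le> n \<longleftrightarrow> 1 \<le> a \<and> a \<le> n" for a
    using assms(2) by (auto simp: Transposition.transpose_def)
  have "inversions n (w \<circ> ?s) = insert (Suc k, Suc (Suc k)) (?m ` inversions n w)" (is "?L = ?R")
    unfolding set_eq_iff
  proof
    fix x :: "nat \<times> nat"
    obtain a b where x: "x = (a, b)" by force
    have "x \<in> ?m ` inversions n w \<longleftrightarrow> (?s a, ?s b) \<in> inversions n w"
      unfolding x by (force simp: image_iff)
    also have "\<dots> \<longleftrightarrow> x \<in> ?L" if "x \<noteq> (Suc k, Suc (Suc k))" "(b, a) \<noteq> (Suc k, Suc (Suc k))"
    proof -
      have "?s a < ?s b \<longleftrightarrow> a < b" using lt[of a b] that x by simp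
      then have "1 \<le> ?s a \<and> ?s a < ?s b \<and> ?s b \<le> n \<longleftrightarrow> 1 \<le> a \<and> a < b \<and> b \<le> n"
        using rng[of a] rng[of b] by linarith
      then show ?thesis unfolding x inversions_def by (simp only: mem_Collect_eq prod.case o_apply) blast
    qed
    finally have 1: "x \<in> ?m ` inversions n w \<longleftrightarrow> x \<in> ?L"
      if "x \<noteq> (Suc k, Suc (Suc k))" "(b, a) \<noteq> (Suc k, Suc (Suc k))" using that by blast
    have 2: "x \<notin> ?L" "x \<notin> ?R" if "(b, a) = (Suc k, Suc (Suc k))"
      using that x assms(1) by (auto simp: inversions_def Transposition.transpose_def split: if_splits)
    have 3: "x \<in> ?L" if "x = (Suc k, Suc (Suc k))" using that assms by (auto simp: inversions_def)
    show "x \<in> ?L \<longleftrightarrow> x \<in> ?R" using 1 2 3 by blast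
  qed
  moreover have "(Suc k, Suc (Suc k)) \<notin> ?m ` inversions n w"
    by (auto simp: inversions_def Transposition.transpose_def split: if_splits)
  moreover have "inj ?m" by (auto simp: inj_on_def transpose_eq_iff)
  ultimately show ?thesis
    by (simp add: card_image inj_on_subset)
qed

lemma inversions_comp_simple_descent:
  assumes "w (Suc (Suc k)) < w (Suc k)" "Suc k < n"
  shows "Suc (card (inversions n (w \<circ> simple k))) = card (inversions n w)"
  using inversions_comp_simple[of "w \<circ> simple k" k n] assms by (simp add: comp_assoc)

text \<open>By induction on \<open>b\<close>: conjugation by the simple reflection at \<open>b - 1\<close> and \<open>b\<close> shortens the
  transposition, and this reflection changes the number of inversions by exactly 1 on either side.\<close>

lemma inversions_comp_transpose:
  assumes "w permutes {1..n}" "1 \<le> a" "a < b" "b \<le> n" "w a < w b"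
  shows "card (inversions n w) < card (inversions n (w \<circ> Transposition.transpose a b))"
  using assms
proof (induction b arbitrary: w)
  case (Suc b)
  show ?case
  proof (cases "b = a")
    case True
    then obtain k where "a = Suc k" using Suc.prems by (cases a) auto
    then have "card (inversions n (w \<circ> simple k)) = Suc (card (inversions n w))"
      using True Suc.prems by (intro inversions_comp_simple) auto
    then show ?thesis unfolding True \<open>a = Suc k\<close> by linarith
  next
    case False
    then obtain k where k: "b = Suc k" using Suc.prems by (cases b) auto
    let ?y = "w \<circ> simple k"
    have ab: "a < b" using False Suc.prems by auto
    have py: "?y permutes {1..n}" using Suc.prems k by (intro permutes_comp_simple) auto
    have ya: "?y a = w a" using ab k by (auto simp: Transposition.transpose_def)
    have IH: "card (inversions n ?y) < card (inversions n (?y \<circ> Transposition.transpose a b))"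
      using Suc.prems ab k ya by (intro Suc.IH[OF py]) auto
    have eq: "w \<circ> Transposition.transpose a (Suc b) = (?y \<circ> Transposition.transpose a b) \<circ> simple k"
      using ab k by (auto simp: fun_eq_iff Transposition.transpose_def)
    let ?z = "?y \<circ> Transposition.transpose a b"
    have z: "?z (Suc k) = w a" "?z (Suc (Suc k)) = w (Suc k)"
      using ab k by (auto simp: Transposition.transpose_def)
    have pz: "?z permutes {1..n}" using py Suc.prems ab k by (intro permutes_comp_transpose) auto
    show ?thesis
    proof (cases "w (Suc k) < w (Suc (Suc k))")
      case True
      then have "card (inversions n ?y) = Suc (card (inversions n w))"
        using Suc.prems k by (intro inversions_comp_simple) auto
      moreover have "card (inversions n ?z) \<le> Suc (card (inversions n (?z \<circ> simple k)))"
        using inversions_comp_simple[of ?z k n] inversions_comp_simple_descent[of ?z k n]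
          permutes_neq[OF pz, of "Suc k" "Suc (Suc k)"] Suc.prems k
        by (cases "?z (Suc k) < ?z (Suc (Suc k))") auto
      ultimately show ?thesis unfolding eq using IH by linarith
    next
      case F: False
      then have gt: "w (Suc (Suc k)) < w (Suc k)"
        using permutes_neq[OF Suc.prems(1), of "Suc k" "Suc (Suc k)"] by auto
      then have "Suc (card (inversions n ?y)) = card (inversions n w)"
        using Suc.prems k by (intro inversions_comp_simple_descent) auto
      moreover have "card (inversions n (?z \<circ> simple k)) = Suc (card (inversions n ?z))"
      proof (rule inversions_comp_simple)
        show "?z (Suc k) < ?z (Suc (Suc k))" unfolding z using Suc.prems(5) k gt by simp
      qed (use Suc.prems k in simp)
      ultimately show ?thesis unfolding eq using IH by linarith
    qed
  qed
qed simp

lemma inversions_comp_simple_le: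
  assumes "w permutes {1..n}" "Suc k < n"
  shows "card (inversions n (w \<circ> simple k)) \<le> Suc (card (inversions n w))"
  using inversions_comp_simple[of w k n] inversions_comp_simple_descent[of w k n] assms(2)
    permutes_neq[OF assms(1), of "Suc k" "Suc (Suc k)"]
  by (cases "w (Suc k) < w (Suc (Suc k))") auto

text \<open>An increasing permutation satisfies \<open>c \<le> w c\<close> by induction from the left and \<open>w c \<le> c\<close> by
  induction from the right.\<close>

lemma no_descent_imp_id:
  assumes w: "w permutes {1..n}" and asc: "\<And>k. Suc k < n \<Longrightarrow> w (Suc k) < w (Suc (Suc k))"
  shows "w = id"
proof -
  have step: "w a < w b" if "1 \<le> a" "a < b" "b \<le> n" for a b
    using that
  proof (induction b)
    case (Suc b)
    obtain k where k: "b = Suc k" using Suc.prems by (cases b) auto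
    have "w b < w (Suc b)" using asc[of k] Suc.prems k by simp
    then show ?case using Suc by (cases "a = b") auto
  qed simp
  have ge: "c \<le> w c" if "1 \<le> c" "c \<le> n" for c
    using that
  proof (induction c)
    case (Suc c)
    show ?case
    proof (cases "c = 0")
      case True
      then show ?thesis using permutes_ivl_le[OF w Suc.prems] by simp
    next
      case False
      then show ?thesis using Suc step[of c "Suc c"] by fastforce
    qed
  qed simp
  have le: "w (n - d) \<le> n - d" if "d < n" for d
    using that
  proof (induction d)
    case 0
    then show ?case using permutes_ivl_le[OF w, of n] by simp
  next
    case (Suc d)
    then show ?case using step[of "n - Suc d" "n - d"] by fastforce
  qed
  have "w c = c" for c
  proof (cases "1 \<le> c \<and> c \<le> n")
    case True
    then show ?thesis using ge[of c] le[of "n - c"] by simp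
  next
    case False
    then show ?thesis using permutes_not_in[OF w, of c] by auto
  qed
  then show ?thesis by (simp add: fun_eq_iff)
qed

lemma foldr_comp_append: "foldr (\<circ>) (xs @ [x]) id = foldr (\<circ>) xs id \<circ> x"
  by (induction xs) (simp_all add: comp_assoc)

lemma S_std_eq: "S_std n = {simple k | k. Suc k < n}"
proof -
  have "(\<exists>i. x = Transposition.transpose i (i + 1) \<and> 1 \<le> i \<and> i \<le> n - 1) \<longleftrightarrow> (\<exists>k. x = simple k \<and> Suc k < n)" for x
  proof
    assume "\<exists>i. x = Transposition.transpose i (i + 1) \<and> 1 \<le> i \<and> i \<le> n - 1"
    then obtain i where "x = Transposition.transpose i (i + 1)" "1 \<le> i" "i \<le> n - 1" by blast
    then show "\<exists>k. x = simple k \<and> Suc k < n" by (intro exI[of _ "i - 1"]) auto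
  next
    assume "\<exists>k. x = simple k \<and> Suc k < n"
    then obtain k where "x = simple k" "Suc k < n" by blast
    then show "\<exists>i. x = Transposition.transpose i (i + 1) \<and> 1 \<le> i \<and> i \<le> n - 1"
      by (intro exI[of _ "Suc k"]) auto
  qed
  then show ?thesis unfolding S_std_def by simp
qed

lemma word_S_std:
  assumes "set ss \<subseteq> S_std n"
  shows "foldr (\<circ>) ss id permutes {1..n} \<and> card (inversions n (foldr (\<circ>) ss id)) \<le> length ss"
  using assms
proof (induction ss rule: rev_induct)
  case Nil
  have "inversions n (\<lambda>a. a) = {}" by (auto simp: inversions_def)
  then show ?case by (simp add: permutes_id[unfolded id_def])
next
  case (snoc s ss)
  then obtain k where k: "s = simple k" "Suc k < n" by (auto simp: S_std_eq)
  let ?w = "foldr (\<circ>) ss id"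
  have w: "?w permutes {1..n}" and le: "card (inversions n ?w) \<le> length ss"
    using snoc.IH snoc.prems unfolding set_append by blast+
  show ?case unfolding foldr_comp_append k(1)
  proof
    show "?w \<circ> simple k permutes {1..n}" by (rule permutes_comp_simple[OF w k(2)])
    have "length (ss @ [simple k]) = Suc (length ss)" by simp
    then show "card (inversions n (?w \<circ> simple k)) \<le> length (ss @ [simple k])"
      using inversions_comp_simple_le[OF w k(2)] le by linarith
  qed
qed

lemma reduced_word_exists:
  assumes "w permutes {1..n}"
  shows "\<exists>ss. length ss = card (inversions n w) \<and> set ss \<subseteq> S_std n \<and> foldr (\<circ>) ss id = w"
  using assms
proof (induction "card (inversions n w)" arbitrary: w rule: less_induct)
  case less
  show ?case
  proof (cases "w = id")
    case True
    have "inversions n id = {}" by (auto simp: inversions_def)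
    then show ?thesis using True by (intro exI[of _ "[]"]) simp
  next
    case False
    then obtain k where k: "Suc k < n" "w (Suc (Suc k)) < w (Suc k)"
      using no_descent_imp_id[OF less.prems] permutes_neq[OF less.prems, of "Suc _" "Suc (Suc _)"]
      by (metis linorder_less_linear n_not_Suc_n)
    have inv: "Suc (card (inversions n (w \<circ> simple k))) = card (inversions n w)"
      using k by (intro inversions_comp_simple_descent)
    obtain ss where ss: "length ss = card (inversions n (w \<circ> simple k))" "set ss \<subseteq> S_std n"
      "foldr (\<circ>) ss id = w \<circ> simple k"
      using less.hyps[OF _ permutes_comp_simple[OF less.prems k(1)]] inv by auto
    have "foldr (\<circ>) (ss @ [simple k]) id = w"
      unfolding foldr_comp_append ss(3) by (simp add: comp_assoc)
    then show ?thesis using ss inv k(1) by (intro exI[of _ "ss @ [simple k]"]) (auto simp: S_std_eq)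
  qed
qed

text \<open>Right multiplication by a simple reflection changes the number of inversions by at most 1,
  and by exactly -1 at a descent, so a shortest word is found by removing descents.\<close>

lemma cox_length_S_std:
  assumes "w permutes {1..n}"
  shows "cox_length (sym_group n) (S_std n) w = card (inversions n w)"
  unfolding cox_length_def sym_group_mult sym_group_one
proof (rule Least_equality)
  show "\<exists>ss. length ss = card (inversions n w) \<and> set ss \<subseteq> S_std n \<and> foldr (\<circ>) ss id = w"
    by (rule reduced_word_exists[OF assms])
  show "card (inversions n w) \<le> k"
    if "\<exists>ss. length ss = k \<and> set ss \<subseteq> S_std n \<and> foldr (\<circ>) ss id = w" for k
    using that word_S_std by blast
qed

lemma comp_transpose_inv:
  assumes "x permutes A"
  shows "x \<circ> Transposition.transpose a b \<circ> inv' x = Transposition.transpose (x a) (x b)"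
proof -
  have "x (Transposition.transpose a b d) = Transposition.transpose (x a) (x b) (x d)" for d
    using permutes_inj[OF assms] by (auto simp: Transposition.transpose_def inj_eq)
  from this[of "inv' x _"] show ?thesis
    using permutes_inverses(1)[OF assms] by (simp add: fun_eq_iff)
qed

lemma sym_group_inv: "x permutes {1..n} \<Longrightarrow> m_inv (sym_group n) x = inv' x"
  by (rule group.inv_equality[OF sym_group_is_group])
    (simp_all add: sym_group_def permutes_inv permutes_inv_o)

text \<open>The transposition of \<open>a\<close> and \<open>b\<close> is the conjugate of the simple reflection at \<open>a\<close> and \<open>a + 1\<close>
  by the transposition of \<open>a + 1\<close> and \<open>b\<close>.\<close>

lemma cox_reflections_S_std:
  "cox_reflections (sym_group n) (S_std n) = {Transposition.transpose a b | a b. 1 \<le> a \<and> a < b \<and> b \<le> n}"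
    (is "_ = ?T")
proof (intro equalityI subsetI)
  fix t assume "t \<in> cox_reflections (sym_group n) (S_std n)"
  then obtain x s where x: "x permutes {1..n}" and s: "s \<in> S_std n"
    and t: "t = x \<circ> s \<circ> inv' x"
    unfolding cox_reflections_def by (auto simp: sym_group_carrier sym_group_inv sym_group_mult)
  obtain k where k: "s = simple k" "Suc k < n" using s by (auto simp: S_std_eq)
  let ?a = "x (Suc k)" and ?b = "x (Suc (Suc k))"
  have t': "t = Transposition.transpose ?a ?b" unfolding t k by (rule comp_transpose_inv[OF x])
  have "?a \<noteq> ?b" using permutes_neq[OF x] by auto
  moreover have "1 \<le> ?a \<and> ?a \<le> n" "1 \<le> ?b \<and> ?b \<le> n"
    using permutes_ivl_le[OF x] k by auto
  ultimately show "t \<in> ?T" unfolding t' 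
    using linorder_neqE_nat[of ?a ?b] transpose_commute[of ?a ?b] by (metis (mono_tags, lifting) mem_Collect_eq)
next
  fix t assume "t \<in> ?T"
  then obtain a b where ab: "1 \<le> a" "a < b" "b \<le> n" and t: "t = Transposition.transpose a b" by blast
  obtain k where k: "a = Suc k" using ab by (cases a) auto
  let ?x = "Transposition.transpose (Suc a) b"
  have x: "?x permutes {1..n}" using ab by (intro permutes_swap_id) auto
  have "t = ?x \<circ> simple k \<circ> inv' ?x"
    unfolding comp_transpose_inv[OF x] t using ab k by (auto simp: Transposition.transpose_def)
  moreover have "simple k \<in> S_std n" using ab k by (auto simp: S_std_eq)
  ultimately show "t \<in> cox_reflections (sym_group n) (S_std n)"
    unfolding cox_reflections_def mem_Collect_eq
    by (intro exI[of _ ?x] exI[of _ "simple k"] conjI)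
      (simp_all only: sym_group_mult sym_group_inv[OF x] sym_group_carrier x)
qed

lemma bruhat_le_imp_dominated:
  assumes "bruhat_le (sym_group n) (S_std n) y w"
  shows "dominated y w"
  using assms unfolding bruhat_le_def
proof (induction rule: rtranclp_induct)
  case (step w z)
  from step.hyps(2) obtain a b where w: "w permutes {1..n}" and ab: "1 \<le> a" "a < b" "b \<le> n"
    and z: "z = w \<circ> Transposition.transpose a b"
    and len: "cox_length (sym_group n) (S_std n) w < cox_length (sym_group n) (S_std n) z"
    by (auto simp: cox_reflections_S_std sym_group_carrier sym_group_mult)
  have pz: "z permutes {1..n}" unfolding z using w ab by (intro permutes_comp_transpose) auto
  have "w a < w b"
  proof (rule ccontr)
    assume "\<not> ?thesis"
    then have "z a < z b" using permutes_neq[OF w, of a b] ab z by auto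
    then have "card (inversions n z) < card (inversions n (z \<circ> Transposition.transpose a b))"
      using ab by (intro inversions_comp_transpose[OF pz]) auto
    then show False using len w pz unfolding z by (simp add: cox_length_S_std comp_assoc)
  qed
  then have "dominated w z"
    unfolding dominated_def z using ab by (simp add: exceed_comp_transpose)
  with step.IH show ?case by (rule dominated_trans)
qed simp

lemma bruhat_le_step:
  assumes "y \<in> carrier W" "t \<in> cox_reflections W S" "z = y \<otimes>\<^bsub>W\<^esub> t"
    "cox_length W S y < cox_length W S z" "bruhat_le W S z w"
  shows "bruhat_le W S y w"
  using assms(5) unfolding bruhat_le_def
  by (rule converse_rtranclp_into_rtranclp[rotated]) (use assms(1-4) in blast)

lemma dominated_imp_bruhat_le:
  assumes "y permutes {1..n}" "w permutes {1..n}" "dominated y w"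
  shows "bruhat_le (sym_group n) (S_std n) y w"
  using assms
proof (induction "n * n - card (inversions n y)" arbitrary: y rule: less_induct)
  case less
  show ?case
  proof (cases "y = w")
    case True
    then show ?thesis by (simp add: bruhat_le_def)
  next
    case False
    then obtain a b where ab: "1 \<le> a" "a < b" "b \<le> n" "y a < y b"
      and dom: "dominated (y \<circ> Transposition.transpose a b) w"
      using dominated_step[OF less.prems(1,2,3)] by metis
    let ?z = "y \<circ> Transposition.transpose a b"
    have z: "?z permutes {1..n}" using less.prems ab by (intro permutes_comp_transpose) auto
    have inv: "card (inversions n y) < card (inversions n ?z)"
      using ab by (intro inversions_comp_transpose[OF less.prems(1)])
    have "bruhat_le (sym_group n) (S_std n) ?z w"
      using inv card_inversions_le[of n ?z] by (intro less.hyps[OF _ z less.prems(2) dom]) linarith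
    then show ?thesis
    proof (rule bruhat_le_step[rotated 4])
      show "y \<in> carrier (sym_group n)" using less.prems(1) by (simp add: sym_group_carrier)
      show "?z = y \<otimes>\<^bsub>sym_group n\<^esub> Transposition.transpose a b" by (simp only: sym_group_mult)
      show "Transposition.transpose a b \<in> cox_reflections (sym_group n) (S_std n)"
        unfolding cox_reflections_S_std using ab by blast
      show "cox_length (sym_group n) (S_std n) y < cox_length (sym_group n) (S_std n) ?z"
        unfolding cox_length_S_std[OF less.prems(1)] cox_length_S_std[OF z] by (rule inv)
    qed
  qed
qed

text \<open>Ehresmann's criterion. In one direction every length-increasing reflection raises counts; in
  the other the steps of \<open>dominated_step\<close> increase the length and must end at \<open>w\<close>.\<close>

theorem bruhat_le_iff_dominated:
  assumes "y permutes {1..n}" "w permutes {1..n}"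
  shows "bruhat_le (sym_group n) (S_std n) y w \<longleftrightarrow> dominated y w"
  using assms bruhat_le_imp_dominated dominated_imp_bruhat_le by blast

section \<open>Decorated permutations\<close>

text \<open>The combinatorial name of a \<open>B_{n-1}\<close>-orbit. By the Bruhat decomposition a flag \<open>F\<close> is
  spanned in the order \<open>w\<close> by a basis \<open>b_1, \<dots>, b_n\<close> adapted to \<open>E_+\<close>. The orbit depends on \<open>F\<close> and
  on the vector \<open>e_n\<close>, which is normalised to a sum of \<open>b_{w(c)}\<close> over a set \<open>P\<close> of positions: a
  summand \<open>b_k\<close> can be removed as soon as another summand has both a larger index and a later
  position, so \<open>w\<close> decreases on \<open>P\<close>, and the first position in \<open>P\<close> is the one with value \<open>n\<close>.\<close>

definition decorated :: "nat \<Rightarrow> (nat \<Rightarrow> nat) \<Rightarrow> nat set \<Rightarrow> bool" where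
  "decorated n w P \<longleftrightarrow> w permutes {1..n} \<and> P \<subseteq> {1..n} \<and> (\<exists>p\<in>P. w p = n)
     \<and> (\<forall>c\<in>P. \<forall>c'\<in>P. c < c' \<longrightarrow> w c' < w c)"

text \<open>The value of \<open>w\<close> at the first position of \<open>P\<close> after \<open>i\<close>, with 0 when there is none; since \<open>w\<close>
  decreases on \<open>P\<close> this is a maximum.\<close>

definition next_value :: "(nat \<Rightarrow> nat) \<Rightarrow> nat set \<Rightarrow> nat \<Rightarrow> nat" where
  "next_value w P i = Max (insert 0 (w ` {c \<in> P. i < c}))"

text \<open>The type of the orbit with respect to \<open>E*\<close>. It arises from \<open>w\<close> by moving each value on \<open>P\<close> to
  the previous position in \<open>P\<close> and letting \<open>n\<close> reappear at the last one. Values are renamed by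
  their rank in the order \<open>n, 1, 2, \<dots>, n - 1\<close>, hence the successor, and the rank 1 for the value
  \<open>n\<close>, which \<open>next_value\<close> represents by 0.\<close>

definition partner :: "nat \<Rightarrow> (nat \<Rightarrow> nat) \<Rightarrow> nat set \<Rightarrow> nat \<Rightarrow> nat" where
  "partner n w P c = (if c \<in> P then Suc (next_value w P c) else if c \<in> {1..n} then Suc (w c) else c)"

lemma decorated_finite: "decorated n w P \<Longrightarrow> finite P"
  unfolding decorated_def using finite_subset by blast

lemma next_value_le_iff:
  assumes "finite P"
  shows "next_value w P i \<le> j \<longleftrightarrow> (\<forall>c\<in>P. i < c \<longrightarrow> w c \<le> j)"
  using assms by (auto simp: next_value_def)

lemma le_next_value: "finite P \<Longrightarrow> c \<in> P \<Longrightarrow> i < c \<Longrightarrow> w c \<le> next_value w P i"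
  by (auto simp: next_value_def)

lemma next_value_cases:
  assumes "finite P"
  obtains "next_value w P i = 0" | c where "c \<in> P" "i < c" "next_value w P i = w c"
proof -
  have "next_value w P i \<in> insert 0 (w ` {c \<in> P. i < c})"
    unfolding next_value_def using assms by (intro Max_in) auto
  then show thesis using that by blast
qed

lemma next_value_antimono: "finite P \<Longrightarrow> i \<le> i' \<Longrightarrow> next_value w P i' \<le> next_value w P i"
  by (auto simp: next_value_le_iff intro: le_next_value)

lemma next_value_less:
  assumes "decorated n w P" "c \<in> P"
  shows "next_value w P c < w c"
proof (rule next_value_cases[OF decorated_finite[OF assms(1)], of w c])
  assume "next_value w P c = 0"
  moreover have "1 \<le> w c" using assms permutes_ivl_le[of w n c] unfolding decorated_def by auto
  ultimately show ?thesis by simp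
qed (use assms in \<open>auto simp: decorated_def\<close>)

lemma next_value_pred:
  assumes "decorated n w P" "Suc i \<in> P"
  shows "next_value w P i = w (Suc i)"
proof (rule antisym)
  have fin: "finite P" using assms decorated_finite by blast
  show "next_value w P i \<le> w (Suc i)"
    unfolding next_value_le_iff[OF fin]
    using assms unfolding decorated_def by (metis Suc_lessI less_imp_le order_refl)
  show "w (Suc i) \<le> next_value w P i" using assms(2) fin by (intro le_next_value) auto
qed

lemma next_value_pred_notin:
  assumes "Suc i \<notin> P"
  shows "next_value w P i = next_value w P (Suc i)"
proof -
  have "{c \<in> P. i < c} = {c \<in> P. Suc i < c}" using assms by (auto simp: Suc_lessI intro: Suc_lessD) (metis Suc_lessI)
  then show ?thesis by (simp add: next_value_def)
qed

lemma next_value_0: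
  assumes "decorated n w P"
  shows "next_value w P 0 = n"
proof (rule antisym)
  have fin: "finite P" using assms decorated_finite by blast
  have rng: "1 \<le> w c \<and> w c \<le> n" if "c \<in> P" for c
    using that assms permutes_ivl_le[of w n c] unfolding decorated_def by auto
  show "next_value w P 0 \<le> n"
    unfolding next_value_le_iff[OF fin] using rng by auto
  obtain p where "p \<in> P" "w p = n" using assms unfolding decorated_def by auto
  then show "n \<le> next_value w P 0" using le_next_value[OF fin, of p 0 w] assms
    unfolding decorated_def by auto
qed

section \<open>Pairs of permutations whose rank counts interlace\<close>

text \<open>For a flag \<open>F\<close> of types \<open>w\<close> and \<open>v\<close>, the difference of the two counts is
  \<open>dim (F_i \<inter> (E_j + L)) - dim (F_i \<inter> E_j)\<close> with \<open>L\<close> spanned by \<open>e_n\<close>. It is 1 if \<open>L \<subseteq> F_i + E_j\<close>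
  and 0 otherwise, and the condition persists when \<open>i\<close> or \<open>j\<close> grows. The threshold function \<open>f\<close>
  encodes this monotonicity.\<close>

definition interlaced :: "nat \<Rightarrow> (nat \<Rightarrow> nat) \<Rightarrow> (nat \<Rightarrow> nat) \<Rightarrow> bool" where
  "interlaced n w v \<longleftrightarrow> (\<exists>f. (\<forall>i i'. i \<le> i' \<longrightarrow> f i' \<le> f i) \<and>
     (\<forall>i\<le>n. \<forall>j<n. exceed w i j = exceed v i (Suc j) + of_bool (f i \<le> j)))"

text \<open>Induction on \<open>i\<close>. At a position outside \<open>P\<close> nothing changes; at a position in \<open>P\<close> the two
  counts test \<open>j\<close> against two successive values on \<open>P\<close>, and these are the values of \<open>next_value\<close>
  before and after.\<close>

lemma exceed_partner:
  assumes "decorated n w P" "i \<le> n" "j < n"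
  shows "exceed w i j = exceed (partner n w P) i (Suc j) + of_bool (next_value w P i \<le> j)"
  using assms(2)
proof (induction i)
  case 0
  show ?case using next_value_0[OF assms(1)] assms(3) by simp
next
  case (Suc i)
  show ?case
  proof (cases "Suc i \<in> P")
    case True
    then show ?thesis using Suc next_value_pred[OF assms(1) True] next_value_less[OF assms(1) True]
      by (auto simp: exceed_Suc partner_def split: if_splits)
  next
    case False
    then show ?thesis using Suc next_value_pred_notin[OF False, of w]
      by (auto simp: exceed_Suc partner_def split: if_splits)
  qed
qed

lemma interlaced_partner: "decorated n w P \<Longrightarrow> interlaced n w (partner n w P)"
  unfolding interlaced_def using exceed_partner next_value_antimono decorated_finite by metis

lemma partner_permutes:
  assumes dec: "decorated n w P"
  shows "partner n w P permutes {1..n}"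
proof (rule bij_imp_permutes)
  have fin: "finite P" and w: "w permutes {1..n}" and P: "P \<subseteq> {1..n}"
    using dec decorated_finite unfolding decorated_def by auto
  let ?v = "partner n w P"
  have wle: "1 \<le> w c \<and> w c \<le> n" if "c \<in> {1..n}" for c using permutes_ivl_le[OF w] that by auto
  have into: "?v c \<in> {1..n}" if c: "c \<in> {1..n}" for c
  proof (cases "c \<in> P")
    case True
    then show ?thesis using next_value_less[OF dec True] wle[OF c] by (simp add: partner_def)
  next
    case False
    then have "w c \<noteq> n" using dec permutes_neq[OF w] unfolding decorated_def by metis
    then show ?thesis using False c wle[OF c] by (simp add: partner_def)
  qed
  have PP: "next_value w P c \<noteq> next_value w P c'" if "c \<in> P" "c' \<in> P" "c < c'" for c c'
    using le_next_value[OF fin that(2,3), of w] next_value_less[OF dec that(2)] by simp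
  have PN: "next_value w P c \<noteq> w c'" if "c' \<notin> P" "c' \<in> {1..n}" for c c'
  proof (rule next_value_cases[OF fin, of w c])
    fix d assume "d \<in> P" "next_value w P c = w d"
    then show ?thesis using that(1) permutes_neq[OF w, of d c'] by metis
  qed (use wle[OF that(2)] in auto)
  have "inj_on ?v {1..n}"
  proof (rule inj_onI)
    fix c c' assume c: "c \<in> {1..n}" "c' \<in> {1..n}" and eq: "?v c = ?v c'"
    show "c = c'"
      using eq c PP[of c c'] PP[of c' c] PN[of c c'] PN[of c' c] permutes_neq[OF w, of c c']
      by (cases "c \<in> P"; cases "c' \<in> P"; cases c c' rule: linorder_cases) (auto simp: partner_def)
  qed
  then show "bij_betw ?v {1..n} {1..n}"
    unfolding bij_betw_def using endo_inj_surj[of "{1..n}" ?v] into by blast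
  show "?v c = c" if "c \<notin> {1..n}" for c using that P by (auto simp: partner_def)
qed

text \<open>On \<open>P\<close> the value drops and elsewhere it is only renamed, so \<open>P\<close> can be read off from \<open>w\<close> and
  its partner.\<close>

lemma decoration_unique:
  assumes "decorated n w P" "decorated n w P'" "partner n w P = partner n w P'"
  shows "P = P'"
proof -
  have "R = {c \<in> {1..n}. partner n w R c \<noteq> Suc (w c)}" if "decorated n w R" for R
  proof (intro equalityI subsetI CollectI conjI)
    fix c assume c: "c \<in> R"
    show "c \<in> {1..n}" using that c unfolding decorated_def by blast
    show "partner n w R c \<noteq> Suc (w c)" using next_value_less[OF that c] c by (simp add: partner_def)
  next
    fix c assume "c \<in> {c \<in> {1..n}. partner n w R c \<noteq> Suc (w c)}"
    then show "c \<in> R" by (auto simp: partner_def split: if_splits)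
  qed
  from this[OF assms(1)] this[OF assms(2)] assms(3) show ?thesis by metis
qed

text \<open>If \<open>y\<close> and \<open>w\<close> both descend at \<open>k\<close> and \<open>y\<close> is below \<open>w\<close> but not below \<open>w s\<close>, some column \<open>j\<close>
  witnesses it, and there the counts of \<open>y\<close> and \<open>w\<close> agree in three successive rows: the first of
  the two positions has a value above \<open>j\<close>, the second has not, for \<open>y\<close> and for \<open>w\<close>.\<close>

lemma exceed_lift_fail:
  assumes "dominated y w" "w (Suc (Suc k)) < w (Suc k)" "y (Suc (Suc k)) < y (Suc k)"
    and "\<not> dominated y (w \<circ> simple k)"
  obtains j where "exceed y k j = exceed w k j" "exceed w (Suc k) j = exceed w k j + 1"
    "exceed y (Suc k) j = exceed w k j + 1" "exceed w (Suc (Suc k)) j = exceed w k j + 1"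
    "exceed y (Suc (Suc k)) j = exceed w k j + 1"
    "exceed (w \<circ> simple k) (Suc k) j = exceed w k j" "exceed (y \<circ> simple k) (Suc k) j = exceed w k j"
proof -
  obtain i j where ij: "exceed (w \<circ> simple k) i j < exceed y i j"
    using assms(4) by (auto simp: dominated_def not_le)
  have i: "i = Suc k"
  proof (rule ccontr)
    assume "i \<noteq> Suc k"
    then show False using ij assms(1) unfolding dominated_def by (simp add: exceed_comp_simple leD)
  qed
  have asc: "exceed (x \<circ> simple k) (Suc k) j = max (exceed x k j) (exceed x (Suc (Suc k)) j - 1)"
    if "x (Suc (Suc k)) < x (Suc k)" for x
    using exceed_ascent[of "x \<circ> simple k" k j] that by (simp add: exceed_comp_simple)
  have le: "exceed y k j \<le> exceed w k j" "exceed y (Suc (Suc k)) j \<le> exceed w (Suc (Suc k)) j"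
    using assms(1) by (auto simp: dominated_def)
  have low: "exceed w k j < exceed y (Suc k) j" "exceed w (Suc (Suc k)) j \<le> exceed y (Suc k) j"
    using ij[unfolded i asc[OF assms(2)]] by auto
  have up: "exceed y (Suc k) j \<le> exceed y k j + 1" "exceed y (Suc k) j \<le> exceed y (Suc (Suc k)) j"
    by (simp_all add: exceed_Suc)
  have eq: "exceed y k j = exceed w k j" "exceed y (Suc k) j = exceed w k j + 1"
    "exceed w (Suc (Suc k)) j = exceed w k j + 1" "exceed y (Suc (Suc k)) j = exceed w k j + 1"
    using le low up by linarith+
  show thesis
    by (rule that[of j]) (simp_all add: eq asc[OF assms(2)] asc[OF assms(3)] exceed_descent[OF assms(2)])
qed

lemma exceed_le_right: "exceed w i j \<le> exceed w (Suc i) j"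
  by (simp add: exceed_Suc)

lemma exceed_positive: "0 < exceed w i j \<Longrightarrow> \<exists>c. 1 \<le> c \<and> c \<le> i \<and> j < w c"
  unfolding exceed_def card_gt_0_iff by auto

text \<open>This covers the only case of the main induction in which lifting in the two Bruhat orders
  separately does not suffice. The hypotheses describe two orbits with a common descent \<open>k\<close>, when
  the line through the first, of types \<open>(w, v)\<close>, has one exceptional point and the line through
  the second, of types \<open>(w', v')\<close>, has two. If neither conclusion held, \<open>exceed_lift_fail\<close> would
  give a column \<open>j\<close> for \<open>w'\<close> and \<open>w\<close> and a column \<open>l + 1\<close> for \<open>v'\<close> and \<open>v\<close>. The differences of
  counts, being 0 or 1 and monotone, then force \<open>l < j\<close> and contradictory counts for \<open>w\<close> and \<open>w'\<close>
  in column \<open>l\<close> at row \<open>k + 2\<close>.\<close>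

lemma interlaced_descent:
  assumes k: "Suc k < n"
    and perm: "w permutes {1..n}" "v permutes {1..n}" "w' permutes {1..n}" "v' permutes {1..n}"
    and desc: "w (Suc (Suc k)) < w (Suc k)" "v (Suc (Suc k)) < v (Suc k)"
      "w' (Suc (Suc k)) < w' (Suc k)" "v' (Suc (Suc k)) < v' (Suc k)"
    and dom: "dominated w' w" "dominated v' v"
    and unram: "interlaced n w v" "interlaced n (w \<circ> simple k) (v \<circ> simple k)"
    and ram: "interlaced n w' v'" "interlaced n (w' \<circ> simple k) v'" "interlaced n w' (v' \<circ> simple k)"
  shows "dominated w' (w \<circ> simple k) \<or> dominated v' (v \<circ> simple k)"
proof (rule ccontr)
  assume neg: "\<not> ?thesis"
  let ?s = "simple k"
  obtain j where j: "exceed w' k j = exceed w k j" "exceed w (Suc k) j = exceed w k j + 1"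
    "exceed w' (Suc k) j = exceed w k j + 1" "exceed w (Suc (Suc k)) j = exceed w k j + 1"
    "exceed w' (Suc (Suc k)) j = exceed w k j + 1"
    "exceed (w \<circ> ?s) (Suc k) j = exceed w k j" "exceed (w' \<circ> ?s) (Suc k) j = exceed w k j"
    using exceed_lift_fail[OF dom(1) desc(1,3)] neg by blast
  obtain j0 where j0: "exceed v' k j0 = exceed v k j0" "exceed v (Suc k) j0 = exceed v k j0 + 1"
    "exceed v' (Suc k) j0 = exceed v k j0 + 1" "exceed v (Suc (Suc k)) j0 = exceed v k j0 + 1"
    "exceed v' (Suc (Suc k)) j0 = exceed v k j0 + 1"
    "exceed (v \<circ> ?s) (Suc k) j0 = exceed v k j0" "exceed (v' \<circ> ?s) (Suc k) j0 = exceed v k j0"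
    using exceed_lift_fail[OF dom(2) desc(2,4)] neg by blast
  have jn: "j < n"
  proof -
    obtain c where "1 \<le> c" "c \<le> Suc k" "j < w c" using exceed_positive[of w "Suc k" j] j(2) by auto
    then show ?thesis using permutes_ivl_le[OF perm(1), of c] k by simp
  qed
  have j0n: "j0 < n"
  proof -
    obtain c where "1 \<le> c" "c \<le> Suc k" "j0 < v c" using exceed_positive[of v "Suc k" j0] j0(2) by auto
    then show ?thesis using permutes_ivl_le[OF perm(2), of c] k by simp
  qed
  have "j0 \<noteq> 0"
  proof
    assume "j0 = 0"
    moreover have "0 < v (Suc (Suc k))" using permutes_ivl_le[OF perm(2), of "Suc (Suc k)"] k by simp
    ultimately show False using j0(2,4) by (simp add: exceed_Suc)
  qed
  then obtain l where l: "j0 = Suc l" by (cases j0) auto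
  have ln: "l < n" using j0n l by simp
  note j0 = j0[unfolded l]
  obtain f where f: "\<And>i i'. i \<le> i' \<Longrightarrow> f i' \<le> f i"
    "\<And>i j. i \<le> n \<Longrightarrow> j < n \<Longrightarrow> exceed w i j = exceed v i (Suc j) + of_bool (f i \<le> j)"
    using unram(1) unfolding interlaced_def by blast
  obtain f3 where f3: "\<And>i i'. i \<le> i' \<Longrightarrow> f3 i' \<le> f3 i"
    "\<And>i j. i \<le> n \<Longrightarrow> j < n \<Longrightarrow> exceed (w \<circ> ?s) i j = exceed (v \<circ> ?s) i (Suc j) + of_bool (f3 i \<le> j)"
    using unram(2) unfolding interlaced_def by blast
  obtain f' where f': "\<And>i i'. i \<le> i' \<Longrightarrow> f' i' \<le> f' i"
    "\<And>i j. i \<le> n \<Longrightarrow> j < n \<Longrightarrow> exceed w' i j = exceed v' i (Suc j) + of_bool (f' i \<le> j)"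
    using ram(1) unfolding interlaced_def by blast
  obtain f1 where f1: "\<And>i i'. i \<le> i' \<Longrightarrow> f1 i' \<le> f1 i"
    "\<And>i j. i \<le> n \<Longrightarrow> j < n \<Longrightarrow> exceed (w' \<circ> ?s) i j = exceed v' i (Suc j) + of_bool (f1 i \<le> j)"
    using ram(2) unfolding interlaced_def by blast
  obtain f2 where f2: "\<And>i i'. i \<le> i' \<Longrightarrow> f2 i' \<le> f2 i"
    "\<And>i j. i \<le> n \<Longrightarrow> j < n \<Longrightarrow> exceed w' i j = exceed (v' \<circ> ?s) i (Suc j) + of_bool (f2 i \<le> j)"
    using ram(3) unfolding interlaced_def by blast
  have kn: "k \<le> n" "Suc k \<le> n" "Suc (Suc k) \<le> n" using k by auto
  (* Passing from w' to w' s lowers the count at (k + 1, j) and leaves that of v' unchanged, so the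
     difference of counts drops from 1 to 0 there. *)
  have a1: "j < f1 (Suc k)" "f' (Suc k) \<le> j"
    using f1(2)[OF kn(2) jn] f'(2)[OF kn(2) jn] j(3,7) by (auto split: if_splits simp: of_bool_def)
  have a2: "exceed v' k (Suc j) = exceed w k j"
    using f1(2)[OF kn(1) jn] f1(1)[of k "Suc k"] a1(1) j(1)
    by (simp add: exceed_comp_simple)
  (* Likewise the passage from v' to v' s raises the difference at (k + 1, l) from 0 to 1. *)
  have a3: "l < f' (Suc k)" "f2 (Suc k) \<le> l"
    using f2(2)[OF kn(2) ln] f'(2)[OF kn(2) ln] j0(3,7) by (auto split: if_splits simp: of_bool_def)
  have lj: "l < j" using a1 a3 by simp
  have a4: "exceed w' (Suc (Suc k)) l = exceed v k (Suc l) + 2"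
    using f2(2)[OF kn(3) ln] f2(1)[of "Suc k" "Suc (Suc k)"] a3(2) j0(5)
    by (simp add: exceed_comp_simple)
  have "exceed v' k (Suc j) \<le> exceed v k (Suc j)" using dom(2) by (simp add: dominated_def)
  then have a5: "j < f k" "exceed v k (Suc j) = exceed w k j"
    using f(2)[OF kn(1) jn] a2 by (auto split: if_splits simp: of_bool_def)
  have a6: "exceed w k l = exceed v k (Suc l)" using f(2)[OF kn(1) ln] a5(1) lj by simp
  (* Otherwise both values of w at the two positions exceed l, and the pair (w s, v s) would have
     difference 1 at (k + 1, l), hence also at (k + 1, j), where the counts exclude it. *)
  have a7: "exceed w (Suc (Suc k)) l \<le> exceed w k l + 1"
  proof (rule ccontr)
    assume "\<not> ?thesis"
    then have "l < w (Suc k)" "l < w (Suc (Suc k))"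
      by (auto simp: exceed_Suc of_bool_def split: if_splits)
    then have "exceed (w \<circ> ?s) (Suc k) l = exceed w k l + 1"
      by (simp add: exceed_Suc exceed_comp_simple)
    then have "f3 (Suc k) \<le> l" using f3(2)[OF kn(2) ln] j0(6) a6 by (auto split: if_splits simp: of_bool_def)
    then have "exceed (w \<circ> ?s) (Suc k) j = exceed (v \<circ> ?s) (Suc k) (Suc j) + 1"
      using f3(2)[OF kn(2) jn] lj by simp
    moreover have "exceed v k (Suc j) \<le> exceed (v \<circ> ?s) (Suc k) (Suc j)"
      using exceed_le_right[of "v \<circ> ?s" k "Suc j"] by (simp add: exceed_comp_simple)
    ultimately show False using j(6) a5(2) by simp
  qed
  have "exceed w' (Suc (Suc k)) l \<le> exceed w (Suc (Suc k)) l" using dom(1) by (simp add: dominated_def)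
  then show False using a4 a6 a7 by simp
qed

text \<open>Suppose that \<open>P\<close> has a second position \<open>q\<close> after \<open>p\<close>. Since \<open>w\<close> and its partner have no
  common descent, the values strictly between \<open>p\<close> and \<open>q\<close> increase, starting above \<open>w q\<close>, because
  the partner has the value \<open>w q\<close> (renamed) at \<open>p\<close>. Then \<open>q - 1\<close> and \<open>q\<close> form a common descent.\<close>

lemma no_common_descent_imp_singleton:
  assumes dec: "decorated n w P" and p: "p \<in> P" "w p = n"
    and nocommon: "\<And>k. Suc k < n \<Longrightarrow> w (Suc (Suc k)) < w (Suc k) \<Longrightarrow>
      \<not> partner n w P (Suc (Suc k)) < partner n w P (Suc k)"
  shows "P = {p}"
proof (rule ccontr)
  assume ne: "P \<noteq> {p}"
  let ?v = "partner n w P"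
  have fin: "finite P" and w: "w permutes {1..n}" and P: "P \<subseteq> {1..n}"
    and dec': "\<And>c c'. c \<in> P \<Longrightarrow> c' \<in> P \<Longrightarrow> c < c' \<Longrightarrow> w c' < w c"
    using dec decorated_finite unfolding decorated_def by auto
  have v: "?v permutes {1..n}" by (rule partner_permutes[OF dec])
  have wn: "w c \<le> n" if "c \<in> P" for c using permutes_ivl_le[OF w, of c] that P by auto
  have right: "p \<le> c" if "c \<in> P" for c
    using dec'[OF that p(1)] wn[OF that] p(2) by (meson leD leI)
  define q where "q = Min {c \<in> P. p < c}"
  have "{c \<in> P. p < c} \<noteq> {}" using ne p(1) right by (metis (mono_tags, lifting) empty_iff insertI1
    is_singletonI' is_singleton_the_elem le_neq_implies_less mem_Collect_eq singletonD)
  then have "q \<in> {c \<in> P. p < c}" unfolding q_def using fin by (intro Min_in) auto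
  then have q: "q \<in> P" "p < q" by auto
  have between: "c \<notin> P" if "p < c" "c < q" for c
  proof
    assume "c \<in> P"
    then have "q \<le> c" unfolding q_def using fin that(1) by (intro Min_le) auto
    then show False using that(2) by simp
  qed
  have qn: "q \<le> n" "1 \<le> p" using q P p by auto
  have vp: "?v p = Suc (w q)"
  proof -
    have "next_value w P p = w q"
    proof (rule antisym)
      show "next_value w P p \<le> w q"
        unfolding next_value_le_iff[OF fin]
      proof (intro ballI impI)
        fix c assume "c \<in> P" "p < c"
        then show "w c \<le> w q" using between[of c] dec'[OF q(1), of c] by (cases c q rule: linorder_cases) auto
      qed
      show "w q \<le> next_value w P p" by (rule le_next_value[OF fin q])
    qed
    then show ?thesis using p by (simp add: partner_def)
  qed
  have vb: "?v c = Suc (w c)" if "p < c" "c < q" for c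
    using between[OF that] that qn by (simp add: partner_def)
  have vq: "?v q < Suc (w q)" using next_value_less[OF dec q(1)] q by (simp add: partner_def)
  have asc: "?v (Suc c) > ?v c" if "1 \<le> c" "c < n" "w (Suc c) < w c" for c
  proof -
    obtain k where "c = Suc k" using \<open>1 \<le> c\<close> by (cases c) auto
    then show ?thesis using nocommon[of k] that permutes_neq[OF v, of c "Suc c"]
      by (metis Suc_lessD linorder_neqE_nat n_not_Suc_n)
  qed
  have big: "w q < w c" if "p < c" "c < q" for c
    using that
  proof (induction c)
    case (Suc c)
    show ?case
    proof (cases "c = p")
      case True
      have "w (Suc p) < w p" using p(2) permutes_neq[OF w, of p "Suc p"] permutes_ivl_le[OF w, of "Suc p"]
        Suc.prems True qn by (simp add: le_neq_implies_less)
      then have "?v p < ?v (Suc p)" using asc[of p] qn Suc.prems True by simp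
      then show ?thesis using vp vb[of "Suc c"] Suc.prems True by simp
    next
      case False
      then have IH: "w q < w c" using Suc by simp
      have "\<not> w (Suc c) < w c"
        using asc[of c] vb[of c] vb[of "Suc c"] Suc.prems False qn by auto
      then show ?thesis using IH by simp
    qed
  qed simp
  obtain c where c: "q = Suc c" using q by (cases q) auto
  show False
  proof (cases "c = p")
    case True
    have "w q < w p" using dec'[OF p(1) q] .
    then show False using asc[of c] c True qn vp vq by simp
  next
    case False
    then have "p < c" "c < q" using c q by auto
    then show False using asc[of c] big[of c] vb[of c] c qn vq by simp
  qed
qed

text \<open>Domination by \<open>w\<close> moves the value \<open>n\<close>, the first position of \<open>P'\<close>, weakly to the right of
  \<open>p\<close>; domination by the partner moves the value 1 of the partner, the last position of \<open>P'\<close>,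
  weakly to the left of \<open>p\<close>.\<close>

lemma dominated_singleton:
  assumes dec: "decorated n w {p}" and dec': "decorated n w' P'"
    and dom: "dominated w' w" "dominated (partner n w' P') (partner n w {p})"
  shows "P' = {p}"
proof -
  have fin: "finite P'" using dec' decorated_finite by blast
  have w: "w permutes {1..n}" "w' permutes {1..n}" and p: "w p = n" "1 \<le> p" "p \<le> n" and P': "P' \<subseteq> {1..n}"
    using dec dec' unfolding decorated_def by auto
  obtain p' where p': "p' \<in> P'" "w' p' = n" using dec' unfolding decorated_def by auto
  have p'n: "1 \<le> p'" "p' \<le> n" using p' P' by auto
  have "p \<le> p'"
  proof (rule ccontr)
    assume lt: "\<not> p \<le> p'"
    have "{c \<in> {1..p'}. n - 1 < w c} = {}"
    proof -
      have "w c < n" if "c \<in> {1..p'}" for c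
        using that lt permutes_neq[OF w(1), of c p] permutes_ivl_le[OF w(1), of c] p by fastforce
      then show ?thesis by force
    qed
    then have "exceed w p' (n - 1) = 0" unfolding exceed_def by (simp only: card.empty)
    moreover have "p' \<in> {c \<in> {1..p'}. n - 1 < w' c}" using p' p'n by auto
    then have "0 < exceed w' p' (n - 1)" unfolding exceed_def card_gt_0_iff by (intro conjI) (blast, simp)
    ultimately show False using dom(1) unfolding dominated_def by (metis leD)
  qed
  moreover have "c \<le> p" if "c \<in> P'" for c
  proof (rule ccontr)
    assume "\<not> c \<le> p"
    then have nv: "1 \<le> next_value w' P' i" if "i \<le> p" for i
      using le_next_value[OF fin \<open>c \<in> P'\<close>, of i w'] that permutes_ivl_le[OF w(2), of c] P' \<open>c \<in> P'\<close>
      by fastforce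
    have big: "1 < partner n w' P' i" if "i \<in> {1..p}" for i
      using that nv[of i] permutes_ivl_le[OF w(2), of i] p by (simp add: partner_def)
    then have "{c \<in> {1..p}. 1 < partner n w' P' c} = {1..p}" by auto
    then have "exceed (partner n w' P') p 1 = p" unfolding exceed_def by simp
    moreover have "{c \<in> {1..p}. 1 < partner n w {p} c} \<subseteq> {1..p} - {p}"
    proof -
      have empty: "{c \<in> {p}. p < c} = {}" by auto
      have "next_value w {p} p = 0" unfolding next_value_def empty by simp
      then have "partner n w {p} p = 1" by (simp add: partner_def)
      then show ?thesis by auto
    qed
    then have "exceed (partner n w {p}) p 1 \<le> card ({1..p} - {p})"
      unfolding exceed_def by (intro card_mono) auto
    ultimately show False using dom(2) p unfolding dominated_def
      by (metis Diff_iff card_Diff1_less card_atLeastAtMost diff_Suc_1 finite_atLeastAtMost leD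
          atLeastAtMost_iff order_le_less_trans order_refl)
  qed
  moreover have "p' \<le> c" if "c \<in> P'" for c
  proof (rule ccontr)
    assume "\<not> p' \<le> c"
    then have "n < w' c" using dec' p' that unfolding decorated_def by (metis not_le)
    then show False using permutes_ivl_le[OF w(2), of c] that P' by auto
  qed
  ultimately have "c = p" if "c \<in> P'" for c using that by (meson antisym order_trans)
  then show ?thesis using p'(1) by blast
qed

section \<open>Invertible and triangular matrices\<close>

lemma GL_iff: "g \<in> carrier (GL n) \<longleftrightarrow> g \<in> carrier_mat n n \<and> det g \<noteq> 0"
proof
  assume g: "g \<in> carrier (GL n)"
  then have c: "g \<in> carrier_mat n n" by (simp add: GL_def)
  from g obtain h where h: "g * h = 1\<^sub>m n" "h * g = 1\<^sub>m (dim_row h)"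
    by (auto simp: GL_def invertible_mat_def inverts_mat_def)
  have "dim_col h = n" using arg_cong[OF h(1), of dim_col] c by simp
  moreover have "dim_row h = n" using arg_cong[OF h(2), of dim_col] c by simp
  ultimately have "h \<in> carrier_mat n n" by auto
  from det_mult[OF c this] have "det g * det h = 1" unfolding h(1) by simp
  then have "det g \<noteq> 0" by auto
  then show "g \<in> carrier_mat n n \<and> det g \<noteq> 0" using c by simp
next
  assume g: "g \<in> carrier_mat n n \<and> det g \<noteq> 0"
  then have "g \<in> Units (ring_mat TYPE(complex) n ())" by (intro det_non_zero_imp_unit) simp_all
  then obtain h where "h \<in> carrier_mat n n" "g * h = 1\<^sub>m n" "h * g = 1\<^sub>m n"
    by (auto simp: Units_def ring_mat_simps)
  then show "g \<in> carrier (GL n)"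
    using g by (auto simp: GL_def invertible_mat_def inverts_mat_def square_mat.simps)
qed

lemma GL_carrier: "g \<in> carrier (GL n) \<Longrightarrow> g \<in> carrier_mat n n"
  by (simp add: GL_iff)

lemma GL_mult: "g \<in> carrier (GL n) \<Longrightarrow> h \<in> carrier (GL n) \<Longrightarrow> g * h \<in> carrier (GL n)"
  by (auto simp: GL_iff det_mult)

lemma GL_one: "1\<^sub>m n \<in> carrier (GL n)"
  by (simp add: GL_iff)

lemma GL_inverse:
  assumes "g \<in> carrier (GL n)"
  obtains h where "h \<in> carrier (GL n)" "g * h = 1\<^sub>m n" "h * g = 1\<^sub>m n"
proof -
  have "g \<in> Units (ring_mat TYPE(complex) n ())" using assms unfolding GL_iff
    by (intro det_non_zero_imp_unit) simp_all
  then obtain h where h: "h \<in> carrier_mat n n" "g * h = 1\<^sub>m n" "h * g = 1\<^sub>m n"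
    by (auto simp: Units_def ring_mat_simps)
  have "det g * det h = 1" using det_mult[of g n h] h(1,2) assms unfolding GL_iff by simp
  then have "h \<in> carrier (GL n)" using h by (auto simp: GL_iff)
  then show thesis using that h by blast
qed

lemma GL_factor: "a * b \<in> carrier (GL n) \<Longrightarrow> a \<in> carrier_mat n n \<Longrightarrow> b \<in> carrier_mat n n
    \<Longrightarrow> a \<in> carrier (GL n) \<and> b \<in> carrier (GL n)"
  by (auto simp: GL_iff det_mult)

lemma mult_entry:
  assumes "A \<in> carrier_mat n n" "B \<in> carrier_mat n n" "r < n" "c < n"
  shows "(A * B) $$ (r, c) = (\<Sum>k<n. A $$ (r, k) * B $$ (k, c))"
  using assms by (auto simp: scalar_prod_def lessThan_atLeast0)

lemma square_mult:
  fixes A B :: "complex mat"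
  shows "A \<in> carrier_mat n n \<Longrightarrow> B \<in> carrier_mat n n \<Longrightarrow> A * B \<in> carrier_mat n n"
  by (rule mult_carrier_mat)

lemma square_assoc:
  fixes A B C :: "complex mat"
  shows "A \<in> carrier_mat n n \<Longrightarrow> B \<in> carrier_mat n n \<Longrightarrow> C \<in> carrier_mat n n
    \<Longrightarrow> A * B * C = A * (B * C)"
  by (rule assoc_mult_mat)

lemma cancel_left_inverse:
  fixes x :: "complex mat"
  assumes "h * g = 1\<^sub>m n" "h \<in> carrier_mat n n" "g \<in> carrier_mat n n" "x \<in> carrier_mat n n"
  shows "h * (g * x) = x"
  using assoc_mult_mat[OF assms(2,3,4)] left_mult_one_mat[OF assms(4)] unfolding assms(1) by simp

lemma cancel_right_inverse:
  fixes x :: "complex mat"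
  assumes "g * h = 1\<^sub>m n" "h \<in> carrier_mat n n" "g \<in> carrier_mat n n" "x \<in> carrier_mat n n"
  shows "x * g * h = x"
  using assoc_mult_mat[OF assms(4,3,2)] right_mult_one_mat[OF assms(4)] unfolding assms(1) by simp

definition upper_GL :: "nat \<Rightarrow> complex mat set" where
  "upper_GL n = {b \<in> carrier (GL n). upper_triangular b}"

lemma upper_GL_D:
  assumes "b \<in> upper_GL n"
  shows "b \<in> carrier (GL n)" "b \<in> carrier_mat n n" "\<And>r c. c < r \<Longrightarrow> r < n \<Longrightarrow> b $$ (r, c) = 0"
  using assms by (auto simp: upper_GL_def GL_iff)

lemma prod_diag_upper:
  assumes "b \<in> carrier_mat n n" "upper_triangular b"
  shows "det b = (\<Prod>i<n. b $$ (i, i))"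
  using det_upper_triangular[OF assms(2,1)] assms(1)
  by (simp add: prod_list_diag_prod lessThan_atLeast0)

lemma upper_GL_I:
  assumes "b \<in> carrier_mat n n" "\<And>r c. c < r \<Longrightarrow> r < n \<Longrightarrow> b $$ (r, c) = 0"
    "\<And>r. r < n \<Longrightarrow> b $$ (r, r) \<noteq> 0"
  shows "b \<in> upper_GL n"
proof -
  have "upper_triangular b" using assms by auto
  then show ?thesis using assms prod_diag_upper[of b n] by (auto simp: upper_GL_def GL_iff)
qed

lemma upper_GL_diag:
  assumes "b \<in> upper_GL n" "r < n"
  shows "b $$ (r, r) \<noteq> 0"
proof -
  have "det b = (\<Prod>i<n. b $$ (i, i))"
    using assms prod_diag_upper by (auto simp: upper_GL_def GL_iff)
  then show ?thesis using assms by (auto simp: upper_GL_def GL_iff)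
qed

lemma upper_GL_one: "1\<^sub>m n \<in> upper_GL n"
  by (auto intro: upper_GL_I)

lemma upper_GL_mult:
  assumes "a \<in> upper_GL n" "b \<in> upper_GL n"
  shows "a * b \<in> upper_GL n"
proof -
  note a = upper_GL_D[OF assms(1)] and b = upper_GL_D[OF assms(2)]
  have "(a * b) $$ (r, c) = 0" if "c < r" "r < n" for r c
  proof -
    have "(a * b) $$ (r, c) = (\<Sum>k<n. a $$ (r, k) * b $$ (k, c))" using a b that by (intro mult_entry) auto
    also have "\<dots> = 0"
    proof (intro sum.neutral ballI)
      fix k assume "k \<in> {..<n}"
      then show "a $$ (r, k) * b $$ (k, c) = 0" using a(3)[of k r] b(3)[of c k] that by (cases "k < r") auto
    qed
    finally show ?thesis .
  qed
  then show ?thesis using GL_mult[OF a(1) b(1)] a b by (auto simp: upper_GL_def)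
qed

text \<open>Back substitution: a nonzero entry of the inverse below the diagonal, as low as possible in
  its column, would give a nonzero entry of the product.\<close>

lemma upper_GL_inverse:
  assumes b: "b \<in> upper_GL n" and h: "h \<in> carrier (GL n)" "b * h = 1\<^sub>m n"
  shows "h \<in> upper_GL n"
proof -
  note b' = upper_GL_D[OF b]
  have hc: "h \<in> carrier_mat n n" using h GL_carrier by blast
  have zero: "h $$ (r, c) = 0" if "c < r" "r < n" for r c
    using that
  proof (induction "n - r" arbitrary: r rule: less_induct)
    case less
    have "0 = (b * h) $$ (r, c)" using h(2) less.prems by simp
    also have "\<dots> = (\<Sum>k<n. b $$ (r, k) * h $$ (k, c))" using less.prems b' hc by (intro mult_entry) auto
    also have "\<dots> = (\<Sum>k<n. if k = r then b $$ (r, r) * h $$ (r, c) else 0)"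
    proof (intro sum.cong refl)
      fix k assume "k \<in> {..<n}"
      then show "b $$ (r, k) * h $$ (k, c) = (if k = r then b $$ (r, r) * h $$ (r, c) else 0)"
        using b'(3)[of k r] less.hyps[of k] less.prems by (cases k r rule: linorder_cases) auto
    qed
    also have "\<dots> = b $$ (r, r) * h $$ (r, c)" using less.prems by simp
    finally show ?case using upper_GL_diag[OF b less.prems(2)] by simp
  qed
  then have "upper_triangular h" using hc by auto
  then show ?thesis using h by (simp add: upper_GL_def)
qed

lemma upper_GL_inverse_obtain:
  assumes "b \<in> upper_GL n"
  obtains h where "h \<in> upper_GL n" "b * h = 1\<^sub>m n" "h * b = 1\<^sub>m n"
  using GL_inverse[OF upper_GL_D(1)[OF assms]] upper_GL_inverse[OF assms] by metis

section \<open>Minimal parabolic subgroups\<close>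

text \<open>The stabilizer of all members of \<open>E_+\<close> except the one of dimension \<open>k + 1\<close>. The flags that
  agree with \<open>g E_+\<close> outside this dimension form the projective line of the flags \<open>g q E_+\<close> with
  \<open>q\<close> in this group.\<close>

definition minimal_parabolic :: "nat \<Rightarrow> nat \<Rightarrow> complex mat set" where
  "minimal_parabolic n k = {g \<in> carrier (GL n). \<forall>r<n. \<forall>c<r. (r, c) \<noteq> (Suc k, k) \<longrightarrow> g $$ (r, c) = 0}"

lemma upper_subset_parabolic: "upper_GL n \<subseteq> minimal_parabolic n k"
  by (auto simp: upper_GL_def minimal_parabolic_def GL_iff)

lemma minimal_parabolic_D:
  assumes "q \<in> minimal_parabolic n k"
  shows "q \<in> carrier (GL n)" "q \<in> carrier_mat n n"
    "\<And>r c. c < r \<Longrightarrow> r < n \<Longrightarrow> (r, c) \<noteq> (Suc k, k) \<Longrightarrow> q $$ (r, c) = 0"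
  using assms by (auto simp: minimal_parabolic_def GL_iff)

lemma minimal_parabolic_mult:
  assumes "p \<in> minimal_parabolic n k" "q \<in> minimal_parabolic n k"
  shows "p * q \<in> minimal_parabolic n k"
proof -
  note p = minimal_parabolic_D[OF assms(1)] and q = minimal_parabolic_D[OF assms(2)]
  have "(p * q) $$ (r, c) = 0" if "c < r" "r < n" "(r, c) \<noteq> (Suc k, k)" for r c
  proof -
    have "(p * q) $$ (r, c) = (\<Sum>l<n. p $$ (r, l) * q $$ (l, c))" using p q that by (intro mult_entry) auto
    also have "\<dots> = 0"
    proof (intro sum.neutral ballI)
      fix l assume "l \<in> {..<n}"
      then show "p $$ (r, l) * q $$ (l, c) = 0" using p(3)[of l r] q(3)[of c l] that
        by (cases "l < r"; cases "c < l") auto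
    qed
    finally show ?thesis .
  qed
  then show ?thesis using GL_mult[OF p(1) q(1)] by (auto simp: minimal_parabolic_def)
qed

lemma parabolic_notin_upper:
  assumes "q \<in> minimal_parabolic n k" "q \<notin> upper_GL n"
  shows "q $$ (Suc k, k) \<noteq> 0" "Suc k < n"
proof -
  note q = minimal_parabolic_D[OF assms(1)]
  have "\<not> upper_triangular q" using assms(2) q by (simp add: upper_GL_def)
  then obtain r c where "c < r" "r < n" "q $$ (r, c) \<noteq> 0" using q(2) by (auto simp: upper_triangular_def)
  then show "q $$ (Suc k, k) \<noteq> 0" "Suc k < n" using q(3)[of c r] by auto
qed

section \<open>Permutation matrices and Bruhat cells\<close>

lemma perm_mat_carrier [simp]: "perm_mat n w \<in> carrier_mat n n"
proof -
  have "length (map (\<lambda>i. std_vec n (w i)) [1..<n + 1]) = n" by simp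
  then show ?thesis unfolding perm_mat_def by (metis mat_of_cols_carrier(1))
qed

lemma perm_mat_entry:
  assumes "w permutes {1..n}" "r < n" "c < n"
  shows "perm_mat n w $$ (r, c) = (if w (Suc c) = Suc r then 1 else 0)"
proof -
  have "1 \<le> w (Suc c)" "w (Suc c) \<le> n" using permutes_ivl_le[OF assms(1), of "Suc c"] assms by auto
  moreover have "[1..<n + 1] ! c = Suc c" using assms by (subst nth_upt) auto
  ultimately show ?thesis
  proof -
    assume w: "1 \<le> w (Suc c)" "w (Suc c) \<le> n" and idx: "[1..<n + 1] ! c = Suc c"
    have "perm_mat n w $$ (r, c) = map (\<lambda>i. std_vec n (w i)) [1..<n + 1] ! c $ r"
      unfolding perm_mat_def using assms by (intro mat_of_cols_index) auto
    also have "map (\<lambda>i. std_vec n (w i)) [1..<n + 1] ! c = std_vec n (w (Suc c))"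
      using assms idx nth_map[of c "[1..<n + 1]" "\<lambda>i. std_vec n (w i)"] by simp
    finally show ?thesis using assms(2) w by (auto simp: std_vec_def unit_vec_def)
  qed
qed

lemma perm_mat_mult_entry:
  assumes w: "w permutes {1..n}" and A: "A \<in> carrier_mat n n" and rc: "r < n" "c < n"
  shows "(perm_mat n w * A) $$ (r, c) = A $$ (inv' w (Suc r) - 1, c)"
proof -
  have i: "1 \<le> inv' w (Suc r)" "inv' w (Suc r) \<le> n"
    using permutes_ivl_le[OF permutes_inv[OF w], of "Suc r"] rc by auto
  have "(perm_mat n w * A) $$ (r, c) = (\<Sum>k<n. perm_mat n w $$ (r, k) * A $$ (k, c))"
    using A rc by (intro mult_entry) auto
  also have "\<dots> = (\<Sum>k<n. if k = inv' w (Suc r) - 1 then A $$ (inv' w (Suc r) - 1, c) else 0)"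
  proof (intro sum.cong refl)
    fix k assume k: "k \<in> {..<n}"
    have "w (Suc k) = Suc r \<longleftrightarrow> k = inv' w (Suc r) - 1"
      using permutes_inverses[OF w] i by (metis Suc_pred' diff_Suc_1 less_eq_Suc_le One_nat_def)
    then show "perm_mat n w $$ (r, k) * A $$ (k, c) =
       (if k = inv' w (Suc r) - 1 then A $$ (inv' w (Suc r) - 1, c) else 0)"
      using perm_mat_entry[OF w rc(1)] k by simp
  qed
  also have "\<dots> = A $$ (inv' w (Suc r) - 1, c)" using i by (simp add: Suc_le_lessD)
  finally show ?thesis .
qed

lemma mult_perm_mat_entry:
  assumes w: "w permutes {1..n}" and A: "A \<in> carrier_mat n n" and rc: "r < n" "c < n"
  shows "(A * perm_mat n w) $$ (r, c) = A $$ (r, w (Suc c) - 1)"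
proof -
  have i: "1 \<le> w (Suc c)" "w (Suc c) \<le> n"
    using permutes_ivl_le[OF w, of "Suc c"] rc by auto
  have "(A * perm_mat n w) $$ (r, c) = (\<Sum>k<n. A $$ (r, k) * perm_mat n w $$ (k, c))"
    using A rc by (intro mult_entry) auto
  also have "\<dots> = (\<Sum>k<n. if k = w (Suc c) - 1 then A $$ (r, w (Suc c) - 1) else 0)"
    using perm_mat_entry[OF w _ rc(2)] i by (intro sum.cong refl) auto
  also have "\<dots> = A $$ (r, w (Suc c) - 1)" using i by (simp add: Suc_le_lessD)
  finally show ?thesis .
qed

lemma perm_mat_id: "perm_mat n id = 1\<^sub>m n"
  by (rule eq_matI) (use perm_mat_entry[OF permutes_id, of _ n] carrier_matD[OF perm_mat_carrier] in auto)

lemma perm_mat_comp: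
  assumes "w permutes {1..n}" "u permutes {1..n}"
  shows "perm_mat n w * perm_mat n u = perm_mat n (w \<circ> u)"
proof (rule eq_matI)
  fix r c assume "r < dim_row (perm_mat n (w \<circ> u))" "c < dim_col (perm_mat n (w \<circ> u))"
  then have rc: "r < n" "c < n" using carrier_matD[OF perm_mat_carrier] by metis+
  have i: "1 \<le> u (Suc c)" "u (Suc c) \<le> n"
    using permutes_ivl_le[OF assms(2), of "Suc c"] rc by auto
  have "(perm_mat n w * perm_mat n u) $$ (r, c) = perm_mat n w $$ (r, u (Suc c) - 1)"
    using rc by (intro mult_perm_mat_entry assms) auto
  also have "\<dots> = perm_mat n (w \<circ> u) $$ (r, c)"
    using rc i perm_mat_entry[OF assms(1) rc(1), of "u (Suc c) - 1"]
      perm_mat_entry[OF permutes_compose[OF assms(2,1)] rc] by simp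
  finally show "(perm_mat n w * perm_mat n u) $$ (r, c) = perm_mat n (w \<circ> u) $$ (r, c)" .
qed (use carrier_matD[OF perm_mat_carrier] in \<open>auto\<close>)

lemma perm_mat_inverse:
  assumes "w permutes {1..n}"
  shows "perm_mat n w * perm_mat n (inv' w) = 1\<^sub>m n" "perm_mat n (inv' w) * perm_mat n w = 1\<^sub>m n"
  using perm_mat_comp[OF assms permutes_inv[OF assms]] perm_mat_comp[OF permutes_inv[OF assms] assms]
  by (simp_all add: permutes_inv_o[OF assms] perm_mat_id)

lemma perm_mat_GL:
  assumes "w permutes {1..n}"
  shows "perm_mat n w \<in> carrier (GL n)"
  using GL_factor[of "perm_mat n w" "perm_mat n (inv' w)" n] perm_mat_inverse[OF assms] GL_one by auto

text \<open>The Bruhat cell of \<open>g\<close> in \<open>GL(n) = \<Union>w. B w B\<close>.\<close>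

definition in_cell :: "nat \<Rightarrow> complex mat \<Rightarrow> (nat \<Rightarrow> nat) \<Rightarrow> bool" where
  "in_cell n g w \<longleftrightarrow> w permutes {1..n} \<and> (\<exists>b\<in>upper_GL n. \<exists>b'\<in>upper_GL n. g = b * perm_mat n w * b')"

lemma in_cellD: "in_cell n g w \<Longrightarrow> w permutes {1..n}" "in_cell n g w \<Longrightarrow> g \<in> carrier (GL n)"
  unfolding in_cell_def using GL_mult perm_mat_GL upper_GL_D(1) by auto

lemma in_cell_mult:
  assumes "in_cell n g w" "a \<in> upper_GL n" "b \<in> upper_GL n"
  shows "in_cell n (a * g * b) w"
proof -
  obtain x y where xy: "x \<in> upper_GL n" "y \<in> upper_GL n" "g = x * perm_mat n w * y"
    and w: "w permutes {1..n}" using assms(1) by (auto simp: in_cell_def)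
  have c: "a \<in> carrier_mat n n" "b \<in> carrier_mat n n" "x \<in> carrier_mat n n" "y \<in> carrier_mat n n"
    using assms xy upper_GL_D(2) by auto
  have "a * g * b = (a * x) * perm_mat n w * (y * b)"
    unfolding xy(3) using c by (simp only: square_assoc[where n = n] square_mult perm_mat_carrier)
  then show ?thesis unfolding in_cell_def using w upper_GL_mult assms(2,3) xy(1,2) by blast
qed

lemma in_cell_left:
  assumes "in_cell n g w" "a \<in> upper_GL n"
  shows "in_cell n (a * g) w"
proof -
  have "a * g \<in> carrier_mat n n"
    using GL_carrier[OF in_cellD(2)[OF assms(1)]] upper_GL_D(2)[OF assms(2)] by simp
  from right_mult_one_mat[OF this] in_cell_mult[OF assms upper_GL_one] show ?thesis by simp
qed

lemma in_cell_right:
  assumes "in_cell n g w" "b \<in> upper_GL n"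
  shows "in_cell n (g * b) w"
  using in_cell_mult[OF assms(1) upper_GL_one assms(2)]
    left_mult_one_mat[OF GL_carrier[OF in_cellD(2)[OF assms(1)]]] by simp

lemma perm_mat_in_cell:
  assumes "w permutes {1..n}"
  shows "in_cell n (perm_mat n w) w"
proof -
  have "perm_mat n w = 1\<^sub>m n * perm_mat n w * 1\<^sub>m n"
    using left_mult_one_mat[OF perm_mat_carrier] right_mult_one_mat[OF perm_mat_carrier] by metis
  then show ?thesis unfolding in_cell_def using assms upper_GL_one by blast
qed

text \<open>Membership in a cell is always established by this pattern of zeros; the triangular factor
  need not be computed, since it is \<open>Y\<close> with its columns permuted.\<close>

lemma upper_times_perm_pattern:
  assumes w: "w permutes {1..n}" and Y: "Y \<in> carrier (GL n)"
    and pat: "\<And>r c. r < n \<Longrightarrow> c < n \<Longrightarrow> w (Suc c) < Suc r \<Longrightarrow> Y $$ (r, c) = 0"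
  shows "\<exists>b\<in>upper_GL n. Y = b * perm_mat n w"
proof -
  define b where "b = mat n n (\<lambda>(r, m). Y $$ (r, inv' w (Suc m) - 1))"
  have bc: "b \<in> carrier_mat n n" and Yc: "Y \<in> carrier_mat n n"
    using GL_carrier[OF Y] by (auto simp: b_def)
  have iv: "1 \<le> inv' w (Suc m) \<and> inv' w (Suc m) \<le> n" if "m < n" for m
    using permutes_ivl_le[OF permutes_inv[OF w], of "Suc m"] that by auto
  have eq: "Y = b * perm_mat n w"
  proof (rule eq_matI)
    fix r c assume "r < dim_row (b * perm_mat n w)" "c < dim_col (b * perm_mat n w)"
    then have rc: "r < n" "c < n" using bc carrier_matD[OF perm_mat_carrier] by auto
    have "1 \<le> w (Suc c)" "w (Suc c) \<le> n" using permutes_ivl_le[OF w, of "Suc c"] rc by auto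
    then have "b $$ (r, w (Suc c) - 1) = Y $$ (r, c)"
      using rc permutes_inverses(2)[OF w] by (simp add: b_def)
    then show "Y $$ (r, c) = (b * perm_mat n w) $$ (r, c)"
      by (simp add: mult_perm_mat_entry[OF w bc rc])
  qed (use bc Yc carrier_matD[OF perm_mat_carrier] in auto)
  have "b \<in> carrier (GL n)" using GL_factor[of b "perm_mat n w" n] eq Y bc by auto
  moreover have "b $$ (r, m) = 0" if "m < r" "r < n" for r m
  proof -
    have "w (Suc (inv' w (Suc m) - 1)) = Suc m"
      using iv[of m] that permutes_inverses(1)[OF w] by simp
    then show ?thesis using pat[of r "inv' w (Suc m) - 1"] iv[of m] that by (simp add: b_def Suc_le_lessD)
  qed
  then have "upper_triangular b" using bc by auto
  ultimately show ?thesis using eq by (auto simp: upper_GL_def)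
qed

lemma in_cell_pattern:
  assumes w: "w permutes {1..n}" and Y: "Y \<in> carrier (GL n)" and b: "b \<in> upper_GL n"
    and pat: "\<And>r c. r < n \<Longrightarrow> c < n \<Longrightarrow> w (Suc c) < Suc r \<Longrightarrow> (Y * b) $$ (r, c) = 0"
  shows "in_cell n Y w"
proof -
  obtain h where h: "h \<in> upper_GL n" "b * h = 1\<^sub>m n" using upper_GL_inverse_obtain[OF b] by blast
  obtain a where a: "a \<in> upper_GL n" "Y * b = a * perm_mat n w"
    using upper_times_perm_pattern[OF w GL_mult[OF Y upper_GL_D(1)[OF b]] pat] by blast
  have "in_cell n (Y * b) w" unfolding a(2) using w a(1) perm_mat_in_cell in_cell_left by blast
  then have "in_cell n (Y * b * h) w" using h(1) by (rule in_cell_right)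
  then show ?thesis
    using cancel_right_inverse[OF h(2) upper_GL_D(2)[OF h(1)] upper_GL_D(2)[OF b] GL_carrier[OF Y]] by simp
qed

section \<open>Cells on a projective line\<close>

lemma simple_permutes: "Suc k < n \<Longrightarrow> simple k permutes {1..n}"
  by (intro permutes_swap_id) auto

lemma perm_mat_simple_parabolic:
  assumes "Suc k < n"
  shows "perm_mat n (simple k) \<in> minimal_parabolic n k" "perm_mat n (simple k) \<notin> upper_GL n"
proof -
  show "perm_mat n (simple k) \<in> minimal_parabolic n k"
    using perm_mat_GL[OF simple_permutes[OF assms]] perm_mat_entry[OF simple_permutes[OF assms]] assms
    by (auto simp: minimal_parabolic_def Transposition.transpose_def)
  have "perm_mat n (simple k) $$ (Suc k, k) = 1"
    using perm_mat_entry[OF simple_permutes[OF assms], of "Suc k" k] assms by simp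
  then show "perm_mat n (simple k) \<notin> upper_GL n"
    using upper_GL_D(3)[of "perm_mat n (simple k)" n k "Suc k"] assms by auto
qed

lemma addrow_mat_upper:
  assumes "k < l" "l < n"
  shows "addrow_mat n a k l \<in> upper_GL n"
  using assms by (intro upper_GL_I) auto

text \<open>The Bruhat decomposition of \<open>GL(2)\<close> in the rows and columns \<open>k\<close> and \<open>k + 1\<close>. The constant \<open>a\<close>
  clears the upper entry of column \<open>k\<close>, after which exchanging the two rows makes the matrix
  triangular.\<close>

lemma parabolic_decomposition:
  assumes "q \<in> minimal_parabolic n k" "q \<notin> upper_GL n"
  shows "\<exists>a. \<exists>b\<in>upper_GL n. q = addrow_mat n a k (Suc k) * perm_mat n (simple k) * b"
proof -
  note q = minimal_parabolic_D[OF assms(1)] and q' = parabolic_notin_upper[OF assms]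
  let ?a = "q $$ (k, k) / q $$ (Suc k, k)"
  let ?x = "addrow_mat n ?a k (Suc k)" and ?y = "addrow_mat n (- ?a) k (Suc k)" and ?s = "perm_mat n (simple k)"
  have s: "simple k permutes {1..n}" using simple_permutes q' by simp
  have c: "?x \<in> carrier_mat n n" "?y \<in> carrier_mat n n" by auto
  have xy: "?x * ?y = 1\<^sub>m n" using addrow_mat_inv[of k n "Suc k" ?a] q' by simp
  have ss: "?s * ?s = 1\<^sub>m n" using perm_mat_comp[OF s s] by (simp add: perm_mat_id)
  let ?z = "?y * q"
  have z: "?z $$ (r, j) = (if r = k then q $$ (k, j) - ?a * q $$ (Suc k, j) else q $$ (r, j))" if "r < n" "j < n" for r j
    using addrow_mat[OF q(2), of "Suc k" "- ?a" k, symmetric] q' that q(2) by simp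
  have zc: "?z \<in> carrier_mat n n" by (rule square_mult[OF c(2) q(2)])
  let ?b = "?s * ?z"
  have bc: "?b \<in> carrier_mat n n" by (rule square_mult[OF perm_mat_carrier zc])
  have b: "?b $$ (r, j) = (if r = Suc k then q $$ (k, j) - ?a * q $$ (Suc k, j)
      else if r = k then q $$ (Suc k, j) else q $$ (r, j))" if "r < n" "j < n" for r j
    using perm_mat_mult_entry[OF s zc that] that z q' by (auto simp: Transposition.transpose_def)
  have "q = ?x * ?z" using cancel_left_inverse[OF xy c q(2)] by simp
  also have "?z = ?s * ?b" using cancel_left_inverse[OF ss perm_mat_carrier perm_mat_carrier zc] by simp
  also have "?x * (?s * ?b) = ?x * ?s * ?b" using assoc_mult_mat[OF c(1) perm_mat_carrier bc] by simp
  finally have eq: "q = ?x * ?s * ?b" .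
  have "?b \<in> carrier (GL n)"
    using GL_factor[of "?x * ?s" ?b n] eq q(1) bc by (metis c(1) mult_carrier_mat perm_mat_carrier)
  moreover have "upper_triangular ?b"
  proof (rule upper_triangularI)
    fix r j assume rj: "j < r" "r < dim_row ?b"
    then have "r < n" using bc by auto
    then show "?b $$ (r, j) = 0"
      using rj q'(1) q(3)[of j r] q(3)[of j k] q(3)[of j "Suc k"] q'(2) b[of r j]
      by (cases "r = Suc k"; cases "r = k"; cases "j = k") auto
  qed
  ultimately have "?b \<in> upper_GL n" by (simp add: upper_GL_def)
  then show ?thesis using eq by blast
qed

lemma minimal_parabolic_inverse:
  assumes "q \<in> minimal_parabolic n k"
  obtains h where "h \<in> minimal_parabolic n k" "q * h = 1\<^sub>m n" "h * q = 1\<^sub>m n"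
proof (cases "q \<in> upper_GL n")
  case True
  obtain h where "h \<in> upper_GL n" "q * h = 1\<^sub>m n" "h * q = 1\<^sub>m n"
    by (rule upper_GL_inverse_obtain[OF True])
  then show thesis using that[of h] upper_subset_parabolic[of n k] by auto
next
  case False
  note k = parabolic_notin_upper(2)[OF assms False]
  obtain a b where b: "b \<in> upper_GL n" and q: "q = addrow_mat n a k (Suc k) * perm_mat n (simple k) * b"
    using parabolic_decomposition[OF assms False] by blast
  obtain h where h: "h \<in> upper_GL n" "b * h = 1\<^sub>m n" "h * b = 1\<^sub>m n" using upper_GL_inverse_obtain[OF b] by blast
  let ?x = "addrow_mat n a k (Suc k)" and ?y = "addrow_mat n (- a) k (Suc k)" and ?s = "perm_mat n (simple k)"
  have s: "simple k permutes {1..n}" using simple_permutes k by simp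
  have c: "?x \<in> carrier_mat n n" "?y \<in> carrier_mat n n" "b \<in> carrier_mat n n" "h \<in> carrier_mat n n"
    using b h upper_GL_D(2) by auto
  have xy: "?x * ?y = 1\<^sub>m n" using addrow_mat_inv[of k n "Suc k" a] k by simp
  have ss: "?s * ?s = 1\<^sub>m n" using perm_mat_comp[OF s s] by (simp add: perm_mat_id)
  let ?h = "h * ?s * ?y"
  have hc: "?h \<in> carrier_mat n n" by (intro square_mult c perm_mat_carrier)
  have "q * ?h = ?x * (?s * (b * (h * (?s * ?y))))"
    unfolding q using c by (simp only: square_assoc[where n = n] square_mult perm_mat_carrier)
  also have "b * (h * (?s * ?y)) = ?s * ?y"
    by (intro cancel_left_inverse[OF h(2)] c square_mult perm_mat_carrier)
  also have "?s * (?s * ?y) = ?y" by (intro cancel_left_inverse[OF ss] c perm_mat_carrier)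
  finally have 1: "q * ?h = 1\<^sub>m n" using xy by simp
  have "?y \<in> minimal_parabolic n k" "h \<in> minimal_parabolic n k"
    using addrow_mat_upper[of k "Suc k" n "- a"] k h(1) upper_subset_parabolic by auto
  then have "?h \<in> minimal_parabolic n k"
    using perm_mat_simple_parabolic(1)[OF k] by (intro minimal_parabolic_mult)
  then show thesis using that 1 mat_mult_left_right_inverse[OF minimal_parabolic_D(2)[OF assms] hc 1] by blast
qed

text \<open>On the projective line through a point of the smaller cell \<open>B w B\<close> this point is the only one
  in that cell; all other points lie in \<open>B w s B\<close>. By the decomposition of \<open>q\<close> it is enough to
  move an elementary matrix at \<open>(k, k + 1)\<close> across \<open>w\<close>, which keeps it upper triangular because
  \<open>w\<close> ascends at \<open>k\<close>.\<close>

lemma cell_ascent: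
  assumes g: "in_cell n g w" and asc: "w (Suc k) < w (Suc (Suc k))"
    and q: "q \<in> minimal_parabolic n k" "q \<notin> upper_GL n"
  shows "in_cell n (g * q) (w \<circ> simple k)"
proof -
  have k: "Suc k < n" by (rule parabolic_notin_upper(2)[OF q])
  obtain b b' where b: "b \<in> upper_GL n" "b' \<in> upper_GL n" and gb: "g = b * perm_mat n w * b'"
    and w: "w permutes {1..n}" using g by (auto simp: in_cell_def)
  note bc = upper_GL_D(2)[OF b(1)] upper_GL_D(2)[OF b(2)] and qc = minimal_parabolic_D(2)[OF q(1)]
  have "b' * q \<notin> upper_GL n"
  proof
    assume *: "b' * q \<in> upper_GL n"
    obtain h where h: "h \<in> upper_GL n" "h * b' = 1\<^sub>m n" using upper_GL_inverse_obtain[OF b(2)] by blast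
    have "h * (b' * q) = q" using h bc qc upper_GL_D(2)[OF h(1)] by (intro cancel_left_inverse)
    then show False using upper_GL_mult[OF h(1) *] q(2) by simp
  qed
  moreover have "b' * q \<in> minimal_parabolic n k"
    using b(2) q(1) upper_subset_parabolic by (intro minimal_parabolic_mult) auto
  ultimately obtain a d where d: "d \<in> upper_GL n"
    and q': "b' * q = addrow_mat n a k (Suc k) * perm_mat n (simple k) * d"
    using parabolic_decomposition by blast
  let ?x = "addrow_mat n a k (Suc k)"
  have s: "simple k permutes {1..n}" using simple_permutes k by simp
  have x: "?x \<in> carrier (GL n)" using addrow_mat_upper[of k "Suc k" n a] k upper_GL_D(1) by simp
  have "\<exists>e\<in>upper_GL n. perm_mat n w * ?x = e * perm_mat n w"
  proof (rule upper_times_perm_pattern[OF w GL_mult[OF perm_mat_GL[OF w] x]])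
    fix r c assume rc: "r < n" "c < n" "w (Suc c) < Suc r"
    let ?r = "inv' w (Suc r) - 1"
    have iv: "1 \<le> inv' w (Suc r)" "inv' w (Suc r) \<le> n"
      using permutes_ivl_le[OF permutes_inv[OF w], of "Suc r"] rc by auto
    then have wr: "w (Suc ?r) = Suc r" using permutes_inverses(1)[OF w] by simp
    have "?r \<noteq> c" using wr rc by auto
    moreover have "\<not> (?r = k \<and> c = Suc k)" using wr rc asc by auto
    ultimately have "?x $$ (?r, c) = 0" using iv rc by auto
    then show "(perm_mat n w * ?x) $$ (r, c) = 0" using perm_mat_mult_entry[OF w _ rc(1,2), of ?x] by simp
  qed
  then obtain e where e: "e \<in> upper_GL n" "perm_mat n w * ?x = e * perm_mat n w" by blast
  note ec = upper_GL_D(2)[OF e(1)] and dc = upper_GL_D(2)[OF d]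
  have "g * q = b * perm_mat n w * (b' * q)" unfolding gb using bc qc
    by (simp only: square_assoc[where n = n] square_mult perm_mat_carrier addrow_mat_carrier)
  also have "\<dots> = b * (perm_mat n w * ?x) * perm_mat n (simple k) * d"
    unfolding q' using bc dc by (simp only: square_assoc[where n = n] square_mult perm_mat_carrier addrow_mat_carrier)
  also have "\<dots> = b * e * (perm_mat n w * perm_mat n (simple k)) * d"
    unfolding e(2) using bc dc ec by (simp only: square_assoc[where n = n] square_mult perm_mat_carrier addrow_mat_carrier)
  also have "perm_mat n w * perm_mat n (simple k) = perm_mat n (w \<circ> simple k)" by (rule perm_mat_comp[OF w s])
  finally show ?thesis
    unfolding in_cell_def using permutes_comp_simple[OF w k] upper_GL_mult[OF b(1) e(1)] d by blast
qed

lemma cell_descent: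
  assumes g: "in_cell n g w" and k: "Suc k < n"
  shows "\<exists>p\<in>minimal_parabolic n k. in_cell n (g * p) (w \<circ> simple k)"
proof -
  obtain b b' where b: "b \<in> upper_GL n" "b' \<in> upper_GL n" and gb: "g = b * perm_mat n w * b'"
    and w: "w permutes {1..n}" using g by (auto simp: in_cell_def)
  obtain h where h: "h \<in> upper_GL n" "b' * h = 1\<^sub>m n" using upper_GL_inverse_obtain[OF b(2)] by blast
  note c = upper_GL_D(2)[OF b(1)] upper_GL_D(2)[OF b(2)] upper_GL_D(2)[OF h(1)]
  have s: "simple k permutes {1..n}" using simple_permutes k by simp
  let ?p = "h * perm_mat n (simple k)"
  have "g * ?p = b * (perm_mat n w * (b' * (h * perm_mat n (simple k))))"
    unfolding gb using c by (simp only: square_assoc[where n = n] square_mult perm_mat_carrier addrow_mat_carrier)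
  also have "b' * (h * perm_mat n (simple k)) = perm_mat n (simple k)"
    by (intro cancel_left_inverse[OF h(2)] c perm_mat_carrier)
  also have "perm_mat n w * perm_mat n (simple k) = perm_mat n (w \<circ> simple k)" by (rule perm_mat_comp[OF w s])
  finally have "in_cell n (g * ?p) (w \<circ> simple k)"
    using in_cell_left[OF perm_mat_in_cell[OF permutes_comp_simple[OF w k]] b(1)] by simp
  moreover have "?p \<in> minimal_parabolic n k"
    using h(1) upper_subset_parabolic perm_mat_simple_parabolic(1)[OF k] by (intro minimal_parabolic_mult) auto
  ultimately show ?thesis by blast
qed

section \<open>Semicontinuity of rank\<close>

text \<open>Fewer equations than unknowns: eliminate one unknown \<open>d\<close> with a nonzero coefficient from the
  equation \<open>k\<close>.\<close>

lemma underdetermined_system: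
  fixes a :: "'k \<Rightarrow> 'c \<Rightarrow> 'f :: field"
  assumes "finite K" "finite C" "card K < card C"
  shows "\<exists>v. (\<exists>c\<in>C. v c \<noteq> 0) \<and> (\<forall>k\<in>K. (\<Sum>c\<in>C. a k c * v c) = 0)"
  using assms
proof (induction K arbitrary: C a rule: finite_induct)
  case empty
  then have "C \<noteq> {}" by auto
  then show ?case by (intro exI[of _ "\<lambda>_. 1"]) auto
next
  case (insert k K)
  show ?case
  proof (cases "\<forall>c\<in>C. a k c = 0")
    case True
    have "card K < card C" using insert.prems insert.hyps by simp
    from insert.IH[OF insert.prems(1) this] obtain v
      where "\<exists>c\<in>C. v c \<noteq> 0" "\<forall>k\<in>K. (\<Sum>c\<in>C. a k c * v c) = 0" by blast
    then show ?thesis using True by (intro exI[of _ v]) auto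
  next
    case False
    then obtain d where d: "d \<in> C" "a k d \<noteq> 0" by blast
    let ?C = "C - {d}" and ?a = "\<lambda>l c. a l c - a l d * a k c / a k d"
    have "card K < card ?C" using insert d by simp
    from insert.IH[OF _ this, of ?a] insert.prems(1)
    obtain v where v: "\<exists>c\<in>?C. v c \<noteq> 0" "\<forall>l\<in>K. (\<Sum>c\<in>?C. ?a l c * v c) = 0" by blast
    let ?s = "\<Sum>c\<in>?C. a k c * v c"
    let ?v = "v(d := - ?s / a k d)"
    have split: "(\<Sum>c\<in>C. a l c * ?v c) = a l d * (- ?s / a k d) + (\<Sum>c\<in>?C. a l c * v c)" for l
    proof -
      have "(\<Sum>c\<in>C. a l c * ?v c) = a l d * ?v d + (\<Sum>c\<in>?C. a l c * ?v c)"
        by (rule sum.remove[OF insert.prems(1) d(1)])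
      also have "(\<Sum>c\<in>?C. a l c * ?v c) = (\<Sum>c\<in>?C. a l c * v c)" by (rule sum.cong) auto
      finally show ?thesis by simp
    qed
    have "(\<Sum>c\<in>C. a l c * ?v c) = 0" if "l \<in> K" for l
    proof -
      have "0 = (\<Sum>c\<in>?C. ?a l c * v c)" using v(2) that by simp
      also have "\<dots> = (\<Sum>c\<in>?C. a l c * v c) - (\<Sum>c\<in>?C. a l d / a k d * (a k c * v c))"
        by (simp only: left_diff_distrib sum_subtractf times_divide_eq_left mult.assoc)
      also have "\<dots> = (\<Sum>c\<in>?C. a l c * v c) - a l d / a k d * ?s" by (simp add: sum_distrib_left)
      finally show ?thesis unfolding split by simp
    qed
    moreover have "(\<Sum>c\<in>C. a k c * ?v c) = 0" unfolding split using d by simp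
    moreover have "\<exists>c\<in>C. ?v c \<noteq> 0" using v(1) by auto
    ultimately show ?thesis by (intro exI[of _ ?v]) auto
  qed
qed

text \<open>A polynomial that detects rank. Let \<open>C\<close> be the set of columns of the matrix of \<open>w\<close> that have
  their 1 in the block of the first \<open>i\<close> columns and the rows below the \<open>j\<close>-th. In this matrix the
  columns in \<open>C\<close> are those of \<open>A\<close>, truncated to the rows of the block, and the others are those of
  \<open>w\<close>. Its determinant is essentially a minor of \<open>A\<close> of size \<open>exceed w i j\<close>, but no submatrix has
  to be formed.\<close>

definition test_mat :: "nat \<Rightarrow> (nat \<Rightarrow> nat) \<Rightarrow> nat \<Rightarrow> nat \<Rightarrow> complex mat \<Rightarrow> complex mat" where
  "test_mat n w i j A = mat n n (\<lambda>(r, c). if c < i \<and> j < w (Suc c) then (if j \<le> r then A $$ (r, c) else 0)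
     else (if w (Suc c) = Suc r then 1 else 0))"

lemma test_mat_perm:
  assumes "w permutes {1..n}"
  shows "test_mat n w i j (perm_mat n w) = perm_mat n w"
  by (rule eq_matI)
    (use perm_mat_entry[OF assms] carrier_matD[OF perm_mat_carrier] in \<open>auto simp: test_mat_def\<close>)

text \<open>On the cell of \<open>w\<close> the columns of the block span a space of dimension at most \<open>exceed w i j\<close>,
  so fewer linear conditions than columns determine a relation among the \<open>exceed y i j\<close> columns in
  question.\<close>

lemma det_test_mat_zero:
  assumes cell: "in_cell n g w" and y: "y permutes {1..n}" and i: "i \<le> n"
    and lt: "exceed w i j < exceed y i j"
  shows "det (test_mat n y i j g) = 0"
proof -
  obtain b b' where b: "b \<in> upper_GL n" "b' \<in> upper_GL n" and g: "g = b * perm_mat n w * b'"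
    and w: "w permutes {1..n}" using cell by (auto simp: in_cell_def)
  note bD = upper_GL_D[OF b(1)] and bD' = upper_GL_D[OF b(2)]
  have gc: "g \<in> carrier_mat n n" using in_cellD(2)[OF cell] GL_carrier by blast
  let ?K = "{k \<in> {1..i}. j < w k}" and ?C = "{c \<in> {1..i}. j < y c}"
  have "card ?K < card ?C" using lt by (simp only: exceed_def)
  then obtain v where v: "\<exists>c\<in>?C. v c \<noteq> 0"
    "\<forall>k\<in>?K. (\<Sum>c\<in>?C. b' $$ (k - 1, c - 1) * v c) = 0"
    using underdetermined_system[of ?K ?C "\<lambda>k c. b' $$ (k - 1, c - 1)"] by auto
  (* The relation, extended by zero to all columns, lies in the kernel. *)
  define x where "x = vec n (\<lambda>c. if Suc c \<in> ?C then v (Suc c) else 0)"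
  have xc: "x \<in> carrier_vec n" by (simp add: x_def)
  have "x \<noteq> 0\<^sub>v n"
  proof
    assume x0: "x = 0\<^sub>v n"
    obtain c where c: "c \<in> ?C" "v c \<noteq> 0" using v(1) by blast
    then have "c - 1 < n" "Suc (c - 1) = c" using i by auto
    then have "x $ (c - 1) = v c" using c(1) unfolding x_def by (subst index_vec) simp_all
    then show False using c(2) x0 \<open>c - 1 < n\<close> by simp
  qed
  have Cin: "c - 1 < n" "1 \<le> c" "c \<le> i" "j < y c" if "c \<in> ?C" for c using that i by auto
  have "test_mat n y i j g *\<^sub>v x = 0\<^sub>v n"
  proof (rule eq_vecI)
    fix r assume "r < dim_vec (0\<^sub>v n :: complex vec)"
    then have r: "r < n" by simp
    let ?T = "test_mat n y i j g"
    have "(?T *\<^sub>v x) $ r = (\<Sum>c<n. ?T $$ (r, c) * x $ c)"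
      using r by (simp add: test_mat_def scalar_prod_def x_def lessThan_atLeast0)
    also have "\<dots> = (\<Sum>c<n. if Suc c \<in> ?C then (if j \<le> r then g $$ (r, c) else 0) * v (Suc c) else 0)"
      using r i by (intro sum.cong refl) (auto simp: test_mat_def x_def)
    also have "\<dots> = (\<Sum>c\<in>{c. c < n \<and> Suc c \<in> ?C}. (if j \<le> r then g $$ (r, c) else 0) * v (Suc c))"
      by (simp add: sum.If_cases lessThan_def Int_def)
    also have "\<dots> = (\<Sum>c\<in>?C. (if j \<le> r then g $$ (r, c - 1) else 0) * v c)"
      by (rule sum.reindex_bij_witness[of _ "\<lambda>c. c - 1" Suc]) (use i in auto)
    also have "\<dots> = 0"
    proof (cases "j \<le> r")
      case True
      let ?h = "b * perm_mat n w"
      have hc: "?h \<in> carrier_mat n n" by (intro square_mult bD perm_mat_carrier)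
      have zero: "?h $$ (r, m) * (\<Sum>c\<in>?C. b' $$ (m, c - 1) * v c) = 0" if m: "m < n" for m
      proof (cases "m < i")
        case mi: True
        show ?thesis
        proof (cases "j < w (Suc m)")
          case True
          then have "Suc m \<in> ?K" using mi by simp
          then have "(\<Sum>c\<in>?C. b' $$ (Suc m - 1, c - 1) * v c) = 0" using v(2) by blast
          then show ?thesis by simp
        next
          case False
          have "?h $$ (r, m) = b $$ (r, w (Suc m) - 1)"
            by (rule mult_perm_mat_entry[OF w bD(2) r m])
          moreover have "1 \<le> w (Suc m)" using permutes_ivl_le[OF w, of "Suc m"] m by simp
          then have "b $$ (r, w (Suc m) - 1) = 0" using False True r by (intro bD(3)) auto
          ultimately show ?thesis by simp
        qed
      next
        case False
        have "(\<Sum>c\<in>?C. b' $$ (m, c - 1) * v c) = 0"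
        proof (intro sum.neutral ballI)
          fix c assume c: "c \<in> ?C"
          have "c - 1 < m" using Cin(2)[OF c] Cin(3)[OF c] False by linarith
          then have "b' $$ (m, c - 1) = 0" using m by (rule bD'(3))
          then show "b' $$ (m, c - 1) * v c = 0" by simp
        qed
        then show ?thesis by simp
      qed
      have "(\<Sum>c\<in>?C. g $$ (r, c - 1) * v c) = (\<Sum>c\<in>?C. \<Sum>m<n. ?h $$ (r, m) * (b' $$ (m, c - 1) * v c))"
      proof (intro sum.cong refl)
        fix c assume "c \<in> ?C"
        then have "g $$ (r, c - 1) = (\<Sum>m<n. ?h $$ (r, m) * b' $$ (m, c - 1))"
          unfolding g using Cin(1) r by (intro mult_entry[OF hc bD'(2)])
        then show "g $$ (r, c - 1) * v c = (\<Sum>m<n. ?h $$ (r, m) * (b' $$ (m, c - 1) * v c))"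
          by (simp add: sum_distrib_right mult.assoc)
      qed
      also have "\<dots> = (\<Sum>m<n. \<Sum>c\<in>?C. ?h $$ (r, m) * (b' $$ (m, c - 1) * v c))" by (rule sum.swap)
      also have "\<dots> = (\<Sum>m<n. ?h $$ (r, m) * (\<Sum>c\<in>?C. b' $$ (m, c - 1) * v c))"
        by (simp add: sum_distrib_left)
      also have "\<dots> = 0" using zero by (intro sum.neutral ballI) simp
      finally show ?thesis using True by simp
    qed simp
    finally show "(?T *\<^sub>v x) $ r = 0\<^sub>v n $ r" using r by simp
  qed (simp add: test_mat_def)
  moreover have "test_mat n y i j g \<in> carrier_mat n n" by (simp add: test_mat_def)
  ultimately show ?thesis using det_0_iff_vec_prod_zero_field \<open>x \<noteq> 0\<^sub>v n\<close> xc by blast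
qed

section \<open>Zariski closures of sets of matrices\<close>

lemma poly_funs_sum: "finite I \<Longrightarrow> (\<And>i. i \<in> I \<Longrightarrow> f i \<in> poly_funs n) \<Longrightarrow> (\<lambda>A. \<Sum>i\<in>I. f i A) \<in> poly_funs n"
  by (induction I rule: finite_induct) (auto intro: poly_funs.intros)

lemma poly_funs_prod: "finite I \<Longrightarrow> (\<And>i. i \<in> I \<Longrightarrow> f i \<in> poly_funs n) \<Longrightarrow> (\<lambda>A. \<Prod>i\<in>I. f i A) \<in> poly_funs n"
  by (induction I rule: finite_induct) (auto intro: poly_funs.intros)

lemma det_test_mat_poly: "(\<lambda>A. det (test_mat n y i j A)) \<in> poly_funs n"
proof -
  have entry: "(\<lambda>A. test_mat n y i j A $$ (r, c)) \<in> poly_funs n" if "r < n" "c < n" for r c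
    using that
    by (cases "c < i \<and> j < y (Suc c)"; cases "j \<le> r"; cases "y (Suc c) = Suc r")
      (auto simp: test_mat_def intro: poly_funs.intros)
  have "(\<lambda>A. det (test_mat n y i j A))
      = (\<lambda>A. \<Sum>p\<in>{p. p permutes {0..<n}}. signof p * (\<Prod>r = 0..<n. test_mat n y i j A $$ (r, p r)))"
    by (rule ext, subst det_def) (simp add: test_mat_def)
  also have "\<dots> \<in> poly_funs n"
    by (intro poly_funs_sum poly_funs_prod poly_funs.mult poly_funs.const entry)
      (auto simp: finite_permutations permutes_in_image)
  finally show ?thesis .
qed

definition GL_closure :: "nat \<Rightarrow> complex mat set \<Rightarrow> complex mat set" where
  "GL_closure n Z = {g \<in> carrier (GL n). \<forall>p\<in>poly_funs n. (\<forall>z\<in>Z. p z = 0) \<longrightarrow> p g = 0}"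

lemma GL_closure_superset: "Z \<subseteq> carrier (GL n) \<Longrightarrow> Z \<subseteq> GL_closure n Z"
  by (auto simp: GL_closure_def)

lemma GL_closure_GL: "g \<in> GL_closure n Z \<Longrightarrow> g \<in> carrier (GL n)"
  by (simp add: GL_closure_def)

lemma poly_funs_translate:
  assumes "p \<in> poly_funs n" "a \<in> carrier_mat n n" "b \<in> carrier_mat n n"
  shows "\<exists>q\<in>poly_funs n. \<forall>A\<in>carrier_mat n n. q A = p (a * A * b)"
  using assms(1)
proof (induction rule: poly_funs.induct)
  case (const c)
  show ?case by (rule bexI[of _ "\<lambda>_. c"]) (auto intro: poly_funs.const)
next
  case (entry i j)
  let ?q = "\<lambda>A. \<Sum>l<n. (\<Sum>k<n. a $$ (i, k) * A $$ (k, l)) * b $$ (l, j)"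
  have q: "?q \<in> poly_funs n"
    by (intro poly_funs_sum poly_funs.mult poly_funs.const) (auto intro: poly_funs.intros)
  have "?q A = (a * A * b) $$ (i, j)" if A: "A \<in> carrier_mat n n" for A
    unfolding mult_entry[OF square_mult[OF assms(2) A] assms(3) entry]
    by (intro sum.cong refl) (simp only: mult_entry[OF assms(2) A entry(1)] lessThan_iff)
  then show ?case by (intro bexI[OF _ q] ballI)
next
  case (add f g)
  then obtain q q' where "q \<in> poly_funs n" "q' \<in> poly_funs n"
    "\<forall>A\<in>carrier_mat n n. q A = f (a * A * b)" "\<forall>A\<in>carrier_mat n n. q' A = g (a * A * b)" by blast
  then show ?case by (intro bexI[of _ "\<lambda>A. q A + q' A"]) (auto intro: poly_funs.add)
next
  case (mult f g)
  then obtain q q' where "q \<in> poly_funs n" "q' \<in> poly_funs n"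
    "\<forall>A\<in>carrier_mat n n. q A = f (a * A * b)" "\<forall>A\<in>carrier_mat n n. q' A = g (a * A * b)" by blast
  then show ?case by (intro bexI[of _ "\<lambda>A. q A * q' A"]) (auto intro: poly_funs.mult)
qed

lemma GL_closure_translate:
  assumes g: "g \<in> GL_closure n Z" and Z: "Z \<subseteq> carrier_mat n n"
    and a: "a \<in> carrier (GL n)" and b: "b \<in> carrier (GL n)"
    and into: "\<And>z. z \<in> Z \<Longrightarrow> a * z * b \<in> GL_closure n Z'"
  shows "a * g * b \<in> GL_closure n Z'"
proof -
  have gG: "g \<in> carrier (GL n)" using g by (rule GL_closure_GL)
  have "p (a * g * b) = 0" if p: "p \<in> poly_funs n" "\<forall>z\<in>Z'. p z = 0" for p
  proof -
    obtain q where q: "q \<in> poly_funs n" "\<forall>A\<in>carrier_mat n n. q A = p (a * A * b)"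
      using poly_funs_translate[OF p(1) GL_carrier[OF a] GL_carrier[OF b]] by blast
    have "q z = 0" if "z \<in> Z" for z
      using into[OF that] p q(2) Z that unfolding GL_closure_def by auto
    then have "q g = 0" using g q(1) unfolding GL_closure_def by blast
    then show ?thesis using q(2) GL_carrier[OF gG] by simp
  qed
  then show ?thesis using GL_mult[OF GL_mult[OF a gG] b] by (auto simp: GL_closure_def)
qed

text \<open>A polynomial restricted to an affine line is a polynomial in one variable, and it vanishes as
  soon as it has infinitely many zeros.\<close>

lemma GL_closure_line:
  assumes M0: "M 0 \<in> carrier (GL n)"
    and affine: "\<And>r c. r < n \<Longrightarrow> c < n \<Longrightarrow> \<exists>x y. \<forall>t. M t $$ (r, c) = x + t * y"
    and inf: "infinite {t. M t \<in> Z}"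
  shows "M 0 \<in> GL_closure n Z"
proof -
  have poly: "\<exists>q. \<forall>t. p (M t) = poly q t" if "p \<in> poly_funs n" for p
    using that
  proof (induction rule: poly_funs.induct)
    case (const c)
    show ?case by (rule exI[of _ "[:c:]"]) simp
  next
    case (entry i j)
    obtain x y where "\<forall>t. M t $$ (i, j) = x + t * y" using affine[OF entry] by blast
    then show ?case by (intro exI[of _ "[:x, y:]"]) simp
  next
    case (add f g)
    then show ?case by (metis poly_add)
  next
    case (mult f g)
    then show ?case by (metis poly_mult)
  qed
  have "p (M 0) = 0" if p: "p \<in> poly_funs n" "\<forall>z\<in>Z. p z = 0" for p
  proof -
    obtain q where q: "\<forall>t. p (M t) = poly q t" using poly[OF p(1)] by blast
    have "{t. M t \<in> Z} \<subseteq> {t. poly q t = 0}" using q p(2) by force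
    then have "infinite {t. poly q t = 0}" using inf finite_subset by blast
    then have "q = 0" using poly_roots_finite by blast
    then show ?thesis using q by simp
  qed
  then show ?thesis using M0 by (simp add: GL_closure_def)
qed

text \<open>Ranks of blocks do not increase in the closure. If \<open>y\<close> had a larger count than \<open>w\<close> at
  \<open>(i, j)\<close>, then after moving \<open>g\<close> to the permutation matrix of \<open>y\<close> the corresponding test
  determinant would be nonzero there and zero on the whole cell of \<open>w\<close>.\<close>

lemma cell_closure_dominated:
  assumes Z: "\<And>z. z \<in> Z \<Longrightarrow> in_cell n z w" and g: "g \<in> GL_closure n Z" "in_cell n g y" and w: "w permutes {1..n}"
  shows "dominated y w"
proof (rule dominated_bounded)
  show y: "y permutes {1..n}" by (rule in_cellD(1)[OF g(2)])
  show "w permutes {1..n}" by (rule w)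
  fix i j assume i: "i \<le> n"
  show "exceed y i j \<le> exceed w i j"
  proof (rule ccontr)
    assume "\<not> ?thesis"
    then have lt: "exceed w i j < exceed y i j" by simp
    obtain b b' where b: "b \<in> upper_GL n" "b' \<in> upper_GL n" "g = b * perm_mat n y * b'"
      using g(2) by (auto simp: in_cell_def)
    obtain h where h: "h \<in> upper_GL n" "b * h = 1\<^sub>m n" "h * b = 1\<^sub>m n" by (rule upper_GL_inverse_obtain[OF b(1)])
    obtain h' where h': "h' \<in> upper_GL n" "b' * h' = 1\<^sub>m n" "h' * b' = 1\<^sub>m n" by (rule upper_GL_inverse_obtain[OF b(2)])
    note c = upper_GL_D(2)[OF b(1)] upper_GL_D(2)[OF b(2)] upper_GL_D(2)[OF h(1)] upper_GL_D(2)[OF h'(1)]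
    let ?Z = "{z. in_cell n z w}"
    have "h * g * h' \<in> GL_closure n ?Z"
    proof (rule GL_closure_translate[OF g(1)])
      show "Z \<subseteq> carrier_mat n n" using Z in_cellD(2) GL_carrier by blast
      show "h * z * h' \<in> GL_closure n ?Z" if "z \<in> Z" for z
        using in_cell_mult[OF Z[OF that] h(1) h'(1)] in_cellD(2) by (auto simp: GL_closure_def)
    qed (use h(1) h'(1) upper_GL_D(1) in auto)
    also have "h * g * h' = perm_mat n y"
    proof -
      have "h * g * h' = h * (b * (perm_mat n y * b' * h'))"
        unfolding b(3) using c by (simp only: square_assoc[where n = n] square_mult perm_mat_carrier)
      also have "perm_mat n y * b' * h' = perm_mat n y"
        by (intro cancel_right_inverse[OF h'(2)] c perm_mat_carrier)
      also have "h * (b * perm_mat n y) = perm_mat n y"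
        by (intro cancel_left_inverse[OF h(3)] c perm_mat_carrier)
      finally show ?thesis .
    qed
    finally have "perm_mat n y \<in> GL_closure n ?Z" .
    then have "\<forall>p\<in>poly_funs n. (\<forall>z\<in>?Z. p z = 0) \<longrightarrow> p (perm_mat n y) = 0"
      by (simp add: GL_closure_def)
    from bspec[OF this det_test_mat_poly[of n y i j]]
    have "det (test_mat n y i j (perm_mat n y)) = 0" using det_test_mat_zero[OF _ y i lt] by simp
    then show False using perm_mat_GL[OF y] unfolding test_mat_perm[OF y] GL_iff by simp
  qed
qed

text \<open>For a single point in two cells, \<open>cell_closure_dominated\<close> shows that the rank counts of the
  two permutations agree, and a permutation is determined by its counts.\<close>

lemma in_cell_unique:
  assumes "in_cell n g w" "in_cell n g y"
  shows "w = y"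
proof -
  have *: "dominated y w" if "in_cell n g w" "in_cell n g y" for w y
    using that in_cellD[OF that(1)]
    by (intro cell_closure_dominated[of "{g}" n w g y]) (auto simp: GL_closure_def)
  note w = in_cellD(1)[OF assms(1)] and y = in_cellD(1)[OF assms(2)]
  have "exceed w i j = exceed y i j" for i j
    using *[OF assms] *[OF assms(2,1)] unfolding dominated_def by (meson antisym)
  then have ex: "\<And>i j. (j < w (Suc i)) = (j < y (Suc i))"
    by (metis add_left_cancel exceed_Suc of_bool_eq_iff)
  have "w c = y c" for c
  proof (cases c)
    case 0
    then show ?thesis using permutes_not_in[OF w, of c] permutes_not_in[OF y, of c] by simp
  next
    case (Suc i)
    then show ?thesis using ex[of _ i] by (metis linorder_neqE_nat order_less_irrefl)
  qed
  then show ?thesis by blast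
qed

section \<open>The Bruhat decomposition\<close>

text \<open>The identity matrix with \<open>x\<close> added to column \<open>k\<close>; multiplication from the left adds multiples
  of row \<open>k\<close> to the other rows. Dually, multiplication by \<open>row_op\<close> from the right adds multiples
  of column \<open>k\<close> to the other columns.\<close>

definition col_op :: "nat \<Rightarrow> nat \<Rightarrow> (nat \<Rightarrow> complex) \<Rightarrow> complex mat" where
  "col_op n k x = mat n n (\<lambda>(r, c). (if r = c then 1 else 0) + (if c = k then x r else 0))"

definition row_op :: "nat \<Rightarrow> nat \<Rightarrow> (nat \<Rightarrow> complex) \<Rightarrow> complex mat" where
  "row_op n k y = mat n n (\<lambda>(r, c). (if r = c then 1 else 0) + (if r = k then y c else 0))"

lemma col_op_mult_entry:
  assumes "A \<in> carrier_mat n n" "r < n" "c < n" "k < n"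
  shows "(col_op n k x * A) $$ (r, c) = A $$ (r, c) + x r * A $$ (k, c)"
proof -
  have "(col_op n k x * A) $$ (r, c) = (\<Sum>l<n. col_op n k x $$ (r, l) * A $$ (l, c))"
    using assms by (intro mult_entry) (auto simp: col_op_def)
  also have "\<dots> = (\<Sum>l<n. (if l = r then A $$ (r, c) else 0) + (if l = k then x r * A $$ (k, c) else 0))"
    using assms by (intro sum.cong refl) (auto simp: col_op_def algebra_simps)
  also have "\<dots> = A $$ (r, c) + x r * A $$ (k, c)" using assms by (simp add: sum.distrib)
  finally show ?thesis .
qed

lemma mult_row_op_entry:
  assumes "A \<in> carrier_mat n n" "r < n" "c < n" "k < n"
  shows "(A * row_op n k y) $$ (r, c) = A $$ (r, c) + A $$ (r, k) * y c"
proof -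
  have "(A * row_op n k y) $$ (r, c) = (\<Sum>l<n. A $$ (r, l) * row_op n k y $$ (l, c))"
    using assms by (intro mult_entry) (auto simp: row_op_def)
  also have "\<dots> = (\<Sum>l<n. (if l = c then A $$ (r, c) else 0) + (if l = k then A $$ (r, k) * y c else 0))"
    using assms by (intro sum.cong refl) (auto simp: row_op_def algebra_simps)
  also have "\<dots> = A $$ (r, c) + A $$ (r, k) * y c" using assms by (simp add: sum.distrib)
  finally show ?thesis .
qed

lemma GL_column_nonzero:
  assumes "M \<in> carrier (GL n)" "m < n"
  shows "\<exists>r<n. M $$ (r, m) \<noteq> 0"
proof (rule ccontr)
  assume zero: "\<not> ?thesis"
  obtain h where h: "h \<in> carrier (GL n)" "h * M = 1\<^sub>m n" using GL_inverse[OF assms(1)] by blast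
  have "(h * M) $$ (m, m) = (\<Sum>k<n. h $$ (m, k) * M $$ (k, m))"
    using GL_carrier assms h by (intro mult_entry) auto
  also have "\<dots> = 0" using zero by (intro sum.neutral) auto
  finally show False using h(2) assms(2) by simp
qed

text \<open>Gaussian elimination column by column. The pivot \<open>k\<close> of column \<open>m\<close> is its lowest nonzero
  entry. Row operations upwards clear the column and column operations to the right clear row \<open>k\<close>;
  neither disturbs the columns that are finished, since these have a zero in row \<open>k\<close>.\<close>

lemma bruhat_partial:
  assumes g: "g \<in> carrier (GL n)" and "m \<le> n"
  shows "\<exists>a\<in>upper_GL n. \<exists>b\<in>upper_GL n. \<exists>f. inj_on f {..<m} \<and> f ` {..<m} \<subseteq> {..<n} \<and>
    (\<forall>c<m. \<forall>r<n. (a * g * b) $$ (r, c) = (if r = f c then 1 else 0)) \<and>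
    (\<forall>c<m. \<forall>d<n. m \<le> d \<longrightarrow> (a * g * b) $$ (f c, d) = 0)"
  using assms(2)
proof (induction m)
  case 0
  show ?case using upper_GL_one by auto
next
  case (Suc m)
  then obtain a b f where a: "a \<in> upper_GL n" and b: "b \<in> upper_GL n" and f: "inj_on f {..<m}" "f ` {..<m} \<subseteq> {..<n}"
    and cols: "\<And>c r. c < m \<Longrightarrow> r < n \<Longrightarrow> (a * g * b) $$ (r, c) = (if r = f c then 1 else 0)"
    and rows: "\<And>c d. c < m \<Longrightarrow> d < n \<Longrightarrow> m \<le> d \<Longrightarrow> (a * g * b) $$ (f c, d) = 0" by auto
  let ?M = "a * g * b"
  have m: "m < n" using Suc.prems by simp
  note ca = upper_GL_D(2)[OF a] and cb = upper_GL_D(2)[OF b] and cg = GL_carrier[OF g]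
  have M: "?M \<in> carrier (GL n)" using GL_mult upper_GL_D(1) a b g by metis
  note cM = GL_carrier[OF M]
  define k where "k = Max {r. r < n \<and> ?M $$ (r, m) \<noteq> 0}"
  have ne: "{r. r < n \<and> ?M $$ (r, m) \<noteq> 0} \<noteq> {}" using GL_column_nonzero[OF M m] by blast
  have "k \<in> {r. r < n \<and> ?M $$ (r, m) \<noteq> 0}" unfolding k_def by (intro Max_in ne) simp
  then have k: "k < n" "?M $$ (k, m) \<noteq> 0" by auto
  have above: "?M $$ (r, m) = 0" if "k < r" "r < n" for r
  proof (rule ccontr)
    assume "?M $$ (r, m) \<noteq> 0"
    then have "r \<le> k" unfolding k_def using that(2) by (intro Max_ge) auto
    then show False using that(1) by simp
  qed
  have kf: "k \<noteq> f c" if "c < m" for c using rows[OF that m] k(2) by auto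
  let ?x = "\<lambda>r. if r = k then 1 / ?M $$ (k, m) - 1 else if r < k then - ?M $$ (r, m) / ?M $$ (k, m) else 0"
  let ?X = "col_op n k ?x"
  have X: "?X \<in> upper_GL n" using k by (intro upper_GL_I) (auto simp: col_op_def)
  note cX = upper_GL_D(2)[OF X]
  let ?N = "?X * ?M"
  have N: "?N $$ (r, c) = ?M $$ (r, c) + ?x r * ?M $$ (k, c)" if "r < n" "c < n" for r c
    using col_op_mult_entry[OF cM that k(1)] .
  have cN: "?N \<in> carrier_mat n n" by (rule square_mult[OF cX cM])
  let ?y = "\<lambda>c. if m < c then - ?N $$ (k, c) else 0"
  let ?Y = "row_op n m ?y"
  have Y: "?Y \<in> upper_GL n" by (intro upper_GL_I) (auto simp: row_op_def)
  note cY = upper_GL_D(2)[OF Y]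
  let ?L = "?N * ?Y"
  have L: "?L $$ (r, c) = ?N $$ (r, c) + ?N $$ (r, m) * ?y c" if "r < n" "c < n" for r c
    using mult_row_op_entry[OF cN that m] .
  have Nm: "?N $$ (r, m) = (if r = k then 1 else 0)" if "r < n" for r
    using N[OF that m] k above[of r] that by (cases r k rule: linorder_cases) (auto simp: field_simps)
  have Nc: "?N $$ (r, c) = (if r = f c then 1 else 0)" if "r < n" "c < m" for r c
    using N[of r c] that m cols[of c r] cols[of c k] k(1) kf[of c] by simp
  have Nf: "?N $$ (f c, d) = 0" if "c < m" "d < n" "m \<le> d" for c d
  proof -
    have fc: "f c < n" using f(2) that(1) by auto
    have "?x (f c) = 0" using rows[OF that(1) m] kf[OF that(1)] by auto
    then show ?thesis using N[OF fc that(2)] rows[OF that] by simp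
  qed
  have eq: "?X * a * g * (b * ?Y) = ?L"
    using ca cb cg cX cY by (simp only: square_assoc[where n = n] square_mult)
  let ?f = "f(m := k)"
  have inj: "inj_on ?f {..<Suc m}"
    using f(1) kf by (auto simp: inj_on_def lessThan_Suc)
  have img: "?f ` {..<Suc m} \<subseteq> {..<n}" using f(2) k(1) by (auto simp: lessThan_Suc)
  have 1: "?L $$ (r, c) = (if r = ?f c then 1 else 0)" if "c < Suc m" "r < n" for r c
    using L[of r c] that m Nm[of r] Nc[of r c] by (cases "c = m") auto
  have 2: "?L $$ (?f c, d) = 0" if "c < Suc m" "d < n" "Suc m \<le> d" for c d
  proof (cases "c = m")
    case True
    then show ?thesis using L[of k d] k(1) that Nm[of k] by simp
  next
    case False
    then have c: "c < m" using that by simp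
    have fc: "f c < n" using f(2) c by auto
    then show ?thesis using L[of "f c" d] Nf[OF c, of d] Nm[OF fc] kf[OF c] that False by simp
  qed
  show ?case
    using inj img 1 2
    by (intro bexI[OF _ upper_GL_mult[OF X a]] bexI[OF _ upper_GL_mult[OF b Y]] exI[of _ ?f])
      (unfold eq, blast)
qed

theorem bruhat_decomposition:
  assumes g: "g \<in> carrier (GL n)"
  shows "\<exists>w. in_cell n g w"
proof -
  obtain a b f where a: "a \<in> upper_GL n" and b: "b \<in> upper_GL n" and f: "inj_on f {..<n}" "f ` {..<n} \<subseteq> {..<n}"
    and cols: "\<And>c r. c < n \<Longrightarrow> r < n \<Longrightarrow> (a * g * b) $$ (r, c) = (if r = f c then 1 else 0)"
    using bruhat_partial[OF g order_refl] by auto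
  note ca = upper_GL_D(2)[OF a] and cb = upper_GL_D(2)[OF b] and cg = GL_carrier[OF g]
  define w where "w i = (if i \<in> {1..n} then Suc (f (i - 1)) else i)" for i
  have w: "w permutes {1..n}"
  proof (rule bij_imp_permutes)
    have fn: "f (i - 1) < n" if "i \<in> {1..n}" for i
    proof -
      have "i - 1 \<in> {..<n}" using that by auto
      then show ?thesis using f(2) by blast
    qed
    have "inj_on w {1..n}"
    proof (rule inj_onI)
      fix i j assume ij: "i \<in> {1..n}" "j \<in> {1..n}" "w i = w j"
      then have "f (i - 1) = f (j - 1)" by (simp add: w_def)
      from inj_onD[OF f(1) this] have "i - 1 = j - 1" using ij by auto
      then show "i = j" using ij by auto
    qed
    moreover have "w ` {1..n} \<subseteq> {1..n}" using fn by (auto simp: w_def Suc_le_eq)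
    ultimately show "bij_betw w {1..n} {1..n}" unfolding bij_betw_def using endo_inj_surj[of "{1..n}" w] by blast
  qed (auto simp: w_def)
  have "a * g * b = perm_mat n w"
    by (rule eq_matI) (use cols perm_mat_entry[OF w] ca cb cg carrier_matD[OF perm_mat_carrier] in \<open>auto simp: w_def\<close>)
  then have cell: "in_cell n (a * g * b) w" using perm_mat_in_cell[OF w] by simp
  obtain h where h: "h \<in> upper_GL n" "a * h = 1\<^sub>m n" "h * a = 1\<^sub>m n" by (rule upper_GL_inverse_obtain[OF a])
  obtain h' where h': "h' \<in> upper_GL n" "b * h' = 1\<^sub>m n" "h' * b = 1\<^sub>m n" by (rule upper_GL_inverse_obtain[OF b])
  note c = upper_GL_D(2)[OF h(1)] upper_GL_D(2)[OF h'(1)]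
  have "h * (a * g * b) * h' = h * (a * (g * b * h'))"
    using ca cb cg c by (simp only: square_assoc[where n = n] square_mult)
  also have "\<dots> = g" using cancel_right_inverse[OF h'(2) c(2) cb cg] cancel_left_inverse[OF h(3) c(1) ca cg] by simp
  finally show ?thesis using in_cell_mult[OF cell h(1) h'(1)] by auto
qed

section \<open>The second Borel subgroup\<close>

text \<open>The permutation that carries the order \<open>n, 1, 2, \<dots>, n - 1\<close> of the basis vectors in \<open>E*\<close> to
  the standard one. Its matrix carries \<open>E*\<close> to \<open>E_+\<close>, so statements about \<open>B*\<close> reduce to
  statements about the upper triangular matrices.\<close>

definition rot :: "nat \<Rightarrow> nat \<Rightarrow> nat" where
  "rot n i = (if i = n then 1 else if 1 \<le> i \<and> i < n then Suc i else i)"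

lemma rot_permutes:
  assumes "1 \<le> n"
  shows "rot n permutes {1..n}"
proof (rule bij_imp_permutes)
  have "inj_on (rot n) {1..n}" by (auto simp: inj_on_def rot_def)
  moreover have "rot n ` {1..n} \<subseteq> {1..n}" using assms by (auto simp: rot_def)
  ultimately show "bij_betw (rot n) {1..n} {1..n}"
    unfolding bij_betw_def using endo_inj_surj[of "{1..n}" "rot n"] by blast
qed (use assms in \<open>auto simp: rot_def\<close>)

lemma inv_rot:
  assumes "1 \<le> n"
  shows "inv' (rot n) i = (if i = 1 then n else if 2 \<le> i \<and> i \<le> n then i - 1 else i)"
proof -
  have "rot n (if i = 1 then n else if 2 \<le> i \<and> i \<le> n then i - 1 else i) = i"
    using assms by (auto simp: rot_def)
  then show ?thesis using permutes_inv_eq[OF rot_permutes[OF assms]] by blast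
qed

definition rot_mat :: "nat \<Rightarrow> complex mat" where
  "rot_mat n = perm_mat n (rot n)"

lemma rot_mat_carrier [simp]: "rot_mat n \<in> carrier_mat n n"
  by (simp add: rot_mat_def)

lemma rot_mat_GL: "1 \<le> n \<Longrightarrow> rot_mat n \<in> carrier (GL n)"
  using perm_mat_GL[OF rot_permutes] by (simp add: rot_mat_def)

lemma rot_mat_mult_entry:
  assumes "A \<in> carrier_mat n n" "r < n" "c < n"
  shows "(rot_mat n * A) $$ (r, c) = (if r = 0 then A $$ (n - 1, c) else A $$ (r - 1, c))"
proof -
  have n: "1 \<le> n" using assms by simp
  show ?thesis
    using perm_mat_mult_entry[OF rot_permutes[OF n] assms] assms
    unfolding rot_mat_def inv_rot[OF n] by auto
qed

section \<open>Double cosets and their pairs of cells\<close>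

lemma four_block_diag1:
  assumes "x \<in> carrier_mat m m"
  shows "four_block_mat x (0\<^sub>m m 1) (0\<^sub>m 1 m) (1\<^sub>m 1 :: complex mat) \<in> carrier_mat (Suc m) (Suc m)"
    "\<And>r c. r < Suc m \<Longrightarrow> c < Suc m \<Longrightarrow> four_block_mat x (0\<^sub>m m 1) (0\<^sub>m 1 m) (1\<^sub>m 1) $$ (r, c) =
      (if r < m \<and> c < m then x $$ (r, c) else if r = c then 1 else (0::complex))"
  using assms by (auto simp: index_mat_four_block)

lemma Borel_minor_iff:
  assumes "1 \<le> n"
  shows "x \<in> Borel_minor n \<longleftrightarrow>
    x \<in> upper_GL n \<and> (\<forall>r<n. x $$ (r, n - 1) = (if r = n - 1 then 1 else 0))"
proof
  obtain m where m: "n = Suc m" using assms by (cases n) auto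
  {
    assume "x \<in> Borel_minor n"
    then obtain y where y: "y \<in> carrier (GL m)" "upper_triangular y"
      and x: "x = four_block_mat y (0\<^sub>m m 1) (0\<^sub>m 1 m) (1\<^sub>m 1)"
      unfolding Borel_minor_def m by auto
    have yc: "y \<in> carrier_mat m m" using y by (simp add: GL_iff)
    have yu: "y \<in> upper_GL m" using y by (simp add: upper_GL_def)
    note e = four_block_diag1[OF yc, folded x]
    have "x \<in> upper_GL n"
      unfolding m
    proof (rule upper_GL_I[OF e(1)])
      show "x $$ (r, c) = 0" if "c < r" "r < Suc m" for r c
        using e(2)[of r c] that upper_GL_D(3)[OF yu that(1)] by auto
      show "x $$ (r, r) \<noteq> 0" if "r < Suc m" for r
        using e(2)[of r r] that upper_GL_diag[OF yu, of r] by auto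
    qed
    then show "x \<in> upper_GL n \<and> (\<forall>r<n. x $$ (r, n - 1) = (if r = n - 1 then 1 else 0))"
      using e(2) m by auto
  next
    assume *: "x \<in> upper_GL n \<and> (\<forall>r<n. x $$ (r, n - 1) = (if r = n - 1 then 1 else 0))"
    then have xu: "x \<in> upper_GL (Suc m)" using m by simp
    define y where "y = mat m m (\<lambda>(r, c). x $$ (r, c))"
    have yc: "y \<in> carrier_mat m m" by (simp add: y_def)
    have yu: "y \<in> upper_GL m"
      using upper_GL_D(3)[OF xu] upper_GL_diag[OF xu] by (intro upper_GL_I[OF yc]) (auto simp: y_def)
    note e = four_block_diag1[OF yc]
    have "x = four_block_mat y (0\<^sub>m m 1) (0\<^sub>m 1 m) (1\<^sub>m 1)"
    proof (rule eq_matI)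
      fix r c assume "r < dim_row (four_block_mat y (0\<^sub>m m 1) (0\<^sub>m 1 m) (1\<^sub>m 1 :: complex mat))"
        "c < dim_col (four_block_mat y (0\<^sub>m m 1) (0\<^sub>m 1 m) (1\<^sub>m 1 :: complex mat))"
      then have rc: "r < Suc m" "c < Suc m" using e(1) by auto
      show "x $$ (r, c) = four_block_mat y (0\<^sub>m m 1) (0\<^sub>m 1 m) (1\<^sub>m 1) $$ (r, c)"
        unfolding e(2)[OF rc] using rc * upper_GL_D(3)[OF xu, of c r] m
        by (cases "c < m"; cases "r < m") (auto simp: y_def less_Suc_eq)
    qed (use upper_GL_D(2)[OF xu] yc in auto)
    then show "x \<in> Borel_minor n"
      using yu m unfolding Borel_minor_def upper_GL_def by auto
  }
qed

lemma Borel_minor_upper: "1 \<le> n \<Longrightarrow> x \<in> Borel_minor n \<Longrightarrow> x \<in> upper_GL n"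
  by (simp add: Borel_minor_iff)

lemma last_column_mult:
  fixes A B :: "complex mat"
  assumes A: "A \<in> carrier_mat n n" and B: "B \<in> carrier_mat n n" and n: "1 \<le> n" and r: "r < n"
    and col: "\<And>k. k < n \<Longrightarrow> B $$ (k, n - 1) = (if k = n - 1 then 1 else 0)"
  shows "(A * B) $$ (r, n - 1) = A $$ (r, n - 1)"
proof -
  have "(A * B) $$ (r, n - 1) = (\<Sum>k<n. A $$ (r, k) * B $$ (k, n - 1))"
    using n by (intro mult_entry[OF A B r]) simp
  also have "\<dots> = (\<Sum>k<n. if k = n - 1 then A $$ (r, n - 1) else 0)"
    by (intro sum.cong refl) (auto simp: col[unfolded One_nat_def])
  finally show ?thesis using n by simp
qed

lemma Borel_minor_mult:
  assumes "1 \<le> n" "x \<in> Borel_minor n" "y \<in> Borel_minor n"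
  shows "x * y \<in> Borel_minor n"
proof -
  note x = assms(2)[unfolded Borel_minor_iff[OF assms(1)]] and y = assms(3)[unfolded Borel_minor_iff[OF assms(1)]]
  show ?thesis
    unfolding Borel_minor_iff[OF assms(1)]
    using upper_GL_mult[of x n y] x y last_column_mult[of x n y] upper_GL_D(2) assms(1) by simp
qed

lemma Borel_minor_inverse:
  assumes n: "1 \<le> n" and x: "x \<in> Borel_minor n"
  obtains h where "h \<in> Borel_minor n" "x * h = 1\<^sub>m n" "h * x = 1\<^sub>m n"
proof -
  note x' = x[unfolded Borel_minor_iff[OF n]]
  obtain h where h: "h \<in> upper_GL n" "x * h = 1\<^sub>m n" "h * x = 1\<^sub>m n"
    using upper_GL_inverse_obtain x' by blast
  have "h $$ (r, n - 1) = (if r = n - 1 then 1 else 0)" if "r < n" for r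
  proof -
    have "h $$ (r, n - 1) = (h * x) $$ (r, n - 1)"
      using last_column_mult[of h n x r] upper_GL_D(2) h(1) x' n that by simp
    then show ?thesis using h(3) that n by simp
  qed
  then have "h \<in> Borel_minor n" using h(1) by (simp add: Borel_minor_iff[OF n])
  then show thesis using that h by blast
qed

text \<open>A matrix in \<open>B_{n-1}\<close> fixes \<open>e_n\<close>, hence also stabilizes \<open>E*\<close>.\<close>

lemma rot_conj_Borel_minor:
  assumes n: "1 \<le> n" and x: "x \<in> Borel_minor n"
  obtains y where "y \<in> upper_GL n" "rot_mat n * x = y * rot_mat n"
proof -
  note x' = x[unfolded Borel_minor_iff[OF n]]
  have xu: "x \<in> upper_GL n" and xc: "x \<in> carrier_mat n n" using x' upper_GL_D(2) by auto
  have "\<exists>b\<in>upper_GL n. rot_mat n * x = b * perm_mat n (rot n)"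
  proof (rule upper_times_perm_pattern[OF rot_permutes[OF n]])
    show "rot_mat n * x \<in> carrier (GL n)" using GL_mult[OF rot_mat_GL[OF n] upper_GL_D(1)[OF xu]] .
    fix r c assume rc: "r < n" "c < n" "rot n (Suc c) < Suc r"
    show "(rot_mat n * x) $$ (r, c) = 0"
      unfolding rot_mat_mult_entry[OF xc rc(1,2)]
    proof (cases "Suc c = n")
      case True
      then have c: "c = n - 1" by simp
      show "(if r = 0 then x $$ (n - 1, c) else x $$ (r - 1, c)) = 0"
        using rc conjunct2[OF x', rule_format, of "r - 1"] True n unfolding c by (auto simp: rot_def)
    next
      case False
      then show "(if r = 0 then x $$ (n - 1, c) else x $$ (r - 1, c)) = 0"
        using rc upper_GL_D(3)[OF xu, of c "r - 1"] by (simp add: rot_def)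
    qed
  qed
  then show thesis using that unfolding rot_mat_def by blast
qed

text \<open>The preimage in \<open>GL(n)\<close> of the \<open>B_{n-1}\<close>-orbit of the flag \<open>h E_+\<close>.\<close>

definition double_coset :: "nat \<Rightarrow> complex mat \<Rightarrow> complex mat set" where
  "double_coset n h = {x * h * b | x b. x \<in> Borel_minor n \<and> b \<in> upper_GL n}"

text \<open>The two cells that contain the orbit of \<open>h E_+\<close>, one for each Borel subgroup. Here \<open>v\<close> is the
  conjugate by \<open>rot\<close> of the permutation \<open>u*\<close> in the definition of \<open>Sh\<close>.\<close>

definition types :: "nat \<Rightarrow> complex mat \<Rightarrow> (nat \<Rightarrow> nat) \<Rightarrow> (nat \<Rightarrow> nat) \<Rightarrow> bool" where
  "types n h w v \<longleftrightarrow> in_cell n h w \<and> in_cell n (rot_mat n * h) v"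

lemma typesD: "types n h w v \<Longrightarrow> w permutes {1..n}" "types n h w v \<Longrightarrow> v permutes {1..n}"
  "types n h w v \<Longrightarrow> h \<in> carrier (GL n)"
  unfolding types_def using in_cellD by blast+

lemma types_unique: "types n h w v \<Longrightarrow> types n h w' v' \<Longrightarrow> w = w' \<and> v = v'"
  unfolding types_def using in_cell_unique by blast

lemma types_exist:
  assumes "1 \<le> n" "h \<in> carrier (GL n)"
  shows "\<exists>w v. types n h w v"
  unfolding types_def using bruhat_decomposition GL_mult[OF rot_mat_GL[OF assms(1)] assms(2)] assms(2) by blast

lemma double_coset_GL:
  assumes "1 \<le> n" "h \<in> carrier (GL n)"
  shows "double_coset n h \<subseteq> carrier (GL n)"
  unfolding double_coset_def
  using Borel_minor_upper[OF assms(1)] upper_GL_D(1) GL_mult assms(2) by blast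

lemma double_coset_self:
  assumes "1 \<le> n" "h \<in> carrier (GL n)"
  shows "h \<in> double_coset n h"
proof -
  have "1\<^sub>m n \<in> Borel_minor n" using upper_GL_one by (auto simp: Borel_minor_iff[OF assms(1)])
  moreover have "h = 1\<^sub>m n * h * 1\<^sub>m n"
    using left_mult_one_mat[OF GL_carrier[OF assms(2)]] right_mult_one_mat[OF GL_carrier[OF assms(2)]] by simp
  ultimately show ?thesis unfolding double_coset_def using upper_GL_one by blast
qed

lemma double_coset_closed:
  assumes n: "1 \<le> n" and h: "h \<in> carrier (GL n)" and g: "g \<in> double_coset n h"
    and x: "x \<in> Borel_minor n" and b: "b \<in> upper_GL n"
  shows "x * g * b \<in> double_coset n h"
proof -
  obtain y d where y: "y \<in> Borel_minor n" "d \<in> upper_GL n" "g = y * h * d"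
    using g unfolding double_coset_def by blast
  have c: "x \<in> carrier_mat n n" "b \<in> carrier_mat n n" "y \<in> carrier_mat n n" "d \<in> carrier_mat n n" "h \<in> carrier_mat n n"
    using Borel_minor_upper[OF n] x b y(1,2) h GL_carrier upper_GL_D(2) by blast+
  have "x * g * b = (x * y) * h * (d * b)"
    unfolding y(3) using c by (simp only: square_assoc[where n = n] square_mult)
  then show ?thesis unfolding double_coset_def
    using Borel_minor_mult[OF n x y(1)] upper_GL_mult[OF y(2) b] by blast
qed

lemma double_coset_sym:
  assumes n: "1 \<le> n" and h: "h \<in> carrier (GL n)" and g: "g \<in> double_coset n h"
  shows "h \<in> double_coset n g"
proof -
  obtain y d where y: "y \<in> Borel_minor n" "d \<in> upper_GL n" "g = y * h * d"
    using g unfolding double_coset_def by blast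
  obtain z where z: "z \<in> Borel_minor n" "y * z = 1\<^sub>m n" "z * y = 1\<^sub>m n" by (rule Borel_minor_inverse[OF n y(1)])
  obtain e where e: "e \<in> upper_GL n" "d * e = 1\<^sub>m n" "e * d = 1\<^sub>m n" by (rule upper_GL_inverse_obtain[OF y(2)])
  have c: "y \<in> carrier_mat n n" "d \<in> carrier_mat n n" "h \<in> carrier_mat n n" "z \<in> carrier_mat n n" "e \<in> carrier_mat n n"
    using Borel_minor_upper[OF n] y(1,2) z e h GL_carrier upper_GL_D(2) by blast+
  have "z * g * e = z * (y * (h * d * e))"
    unfolding y(3) using c by (simp only: square_assoc[where n = n] square_mult)
  also have "h * d * e = h" by (rule cancel_right_inverse[OF e(2) c(5,2,3)])
  also have "z * (y * h) = h" by (rule cancel_left_inverse[OF z(3) c(4,1,3)])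
  finally show ?thesis unfolding double_coset_def using z(1) e(1) by force
qed

lemma double_coset_trans:
  assumes n: "1 \<le> n" and h: "h \<in> carrier (GL n)" and g: "g \<in> double_coset n h" and f: "f \<in> double_coset n g"
  shows "f \<in> double_coset n h"
  using f double_coset_closed[OF n h g] unfolding double_coset_def[of n g] by blast

lemma types_double_coset:
  assumes n: "1 \<le> n" and t: "types n h w v" and g: "g \<in> double_coset n h"
  shows "types n g w v"
proof -
  obtain x b where x: "x \<in> Borel_minor n" "b \<in> upper_GL n" "g = x * h * b"
    using g unfolding double_coset_def by blast
  obtain y where y: "y \<in> upper_GL n" "rot_mat n * x = y * rot_mat n" by (rule rot_conj_Borel_minor[OF n x(1)])
  have c: "x \<in> carrier_mat n n" "b \<in> carrier_mat n n" "h \<in> carrier_mat n n" "y \<in> carrier_mat n n"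
    using Borel_minor_upper[OF n] x(1,2) y typesD(3)[OF t] GL_carrier upper_GL_D(2) by blast+
  have "rot_mat n * g = (rot_mat n * x) * h * b"
    unfolding x(3) using c by (simp only: square_assoc[where n = n] square_mult rot_mat_carrier)
  also have "\<dots> = y * (rot_mat n * h) * b"
    unfolding y(2) using c by (simp only: square_assoc[where n = n] square_mult rot_mat_carrier)
  finally show ?thesis
    using t x in_cell_mult[of n _ _ x b] in_cell_mult[OF _ y(1) x(2)] Borel_minor_upper[OF n x(1)]
    unfolding types_def by metis
qed

section \<open>Normal forms of double cosets\<close>

text \<open>The change of basis from \<open>e_1, \<dots>, e_n\<close> to \<open>e_1, \<dots>, e_{n-1}\<close> and the sum of \<open>e_{w(c)}\<close> over
  \<open>P\<close>. The coefficients are those of \<open>decorated\<close> up to a diagonal matrix in \<open>B_{n-1}\<close> that changes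
  their signs.\<close>

definition normal_col :: "nat \<Rightarrow> (nat \<Rightarrow> nat) \<Rightarrow> nat set \<Rightarrow> complex mat" where
  "normal_col n w P = col_op n (n - 1) (\<lambda>r. if r < n - 1 \<and> Suc r \<in> w ` P then 1 else 0)"

definition normal_mat :: "nat \<Rightarrow> (nat \<Rightarrow> nat) \<Rightarrow> nat set \<Rightarrow> complex mat" where
  "normal_mat n w P = normal_col n w P * perm_mat n w"

lemma normal_col_upper: "normal_col n w P \<in> upper_GL n"
  unfolding normal_col_def by (intro upper_GL_I) (auto simp: col_op_def)

lemma normal_mat_entry:
  assumes w: "w permutes {1..n}" and rc: "r < n" "c < n"
  shows "normal_mat n w P $$ (r, c) = (if w (Suc c) = Suc r then 1 else 0)
     + (if w (Suc c) = n \<and> r < n - 1 \<and> Suc r \<in> w ` P then 1 else 0)"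
proof -
  have i: "1 \<le> w (Suc c)" "w (Suc c) \<le> n" using permutes_ivl_le[OF w, of "Suc c"] rc by auto
  have "normal_mat n w P $$ (r, c) = normal_col n w P $$ (r, w (Suc c) - 1)"
    unfolding normal_mat_def by (rule mult_perm_mat_entry[OF w upper_GL_D(2)[OF normal_col_upper] rc])
  then show ?thesis using i rc by (auto simp: normal_col_def col_op_def)
qed

lemma normal_mat_in_cell: "w permutes {1..n} \<Longrightarrow> in_cell n (normal_mat n w P) w"
  unfolding normal_mat_def by (intro in_cell_left perm_mat_in_cell normal_col_upper)

text \<open>The type \<open>w\<close> is visible from the definition. For the second type, replace each column of the
  matrix at a position \<open>c\<close> in \<open>P\<close> other than \<open>p\<close> by column \<open>p\<close> minus the columns at the positions
  in \<open>P\<close> after \<open>p\<close> up to \<open>c\<close>. What remains is \<open>e_n\<close> plus the \<open>e_{w(c')}\<close> with \<open>c'\<close> in \<open>P\<close> after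
  \<open>c\<close>, and the leading term in the order \<open>n, 1, \<dots>, n - 1\<close> is the next value.\<close>

lemma normal_mat_types:
  assumes dec: "decorated n w P" and n: "1 \<le> n"
  shows "types n (normal_mat n w P) w (partner n w P)"
proof -
  have w: "w permutes {1..n}" and P: "P \<subseteq> {1..n}" and fin: "finite P"
    and decr: "\<And>c c'. c \<in> P \<Longrightarrow> c' \<in> P \<Longrightarrow> c < c' \<Longrightarrow> w c' < w c"
    using dec decorated_finite unfolding decorated_def by auto
  obtain p where p: "p \<in> P" "w p = n" using dec unfolding decorated_def by auto
  have pn: "1 \<le> p" "p \<le> n" using P p by auto
  have right: "p \<le> c" if "c \<in> P" for c
    using decr[OF that p(1)] permutes_ivl_le[OF w, of c] that P p(2) by (meson atLeastAtMost_iff leD leI subsetD)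
  have wn: "w c = n \<longleftrightarrow> c = p" for c using p(2) permutes_neq[OF w, of c p] by auto
  let ?N = "normal_mat n w P" and ?v = "partner n w P"
  let ?Y = "rot_mat n * ?N"
  have cellN: "in_cell n ?N w" by (rule normal_mat_in_cell[OF w])
  have NG: "?N \<in> carrier (GL n)" and Nc: "?N \<in> carrier_mat n n" using in_cellD(2)[OF cellN] GL_carrier by auto
  have YG: "?Y \<in> carrier (GL n)" by (rule GL_mult[OF rot_mat_GL[OF n] NG])
  note Yc = GL_carrier[OF YG]
  have Y: "?Y $$ (r, m) = (if w (Suc m) = r then 1 else 0) + (if Suc m = p \<and> r \<in> w ` P then 1 else 0)"
    if "r < n" "m < n" "1 \<le> r" for r m
  proof -
    have "r - 1 < n - 1" using that by simp
    then show ?thesis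
      using rot_mat_mult_entry[OF Nc that(1,2)] normal_mat_entry[OF w, of "r - 1" m P] that wn[of "Suc m"] by simp
  qed
  define b :: "complex mat" where "b = mat n n (\<lambda>(m, c). if Suc c \<in> P \<and> Suc c \<noteq> p
      then (if Suc m = p then 1 else if Suc m \<in> P \<and> m \<le> c then - 1 else 0) else if m = c then 1 else 0)"
  have b: "b \<in> upper_GL n"
  proof (rule upper_GL_I)
    show "b \<in> carrier_mat n n" by (simp add: b_def)
    show "b $$ (r, c) = 0" if "c < r" "r < n" for r c
      using that right[of "Suc c"] by (auto simp: b_def)
    show "b $$ (r, r) \<noteq> 0" if "r < n" for r using that by (auto simp: b_def)
  qed
  have "in_cell n ?Y ?v"
  proof (rule in_cell_pattern[OF partner_permutes[OF dec] YG b])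
    fix r c assume rc: "r < n" "c < n" "?v (Suc c) < Suc r"
    have r1: "1 \<le> r"
      using rc permutes_ivl_le[OF partner_permutes[OF dec], of "Suc c"] by simp
    have eq: "(?Y * b) $$ (r, c) = (\<Sum>m<n. ?Y $$ (r, m) * b $$ (m, c))"
      by (rule mult_entry[OF Yc upper_GL_D(2)[OF b] rc(1,2)])
    have large: "c' \<le> Suc c" if "c' \<in> P" "w c' = r" "Suc c \<in> P" for c'
    proof (rule ccontr)
      assume "\<not> c' \<le> Suc c"
      then have "r \<le> next_value w P (Suc c)" using le_next_value[OF fin that(1), of "Suc c" w] that(2) by simp
      then show False using rc(3) that(3) by (simp add: partner_def)
    qed
    show "(?Y * b) $$ (r, c) = 0"
    proof (cases "Suc c \<in> P \<and> Suc c \<noteq> p")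
      case False
      have "(?Y * b) $$ (r, c) = (\<Sum>m<n. if m = c then ?Y $$ (r, c) else 0)"
        unfolding eq using False rc by (intro sum.cong refl) (auto simp: b_def)
      also have "\<dots> = ?Y $$ (r, c)" using rc by simp
      also have "\<dots> = 0"
      proof (cases "Suc c = p")
        case True
        have "r \<notin> w ` P"
        proof
          assume "r \<in> w ` P"
          then obtain c' where c': "c' \<in> P" "w c' = r" by auto
          then have "c' = p" using large[OF c'] True p(1) right[OF c'(1)] by simp
          then show False using c'(2) p(2) rc(1) by simp
        qed
        then show ?thesis using Y[OF rc(1,2) r1] True p rc(1) by simp
      next
        case False
        then have "Suc c \<notin> P" using \<open>\<not> (Suc c \<in> P \<and> Suc c \<noteq> p)\<close> by simp
        then have "w (Suc c) < r" using rc by (simp add: partner_def)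
        then show ?thesis using Y[OF rc(1,2) r1] False by simp
      qed
      finally show ?thesis .
    next
      case True
      show ?thesis
      proof (cases "r \<in> w ` P")
        case False
        have "?Y $$ (r, m) * b $$ (m, c) = 0" if m: "m < n" for m
        proof (cases "w (Suc m) = r")
          case wr: True
          then have "Suc m \<notin> P" "Suc m \<noteq> p" using False p by auto
          then show ?thesis using m rc True by (simp add: b_def)
        qed (use Y[OF rc(1) m r1] False in simp)
        then show ?thesis unfolding eq by (intro sum.neutral) simp
      next
        case rP: True
        then obtain c' where c': "c' \<in> P" "w c' = r" by auto
        have le: "c' \<le> Suc c" using large[OF c'] True by simp
        have c'p: "c' \<noteq> p" using c' p(2) rc(1) by auto
        have c'n: "1 \<le> c'" using c' P by auto
        have wr: "w m = r \<longleftrightarrow> m = c'" for m using c' permutes_neq[OF w, of m c'] by auto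
        have "?Y $$ (r, m) * b $$ (m, c) = (if m = p - 1 then 1 else 0) + (if m = c' - 1 then - 1 else 0)"
          if m: "m < n" for m
        proof -
          have idx: "m = p - 1 \<longleftrightarrow> Suc m = p" "m = c' - 1 \<longleftrightarrow> Suc m = c'" using pn c'n by auto
          have Yv: "?Y $$ (r, m) = (if Suc m = c' then 1 else 0) + (if Suc m = p then 1 else 0)"
            unfolding Y[OF rc(1) m r1] using rP wr[of "Suc m"] by simp
          have bv: "b $$ (m, c) = (if Suc m = p then 1 else if Suc m \<in> P \<and> m \<le> c then - 1 else 0)"
            using m rc(2) True by (simp add: b_def)
          consider "Suc m = p" | "Suc m = c'" "Suc m \<noteq> p" | "Suc m \<noteq> c'" "Suc m \<noteq> p" by blast
          then show ?thesis
          proof cases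
            case 1
            then show ?thesis unfolding Yv bv idx using c'p by simp
          next
            case 2
            then have "Suc m \<in> P \<and> m \<le> c" using c'(1) le by simp
            then show ?thesis unfolding Yv bv idx using 2 by simp
          next
            case 3
            then show ?thesis unfolding Yv bv idx by simp
          qed
        qed
        then have "(?Y * b) $$ (r, c) = (\<Sum>m<n. (if m = p - 1 then 1 else 0) + (if m = c' - 1 then - 1 else 0))"
          unfolding eq by (intro sum.cong refl) simp
        also have "\<dots> = 0"
        proof -
          have "p - 1 < n" "c' - 1 < n" using pn c'n le rc(2) by linarith+
          then show ?thesis by (simp add: sum.distrib)
        qed
        finally show ?thesis .
      qed
    qed
  qed
  then show ?thesis using cellN by (simp add: types_def)
qed

text \<open>A largest element of \<open>T\<close> among those that lie weakly above \<open>c\<close> in both coordinates.\<close>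

lemma maximal_point:
  fixes w :: "nat \<Rightarrow> nat"
  assumes "finite T" "c \<in> T"
  shows "\<exists>d\<in>T. c \<le> d \<and> w c \<le> w d \<and> \<not> (\<exists>e\<in>T. d < e \<and> w d < w e)"
proof -
  let ?S = "{d \<in> T. c \<le> d \<and> w c \<le> w d}"
  have "c \<in> ?S" using assms by simp
  then have "Max ?S \<in> ?S" using assms(1) by (intro Max_in) auto
  moreover have "\<not> (\<exists>e\<in>T. Max ?S < e \<and> w (Max ?S) < w e)"
  proof
    assume "\<exists>e\<in>T. Max ?S < e \<and> w (Max ?S) < w e"
    then obtain e where e: "e \<in> T" "Max ?S < e" "w (Max ?S) < w e" by blast
    then have "e \<in> ?S" using \<open>Max ?S \<in> ?S\<close> by auto
    then have "e \<le> Max ?S" using assms(1) by (intro Max_ge) auto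
    then show False using e(2) by simp
  qed
  ultimately show ?thesis by blast
qed

text \<open>The vector \<open>z\<close>, which may be scaled so that its last entry is 1, is the last column of a
  triangular matrix, the only column in which it differs from the identity, and stands at the
  position \<open>p\<close> with value \<open>n\<close>. Its coefficients at positions before \<open>p\<close> are removed by column
  operations. Among the remaining positions \<open>T\<close> only the maximal ones \<open>D\<close>, for the order by
  position and value, are kept: each element of \<open>T\<close> is assigned a maximal one \<open>\<phi>\<close> above it, and
  the matrix \<open>x\<close> in \<open>B_{n-1}\<close> sends \<open>e_{w(d)}\<close> to the part of \<open>z\<close> assigned to \<open>d\<close>. Then \<open>x\<close>
  applied to the sum of \<open>e_{w(d)}\<close> is the relevant part of \<open>z\<close>, and the other columns change only
  by earlier ones.\<close>

lemma normal_form_reduce: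
  assumes n: "1 \<le> n" and w: "w permutes {1..n}" and z: "z (n - 1) \<noteq> 0"
  shows "\<exists>P x b. decorated n w P \<and> x \<in> Borel_minor n \<and> b \<in> upper_GL n \<and>
    x * normal_mat n w P = mat n n (\<lambda>(r, c). if c = n - 1 then z r else if r = c then 1 else 0) * perm_mat n w * b"
proof -
  let ?p = "inv' w n"
  let ?pos = "\<lambda>r. inv' w (Suc r)"
  define \<zeta> where "\<zeta> r = z r / z (n - 1)" for r
  define T where "T = {c \<in> {1..n}. ?p < c \<and> \<zeta> (w c - 1) \<noteq> 0}"
  define D where "D = {d \<in> T. \<not> (\<exists>e\<in>T. d < e \<and> w d < w e)}"
  have finT: "finite T" by (simp add: T_def)
  have "\<forall>c\<in>T. \<exists>d\<in>D. c \<le> d \<and> w c \<le> w d" unfolding D_def using maximal_point[OF finT, of _ w] by blast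
  then obtain \<phi> where \<phi>: "\<And>c. c \<in> T \<Longrightarrow> \<phi> c \<in> D \<and> c \<le> \<phi> c \<and> w c \<le> w (\<phi> c)" by metis
  have \<phi>D: "\<phi> d = d" if "d \<in> D" for d
  proof (rule ccontr)
    assume ne: "\<phi> d \<noteq> d"
    have dT: "d \<in> T" using that by (simp add: D_def)
    then have "d < \<phi> d" "w d < w (\<phi> d)" "\<phi> d \<in> T"
      using \<phi>[OF dT] ne permutes_neq[OF w, of d "\<phi> d"] by (auto simp: D_def)
    then show False using that by (auto simp: D_def)
  qed
  have p: "1 \<le> ?p" "?p \<le> n" "w ?p = n"
    using permutes_ivl_le[OF permutes_inv[OF w], of n] n permutes_inverses(1)[OF w] by auto
  have pos: "1 \<le> ?pos r" "?pos r \<le> n" "w (?pos r) = Suc r" if "r < n" for r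
    using permutes_ivl_le[OF permutes_inv[OF w], of "Suc r"] that permutes_inverses(1)[OF w] by auto
  have posp: "?pos r = ?p \<longleftrightarrow> r = n - 1" if "r < n" for r
  proof
    assume "?pos r = ?p"
    then have "w (?pos r) = w ?p" by (rule arg_cong)
    then have "Suc r = n" unfolding pos(3)[OF that] p(3) .
    then show "r = n - 1" by simp
  next
    assume "r = n - 1"
    then have "Suc r = n" using n by simp
    then show "?pos r = ?p" by simp
  qed
  have posinj: "?pos r = ?pos s \<longleftrightarrow> r = s" if "r < n" "s < n" for r s
  proof
    assume "?pos r = ?pos s"
    then have "w (?pos r) = w (?pos s)" by (rule arg_cong)
    then show "r = s" unfolding pos(3)[OF that(1)] pos(3)[OF that(2)] by simp
  qed simp
  have pT: "?p \<notin> T" "?p \<notin> D" by (auto simp: T_def D_def)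
  let ?P = "insert ?p D"
  have dec: "decorated n w ?P"
    unfolding decorated_def
  proof (intro conjI ballI impI)
    show "?P \<subseteq> {1..n}" using p by (auto simp: D_def T_def)
    show "\<exists>p\<in>?P. w p = n" using p by blast
    fix c c' assume c: "c \<in> ?P" "c' \<in> ?P" "c < c'"
    have c'D: "c' \<in> D"
    proof (rule ccontr)
      assume "c' \<notin> D"
      then have "c' = ?p" using c by simp
      then have "c \<in> D" "c < ?p" using c by auto
      then show False by (simp add: D_def T_def)
    qed
    then have c'n: "c' \<in> {1..n}" "c' \<noteq> ?p" using pT by (auto simp: D_def T_def)
    show "w c' < w c"
    proof (cases "c = ?p")
      case True
      have "w c' \<le> n" using permutes_ivl_le[OF w, of c'] c'n(1) by simp
      moreover have "w c' \<noteq> w ?p" using permutes_neq[OF w c'n(2)] .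
      ultimately show ?thesis unfolding True p(3) by simp
    next
      case False
      then have "\<not> w c < w c'" using c c'D by (auto simp: D_def)
      then show ?thesis using permutes_neq[OF w, of c c'] c(3) by simp
    qed
  qed (rule w)
  define x where "x = mat n n (\<lambda>(r, m). if ?pos m \<in> D then (if ?pos r \<in> T \<and> \<phi> (?pos r) = ?pos m then \<zeta> r else 0)
      else if r = m then 1 else 0)"
  have xc: "x \<in> carrier_mat n n" by (simp add: x_def)
  have xu: "x \<in> upper_GL n"
  proof (rule upper_GL_I[OF xc])
    fix r c assume rc: "c < r" "r < n"
    show "x $$ (r, c) = 0"
    proof (rule ccontr)
      assume "x $$ (r, c) \<noteq> 0"
      then have "?pos r \<in> T" "\<phi> (?pos r) = ?pos c" using rc by (auto simp: x_def split: if_splits)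
      then have "w (?pos r) \<le> w (?pos c)" using \<phi> by metis
      then show False using pos(3)[of r] pos(3)[of c] rc by simp
    qed
  next
    fix r assume r: "r < n"
    show "x $$ (r, r) \<noteq> 0"
    proof (cases "?pos r \<in> D")
      case True
      then have "?pos r \<in> T" "\<zeta> r \<noteq> 0" using pos(3)[OF r] by (auto simp: D_def T_def)
      then show ?thesis using True r \<phi>D[OF True] by (simp add: x_def)
    qed (use r in \<open>simp add: x_def\<close>)
  qed
  have xlast: "x $$ (r, n - 1) = (if r = n - 1 then 1 else 0)" if "r < n" for r
    using that n posp[of "n - 1"] pT by (auto simp: x_def)
  have xB: "x \<in> Borel_minor n" using xu xlast by (simp add: Borel_minor_iff[OF n])
  have xrow: "x $$ (n - 1, m) = (if m = n - 1 then 1 else 0)" if "m < n" for m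
    using that n posp[of "n - 1"] pT posp[of m] by (auto simp: x_def)
  (* The inverse of the triangular matrix with last column z is again of this form. *)
  let ?Z = "mat n n (\<lambda>(r, c). if c = n - 1 then z r else if r = c then 1 else 0)"
  let ?Z' = "col_op n (n - 1) (\<lambda>r. if r = n - 1 then 1 / z (n - 1) - 1 else - \<zeta> r)"
  have Zc: "?Z \<in> carrier_mat n n" and Zc': "?Z' \<in> carrier_mat n n" by (auto simp: col_op_def)
  have ZZ': "?Z' * ?Z = 1\<^sub>m n"
  proof (rule eq_matI)
    fix r c assume "r < dim_row (1\<^sub>m n :: complex mat)" "c < dim_col (1\<^sub>m n :: complex mat)"
    then have rc: "r < n" "c < n" by auto
    show "(?Z' * ?Z) $$ (r, c) = 1\<^sub>m n $$ (r, c)"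
      using col_op_mult_entry[OF Zc rc, of "n - 1"] n z rc by (auto simp: \<zeta>_def field_simps)
  qed (use Zc Zc' in auto)
  have Z'Z: "?Z * ?Z' = 1\<^sub>m n" by (rule mat_mult_left_right_inverse[OF Zc' Zc ZZ'])
  let ?B = "normal_col n w ?P"
  have Bc: "?B \<in> carrier_mat n n" by (rule upper_GL_D(2)[OF normal_col_upper])
  let ?xB = "x * ?B"
  have xBc: "?xB \<in> carrier_mat n n" by (rule square_mult[OF xc Bc])
  have xB_entry: "?xB $$ (r, c) = x $$ (r, c)
     + (if c = n - 1 then (\<Sum>m<n. x $$ (r, m) * (if ?pos m \<in> D then 1 else 0)) else 0)" if "r < n" "c < n" for r c
  proof -
    have memP: "m < n - 1 \<and> Suc m \<in> w ` ?P \<longleftrightarrow> ?pos m \<in> D" if m: "m < n" for m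
    proof -
      have "Suc m \<in> w ` ?P \<longleftrightarrow> ?pos m \<in> ?P"
        using pos(3)[OF m] permutes_inverses(2)[OF w] by (metis image_iff)
      then show ?thesis using posp[OF m] pT m by auto
    qed
    have "?xB $$ (r, c) = (\<Sum>m<n. x $$ (r, m) * ?B $$ (m, c))" by (rule mult_entry[OF xc Bc that])
    also have "\<dots> = (\<Sum>m<n. (if m = c then x $$ (r, c) else 0)
        + (if c = n - 1 then x $$ (r, m) * (if ?pos m \<in> D then 1 else 0) else 0))"
      using that memP by (intro sum.cong refl) (auto simp: normal_col_def col_op_def)
    also have "\<dots> = x $$ (r, c) + (if c = n - 1 then (\<Sum>m<n. x $$ (r, m) * (if ?pos m \<in> D then 1 else 0)) else 0)"
      using that by (simp add: sum.distrib)
    finally show ?thesis .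
  qed
  have sumD: "(\<Sum>m<n. x $$ (r, m) * (if ?pos m \<in> D then 1 else 0)) = (if ?pos r \<in> T then \<zeta> r else 0)" if r: "r < n" for r
  proof (cases "?pos r \<in> T")
    case True
    then have f: "\<phi> (?pos r) \<in> D" using \<phi> by blast
    define m0 where "m0 = w (\<phi> (?pos r)) - 1"
    have "1 \<le> \<phi> (?pos r)" "\<phi> (?pos r) \<le> n" using f by (auto simp: D_def T_def)
    then have wm: "1 \<le> w (\<phi> (?pos r))" "w (\<phi> (?pos r)) \<le> n" using permutes_ivl_le[OF w] by auto
    then have m0: "m0 < n" "?pos m0 = \<phi> (?pos r)" using permutes_inverses(2)[OF w] by (auto simp: m0_def)
    have "(\<Sum>m<n. x $$ (r, m) * (if ?pos m \<in> D then 1 else 0)) = (\<Sum>m<n. if m = m0 then \<zeta> r else 0)"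
    proof (intro sum.cong refl)
      fix m assume "m \<in> {..<n}"
      then have m: "m < n" by simp
      then show "x $$ (r, m) * (if ?pos m \<in> D then 1 else 0) = (if m = m0 then \<zeta> r else 0)"
        using r True m0 f posinj[OF m m0(1)] by (auto simp: x_def)
    qed
    then show ?thesis using True m0 by simp
  next
    case False
    then have "x $$ (r, m) * (if ?pos m \<in> D then 1 else 0) = 0" if "m < n" for m
      using that r by (simp add: x_def)
    then show ?thesis using False by (simp add: sum.neutral)
  qed
  let ?C = "?Z' * ?xB"
  have Cc: "?C \<in> carrier_mat n n" by (rule square_mult[OF Zc' xBc])
  have C: "?C $$ (r, c) = ?xB $$ (r, c) - (if r = n - 1 then 0 else if c = n - 1 then \<zeta> r else 0)"
    if "r < n" "c < n" "r \<noteq> n - 1" for r c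
  proof -
    have last: "?xB $$ (n - 1, c) = (if c = n - 1 then 1 else 0)"
      using xB_entry[of "n - 1" c] sumD[of "n - 1"] xrow[of c] that n posp[of "n - 1"] pT by auto
    show ?thesis using col_op_mult_entry[OF xBc that(1,2), of "n - 1"] that n last by auto
  qed
  (* The factor b is forced by the equation; what has to be seen is that it is upper triangular. *)
  let ?b = "perm_mat n (inv' w) * ?C * perm_mat n w"
  have piC: "perm_mat n (inv' w) * ?C \<in> carrier_mat n n" by (rule square_mult[OF perm_mat_carrier Cc])
  have bc: "?b \<in> carrier_mat n n" by (rule square_mult[OF piC perm_mat_carrier])
  have eq: "x * normal_mat n w ?P = ?Z * perm_mat n w * ?b"
  proof -
    have "?Z * perm_mat n w * ?b = ?Z * (perm_mat n w * (perm_mat n (inv' w) * (?C * perm_mat n w)))"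
      using Zc Cc by (simp only: square_assoc[where n = n] square_mult perm_mat_carrier)
    also have "perm_mat n w * (perm_mat n (inv' w) * (?C * perm_mat n w)) = ?C * perm_mat n w"
      by (intro cancel_left_inverse[OF perm_mat_inverse(1)[OF w]] square_mult Cc perm_mat_carrier)
    also have "\<dots> = ?Z' * (?xB * perm_mat n w)" by (rule square_assoc[OF Zc' xBc perm_mat_carrier])
    also have "?Z * \<dots> = ?xB * perm_mat n w"
      by (intro cancel_left_inverse[OF Z'Z] square_mult Zc Zc' xc Bc perm_mat_carrier)
    also have "\<dots> = x * normal_mat n w ?P" unfolding normal_mat_def by (rule square_assoc[OF xc Bc perm_mat_carrier])
    finally show ?thesis by simp
  qed
  have NG: "normal_mat n w ?P \<in> carrier (GL n)" using in_cellD(2)[OF normal_mat_in_cell[OF w]] .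
  have "?b \<in> carrier (GL n)"
    using GL_factor[of "?Z * perm_mat n w" ?b n] GL_mult[OF upper_GL_D(1)[OF xu] NG] bc Zc
    unfolding eq by (simp add: square_mult)
  moreover have "?b $$ (k, c) = 0" if kc: "c < k" "k < n" for k c
  proof -
    let ?r = "w (Suc k) - 1" and ?m = "w (Suc c) - 1"
    have wk: "1 \<le> w (Suc k)" "w (Suc k) \<le> n" and wc: "1 \<le> w (Suc c)" "w (Suc c) \<le> n"
      using permutes_ivl_le[OF w, of "Suc k"] permutes_ivl_le[OF w, of "Suc c"] kc by auto
    then have rm: "?r < n" "?m < n" by auto
    have pr: "?pos ?r = Suc k" "?pos ?m = Suc c" using wk wc permutes_inverses(2)[OF w] by auto
    have ne: "?r \<noteq> ?m" using pr kc by auto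
    have iv: "inv' (inv' w) = w" using inv_inv_eq[OF permutes_bij[OF w]] .
    have "?b $$ (k, c) = (perm_mat n (inv' w) * ?C) $$ (k, ?m)"
      using kc by (intro mult_perm_mat_entry[OF w piC]) auto
    also have "\<dots> = ?C $$ (?r, ?m)"
      using perm_mat_mult_entry[OF permutes_inv[OF w] Cc kc(2) rm(2)] by (simp add: iv)
    also have "\<dots> = 0"
    proof (cases "?r = n - 1")
      case True
      have "?xB $$ (n - 1, ?m) = 0"
        using xB_entry[of "n - 1" ?m] xrow[OF rm(2)] ne True n rm by auto
      then show ?thesis using col_op_mult_entry[OF xBc rm, of "n - 1"] True n by simp
    next
      case False
      show ?thesis
      proof (cases "?m = n - 1")
        case True
        then have cp: "Suc c = ?p" using pr posp[OF rm(2)] by simp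
        have "Suc k \<in> T \<longleftrightarrow> \<zeta> ?r \<noteq> 0" using kc cp by (auto simp: T_def)
        then have "?pos ?r \<in> T \<longleftrightarrow> \<zeta> ?r \<noteq> 0" unfolding pr(1) .
        then have "?xB $$ (?r, ?m) = \<zeta> ?r"
          using xB_entry[OF rm] xlast[OF rm(1)] True False sumD[OF rm(1)] by auto
        then show ?thesis using C[OF rm False] True False by simp
      next
        case mn: False
        have "x $$ (?r, ?m) = 0"
        proof (rule ccontr)
          assume nz: "x $$ (?r, ?m) \<noteq> 0"
          have "x $$ (?r, ?m) = (if Suc c \<in> D then (if Suc k \<in> T \<and> \<phi> (Suc k) = Suc c then \<zeta> ?r else 0)
              else if ?r = ?m then 1 else 0)"
            unfolding x_def index_mat(1)[OF rm] prod.case pr ..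
          then have "Suc k \<in> T" "\<phi> (Suc k) = Suc c" using nz ne by (auto split: if_splits)
          then show False using \<phi>[of "Suc k"] kc by simp
        qed
        then show ?thesis using C[OF rm False] xB_entry[OF rm] mn by simp
      qed
    qed
    finally show ?thesis .
  qed
  then have "upper_triangular ?b" using bc by (intro upper_triangularI) auto
  ultimately have "?b \<in> upper_GL n" by (simp add: upper_GL_def)
  then show ?thesis using dec xB eq by blast
qed

text \<open>In \<open>h = b w d\<close> split off from \<open>b\<close> the factor \<open>x\<close> in \<open>B_{n-1}\<close>, obtained by replacing its last
  column by \<open>e_n\<close>. What is left differs from the identity only in the last column.\<close>

lemma normal_form_exists:
  assumes n: "1 \<le> n" and h: "h \<in> carrier (GL n)"
  shows "\<exists>w P. decorated n w P \<and> h \<in> double_coset n (normal_mat n w P)"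
proof -
  obtain w where cell: "in_cell n h w" using bruhat_decomposition[OF h] by blast
  then obtain b d where b: "b \<in> upper_GL n" "d \<in> upper_GL n" and hb: "h = b * perm_mat n w * d"
    and w: "w permutes {1..n}" by (auto simp: in_cell_def)
  note bD = upper_GL_D[OF b(1)] and dc = upper_GL_D(2)[OF b(2)]
  define x where "x = mat n n (\<lambda>(r, c). if c = n - 1 then (if r = n - 1 then 1 else 0) else b $$ (r, c))"
  have xc: "x \<in> carrier_mat n n" by (simp add: x_def)
  have xu: "x \<in> upper_GL n"
    using bD(3) upper_GL_diag[OF b(1)] by (intro upper_GL_I[OF xc]) (auto simp: x_def)
  have xB: "x \<in> Borel_minor n" using xu by (simp add: Borel_minor_iff[OF n] x_def)
  obtain y where y: "y \<in> Borel_minor n" "x * y = 1\<^sub>m n" "y * x = 1\<^sub>m n" by (rule Borel_minor_inverse[OF n xB])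
  have yu: "y \<in> upper_GL n" by (rule Borel_minor_upper[OF n y(1)])
  note yc = upper_GL_D(2)[OF yu]
  let ?z = "\<lambda>r. (y * b) $$ (r, n - 1)"
  let ?Z = "mat n n (\<lambda>(r, c). if c = n - 1 then ?z r else if r = c then 1 else 0)"
  have ybu: "y * b \<in> upper_GL n" by (rule upper_GL_mult[OF yu b(1)])
  have yb: "y * b = ?Z"
  proof (rule eq_matI)
    fix r c assume "r < dim_row ?Z" "c < dim_col ?Z"
    then have rc: "r < n" "c < n" by auto
    show "(y * b) $$ (r, c) = ?Z $$ (r, c)"
    proof (cases "c = n - 1")
      case False
      have "(y * b) $$ (r, c) = (\<Sum>k<n. y $$ (r, k) * b $$ (k, c))" by (rule mult_entry[OF yc bD(2) rc])
      also have "\<dots> = (\<Sum>k<n. y $$ (r, k) * x $$ (k, c))"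
        using False rc by (intro sum.cong refl) (simp add: x_def)
      also have "\<dots> = (y * x) $$ (r, c)" by (rule mult_entry[OF yc xc rc, symmetric])
      finally show ?thesis using False y(3) rc by simp
    qed (use rc in simp)
  qed (use upper_GL_D(2)[OF ybu] in auto)
  have "?z (n - 1) \<noteq> 0" using upper_GL_diag[OF ybu, of "n - 1"] n by simp
  from normal_form_reduce[where z = ?z, OF n w this] obtain P x' b' where dec: "decorated n w P"
    and x': "x' \<in> Borel_minor n" and b': "b' \<in> upper_GL n"
    and eq: "x' * normal_mat n w P = ?Z * perm_mat n w * b'" by blast
  note c' = upper_GL_D(2)[OF Borel_minor_upper[OF n x']] upper_GL_D(2)[OF b']
  obtain e where e: "e \<in> upper_GL n" "b' * e = 1\<^sub>m n" "e * b' = 1\<^sub>m n" by (rule upper_GL_inverse_obtain[OF b'])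
  note ec = upper_GL_D(2)[OF e(1)]
  have Nc: "normal_mat n w P \<in> carrier_mat n n"
    using GL_carrier[OF in_cellD(2)[OF normal_mat_in_cell[OF w]]] .
  have "x * x' * normal_mat n w P * (e * d) = x * ((x' * normal_mat n w P) * (e * d))"
    using xc c' ec dc Nc by (simp only: square_assoc[where n = n] square_mult)
  also have "\<dots> = x * (y * b * perm_mat n w * b' * e * d)"
    unfolding eq yb[symmetric] using xc yc bD(2) c' ec dc
    by (simp only: square_assoc[where n = n] square_mult perm_mat_carrier)
  also have "y * b * perm_mat n w * b' * e = y * b * perm_mat n w"
    using yc bD(2) by (intro cancel_right_inverse[OF e(2)] ec c' square_mult perm_mat_carrier)
  also have "x * (y * b * perm_mat n w * d) = x * (y * (b * perm_mat n w * d))"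
    using xc yc bD(2) dc by (simp only: square_assoc[where n = n] square_mult perm_mat_carrier)
  also have "\<dots> = h"
    unfolding hb using bD(2) dc by (intro cancel_left_inverse[OF y(2)] xc yc square_mult perm_mat_carrier)
  finally have "h \<in> double_coset n (normal_mat n w P)"
    unfolding double_coset_def using Borel_minor_mult[OF n xB x'] upper_GL_mult[OF e(1) b(2)] by blast
  then show ?thesis using dec by blast
qed

lemma types_normal_form:
  assumes n: "1 \<le> n" and t: "types n h w v"
  obtains P where "decorated n w P" "v = partner n w P" "h \<in> double_coset n (normal_mat n w P)"
proof -
  obtain w' P where P: "decorated n w' P" "h \<in> double_coset n (normal_mat n w' P)"
    using normal_form_exists[OF n typesD(3)[OF t]] by blast
  have "types n h w' (partner n w' P)" using types_double_coset[OF n normal_mat_types[OF P(1) n] P(2)] .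
  then have "w' = w" "v = partner n w P" using types_unique[OF t] by auto
  then show thesis using that P by blast
qed

lemma types_interlaced: "1 \<le> n \<Longrightarrow> types n h w v \<Longrightarrow> interlaced n w v"
  using types_normal_form interlaced_partner by metis

text \<open>The pair of types determines \<open>w\<close> and, by \<open>decoration_unique\<close>, the set \<open>P\<close>, so both matrices
  have the same normal form.\<close>

theorem types_determine_coset:
  assumes n: "1 \<le> n" and t: "types n h w v" "types n g w v"
  shows "g \<in> double_coset n h"
proof -
  obtain P where P: "decorated n w P" "v = partner n w P" "h \<in> double_coset n (normal_mat n w P)"
    by (rule types_normal_form[OF n t(1)])
  obtain P' where P': "decorated n w P'" "v = partner n w P'" "g \<in> double_coset n (normal_mat n w P')"
    by (rule types_normal_form[OF n t(2)])
  have eq: "P' = P" using decoration_unique P P' by metis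
  have NG: "normal_mat n w P \<in> carrier (GL n)" using typesD(3)[OF normal_mat_types[OF P(1) n]] .
  show ?thesis
    using double_coset_trans[OF n typesD(3)[OF t(1)] double_coset_sym[OF n NG P(3)] P'(3)[unfolded eq]] .
qed

section \<open>Closures of double cosets along parabolic classes\<close>

lemma GL_closure_trans:
  assumes "g \<in> GL_closure n Z" "Z \<subseteq> GL_closure n Z'"
  shows "g \<in> GL_closure n Z'"
  using assms unfolding GL_closure_def by blast

lemma closure_double_coset_stable:
  assumes n: "1 \<le> n" and h: "h \<in> carrier (GL n)" and g: "g \<in> GL_closure n (double_coset n h)"
    and x: "x \<in> Borel_minor n" and b: "b \<in> upper_GL n"
  shows "x * g * b \<in> GL_closure n (double_coset n h)"
proof (rule GL_closure_translate[OF g])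
  show "double_coset n h \<subseteq> carrier_mat n n" using double_coset_GL[OF n h] GL_carrier by blast
  show "x * z * b \<in> GL_closure n (double_coset n h)" if "z \<in> double_coset n h" for z
    using double_coset_closed[OF n h that x b] GL_closure_superset[OF double_coset_GL[OF n h]] by blast
qed (use x b Borel_minor_upper[OF n] upper_GL_D(1) in auto)

lemma double_coset_in_closure:
  assumes n: "1 \<le> n" and h: "h \<in> carrier (GL n)" and g: "g \<in> GL_closure n (double_coset n h)"
  shows "double_coset n g \<subseteq> GL_closure n (double_coset n h)"
  using closure_double_coset_stable[OF n h g] unfolding double_coset_def[of n g] by blast

lemma closure_double_coset_trans:
  assumes "1 \<le> n" "h \<in> carrier (GL n)" "g \<in> GL_closure n (double_coset n h)"
    "f \<in> GL_closure n (double_coset n g)"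
  shows "f \<in> GL_closure n (double_coset n h)"
  using GL_closure_trans[OF assms(4) double_coset_in_closure[OF assms(1-3)]] .

text \<open>The identity matrix with an entry \<open>t\<close> at \<open>(b, a)\<close>; from the right it adds \<open>t\<close> times column
  \<open>b\<close> to column \<open>a\<close>.\<close>

definition transvection :: "nat \<Rightarrow> nat \<Rightarrow> nat \<Rightarrow> complex \<Rightarrow> complex mat" where
  "transvection n b a t = row_op n b (\<lambda>c. if c = a then t else 0)"

lemma mult_transvection_entry:
  assumes "A \<in> carrier_mat n n" "r < n" "c < n" "b < n"
  shows "(A * transvection n b a t) $$ (r, c) = A $$ (r, c) + (if c = a then t * A $$ (r, b) else 0)"
  using mult_row_op_entry[OF assms] by (simp add: transvection_def)

lemma transvection_carrier [simp]: "transvection n b a t \<in> carrier_mat n n"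
  by (simp add: transvection_def row_op_def)

lemma transvection_GL:
  assumes "a \<noteq> b" "a < n" "b < n"
  shows "transvection n b a t \<in> carrier (GL n)"
proof -
  have "transvection n b a t * transvection n b a (- t) = 1\<^sub>m n"
  proof (rule eq_matI)
    fix r c assume "r < dim_row (1\<^sub>m n :: complex mat)" "c < dim_col (1\<^sub>m n :: complex mat)"
    then have rc: "r < n" "c < n" by auto
    show "(transvection n b a t * transvection n b a (- t)) $$ (r, c) = 1\<^sub>m n $$ (r, c)"
      using mult_transvection_entry[OF transvection_carrier rc assms(3)] rc assms
      by (auto simp: transvection_def row_op_def)
  qed (auto simp: transvection_def row_op_def)
  then show ?thesis using GL_factor[of "transvection n b a t" "transvection n b a (- t)" n] GL_one by simp
qed

lemma mult_transvection_0:
  assumes "A \<in> carrier_mat n n" "b < n"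
  shows "A * transvection n b a 0 = A"
proof (rule eq_matI)
  fix r c assume "r < dim_row A" "c < dim_col A"
  then have "r < n" "c < n" using assms by auto
  from mult_transvection_entry[OF assms(1) this assms(2), of a 0]
  show "(A * transvection n b a 0) $$ (r, c) = A $$ (r, c)" by simp
qed (use assms carrier_matD[OF transvection_carrier] in simp_all)

lemma closure_along_line:
  assumes A: "A \<in> carrier (GL n)" and b: "b < n" and inf: "infinite {t. A * transvection n b a t \<in> Z}"
  shows "A \<in> GL_closure n Z"
proof -
  have "A * transvection n b a 0 \<in> GL_closure n Z"
  proof (rule GL_closure_line[OF _ _ inf])
    show "A * transvection n b a 0 \<in> carrier (GL n)" using mult_transvection_0[OF GL_carrier[OF A] b] A by simp
    fix r c assume rc: "r < n" "c < n"
    show "\<exists>x y. \<forall>t. (A * transvection n b a t) $$ (r, c) = x + t * y"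
      unfolding mult_transvection_entry[OF GL_carrier[OF A] rc b]
      by (intro exI[of _ "A $$ (r, c)"] exI[of _ "if c = a then A $$ (r, b) else 0"]) simp
  qed
  then show ?thesis using mult_transvection_0[OF GL_carrier[OF A] b] by simp
qed

lemma transvection_parabolic:
  assumes "Suc k < n"
  shows "transvection n (Suc k) k t \<in> minimal_parabolic n k"
  using transvection_GL[of k "Suc k" n t] assms by (auto simp: minimal_parabolic_def transvection_def row_op_def)

text \<open>The points \<open>A x(t)\<close>, with \<open>x(t)\<close> the transvection, of an affine line inside the projective
  line are pairwise distinct, so at most one of them is the base point.\<close>

lemma finite_upper_on_line:
  assumes A: "A \<in> minimal_parabolic n k" and k: "Suc k < n"
  shows "finite {t. A * transvection n (Suc k) k t \<in> upper_GL n}"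
proof -
  note A' = minimal_parabolic_D[OF A]
  let ?a = "A $$ (Suc k, k)" and ?d = "A $$ (Suc k, Suc k)"
  have zero: "?a + t * ?d = 0" if "A * transvection n (Suc k) k t \<in> upper_GL n" for t
    using upper_GL_D(3)[OF that, of k "Suc k"] mult_transvection_entry[OF A'(2), of "Suc k" k "Suc k" k t] k by simp
  have ne: "?a \<noteq> 0 \<or> ?d \<noteq> 0"
    using parabolic_notin_upper(1)[OF A] upper_GL_diag[of A n "Suc k"] k by blast
  have "t = s" if "A * transvection n (Suc k) k t \<in> upper_GL n" "A * transvection n (Suc k) k s \<in> upper_GL n" for t s
  proof -
    have eqs: "?a + t * ?d = 0" "?a + s * ?d = 0" using zero that by auto
    then have "t * ?d = s * ?d" by (metis add_left_cancel)
    moreover have "?d \<noteq> 0" using eqs ne by auto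
    ultimately show ?thesis by simp
  qed
  then show ?thesis by (metis (no_types, lifting) finite.simps finite_subset insertI1 mem_Collect_eq subsetI)
qed

text \<open>An affine line avoids two given points of the projective line infinitely often.\<close>

lemma infinite_generic_line:
  assumes "A \<in> minimal_parabolic n k" "B \<in> minimal_parabolic n k" "Suc k < n"
  shows "infinite {t. A * transvection n (Suc k) k t \<notin> upper_GL n \<and> B * transvection n (Suc k) k t \<notin> upper_GL n}"
proof
  let ?x = "transvection n (Suc k) k"
  assume "finite {t. A * ?x t \<notin> upper_GL n \<and> B * ?x t \<notin> upper_GL n}"
  then have "finite ({t. A * ?x t \<notin> upper_GL n \<and> B * ?x t \<notin> upper_GL n}
      \<union> {t. A * ?x t \<in> upper_GL n} \<union> {t. B * ?x t \<in> upper_GL n})"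
    using finite_upper_on_line assms by simp
  moreover have "{t. A * ?x t \<notin> upper_GL n \<and> B * ?x t \<notin> upper_GL n}
      \<union> {t. A * ?x t \<in> upper_GL n} \<union> {t. B * ?x t \<in> upper_GL n} = UNIV" by blast
  ultimately show False using infinite_UNIV_char_0[where 'a = complex] by simp
qed

text \<open>The counterpart of \<open>cell_ascent\<close> at a descent: on the line through \<open>g\<close> there is exactly one
  point in the smaller cell, reached by \<open>p\<close> inverse, and \<open>p * q\<close> is triangular exactly when \<open>q\<close>
  leads to it.\<close>

lemma cell_parabolic_descent:
  assumes g: "in_cell n g w" and k: "Suc k < n" and desc: "w (Suc (Suc k)) < w (Suc k)"
  shows "\<exists>p\<in>minimal_parabolic n k. \<forall>q\<in>minimal_parabolic n k.
    (p * q \<notin> upper_GL n \<longrightarrow> in_cell n (g * q) w) \<and> (p * q \<in> upper_GL n \<longrightarrow> in_cell n (g * q) (w \<circ> simple k))"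
proof -
  obtain p where p: "p \<in> minimal_parabolic n k" "in_cell n (g * p) (w \<circ> simple k)"
    using cell_descent[OF g k] by blast
  obtain p' where p': "p' \<in> minimal_parabolic n k" "p * p' = 1\<^sub>m n" by (rule minimal_parabolic_inverse[OF p(1)])
  note gc = GL_carrier[OF in_cellD(2)[OF g]]
  show ?thesis
  proof (intro bexI[OF _ p'(1)] ballI conjI impI)
    fix q assume q: "q \<in> minimal_parabolic n k"
    note c = minimal_parabolic_D(2)[OF p(1)] minimal_parabolic_D(2)[OF p'(1)] minimal_parabolic_D(2)[OF q]
    have eq: "g * p * (p' * q) = g * q"
    proof -
      have "g * p * (p' * q) = g * (p * (p' * q))" using c gc by (simp only: square_assoc[where n = n] square_mult)
      also have "p * (p' * q) = q" by (rule cancel_left_inverse[OF p'(2) c])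
      finally show ?thesis .
    qed
    have asc: "(w \<circ> simple k) (Suc k) < (w \<circ> simple k) (Suc (Suc k))" using desc by simp
    show "in_cell n (g * q) w" if "p' * q \<notin> upper_GL n"
      using cell_ascent[OF p(2) asc minimal_parabolic_mult[OF p'(1) q] that] unfolding eq
      by (simp only: comp_assoc transpose_comp_involutory comp_id)
    show "in_cell n (g * q) (w \<circ> simple k)" if "p' * q \<in> upper_GL n"
      using in_cell_right[OF p(2) that] unfolding eq .
  qed
qed

text \<open>At a common descent the projective line through \<open>h\<close> has one exceptional point for each of the
  two cells; all other points have the types of \<open>h\<close>.\<close>

lemma types_parabolic_descent:
  assumes t: "types n h w v" and k: "Suc k < n"
    and desc: "w (Suc (Suc k)) < w (Suc k)" "v (Suc (Suc k)) < v (Suc k)"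
  shows "\<exists>p\<in>minimal_parabolic n k. \<exists>p'\<in>minimal_parabolic n k. \<forall>q\<in>minimal_parabolic n k.
    types n (h * q) (if p * q \<in> upper_GL n then w \<circ> simple k else w)
      (if p' * q \<in> upper_GL n then v \<circ> simple k else v)"
proof -
  have cells: "in_cell n h w" "in_cell n (rot_mat n * h) v" using t by (auto simp: types_def)
  note hc = GL_carrier[OF in_cellD(2)[OF cells(1)]]
  obtain p where p: "p \<in> minimal_parabolic n k" "\<forall>q\<in>minimal_parabolic n k.
    (p * q \<notin> upper_GL n \<longrightarrow> in_cell n (h * q) w) \<and> (p * q \<in> upper_GL n \<longrightarrow> in_cell n (h * q) (w \<circ> simple k))"
    using cell_parabolic_descent[OF cells(1) k desc(1)] by blast
  obtain p' where p': "p' \<in> minimal_parabolic n k" "\<forall>q\<in>minimal_parabolic n k.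
    (p' * q \<notin> upper_GL n \<longrightarrow> in_cell n (rot_mat n * h * q) v) \<and>
    (p' * q \<in> upper_GL n \<longrightarrow> in_cell n (rot_mat n * h * q) (v \<circ> simple k))"
    using cell_parabolic_descent[OF cells(2) k desc(2)] by blast
  have "rot_mat n * h * q = rot_mat n * (h * q)" if "q \<in> minimal_parabolic n k" for q
    by (rule square_assoc[OF rot_mat_carrier hc minimal_parabolic_D(2)[OF that]])
  then show ?thesis unfolding types_def
    using p p' by (intro bexI[OF _ p(1)] bexI[OF _ p'(1)]) auto
qed

text \<open>The non-exceptional points of the line have the types of \<open>h\<close>, hence lie in its double coset,
  and an affine line through any point \<open>h q\<close> contains infinitely many of them.\<close>

lemma parabolic_class_in_closure:
  assumes n: "1 \<le> n" and t: "types n h w v" and k: "Suc k < n"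
    and desc: "w (Suc (Suc k)) < w (Suc k)" "v (Suc (Suc k)) < v (Suc k)"
    and q: "q \<in> minimal_parabolic n k"
  shows "h * q \<in> GL_closure n (double_coset n h)"
proof -
  obtain p p' where p: "p \<in> minimal_parabolic n k" "p' \<in> minimal_parabolic n k"
    and generic: "\<And>q. q \<in> minimal_parabolic n k \<Longrightarrow> types n (h * q) (if p * q \<in> upper_GL n then w \<circ> simple k else w)
      (if p' * q \<in> upper_GL n then v \<circ> simple k else v)"
    using types_parabolic_descent[OF t k desc] by blast
  let ?x = "transvection n (Suc k) k"
  note c = minimal_parabolic_D(2)[OF p(1)] minimal_parabolic_D(2)[OF p(2)] minimal_parabolic_D(2)[OF q]
    GL_carrier[OF typesD(3)[OF t]]
  have hq: "h * q \<in> carrier (GL n)" by (rule GL_mult[OF typesD(3)[OF t] minimal_parabolic_D(1)[OF q]])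
  have "h * q * ?x s \<in> double_coset n h"
    if s: "p * q * ?x s \<notin> upper_GL n" "p' * q * ?x s \<notin> upper_GL n" for s
  proof -
    have qx: "q * ?x s \<in> minimal_parabolic n k" by (rule minimal_parabolic_mult[OF q transvection_parabolic[OF k]])
    have "p * (q * ?x s) \<notin> upper_GL n" "p' * (q * ?x s) \<notin> upper_GL n"
      using s c by (simp_all only: square_assoc[where n = n] square_mult transvection_carrier not_False_eq_True)
    then have "types n (h * (q * ?x s)) w v" using generic[OF qx] by simp
    then have "h * (q * ?x s) \<in> double_coset n h" by (rule types_determine_coset[OF n t])
    then show ?thesis using c by (simp only: square_assoc[where n = n] square_mult transvection_carrier)
  qed
  then have "{s. p * q * ?x s \<notin> upper_GL n \<and> p' * q * ?x s \<notin> upper_GL n} \<subseteq> {s. h * q * ?x s \<in> double_coset n h}"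
    by blast
  moreover have "infinite {s. p * q * ?x s \<notin> upper_GL n \<and> p' * q * ?x s \<notin> upper_GL n}"
    by (intro infinite_generic_line minimal_parabolic_mult p q k)
  ultimately have "infinite {s. h * q * ?x s \<in> double_coset n h}" using finite_subset by blast
  then show ?thesis by (rule closure_along_line[OF hq k])
qed

text \<open>Right multiplication by \<open>q\<close> is a homeomorphism that maps the double coset into its closure.\<close>

lemma closure_parabolic_saturated:
  assumes n: "1 \<le> n" and t: "types n h w v" and k: "Suc k < n"
    and desc: "w (Suc (Suc k)) < w (Suc k)" "v (Suc (Suc k)) < v (Suc k)"
    and g: "g \<in> GL_closure n (double_coset n h)" and q: "q \<in> minimal_parabolic n k"
  shows "g * q \<in> GL_closure n (double_coset n h)"
proof -
  note h = typesD(3)[OF t]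
  have "1\<^sub>m n * g * q \<in> GL_closure n (double_coset n h)"
  proof (rule GL_closure_translate[OF g _ GL_one minimal_parabolic_D(1)[OF q]])
    show "double_coset n h \<subseteq> carrier_mat n n" using double_coset_GL[OF n h] GL_carrier by blast
    fix z assume z: "z \<in> double_coset n h"
    have zcl: "z \<in> GL_closure n (double_coset n h)" using GL_closure_superset[OF double_coset_GL[OF n h]] z by blast
    have zc: "z \<in> carrier_mat n n" using z double_coset_GL[OF n h] GL_carrier by blast
    have "z * q \<in> GL_closure n (double_coset n z)"
      by (rule parabolic_class_in_closure[OF n types_double_coset[OF n t z] k desc q])
    then show "1\<^sub>m n * z * q \<in> GL_closure n (double_coset n h)"
      using closure_double_coset_trans[OF n h zcl] left_mult_one_mat[OF zc] by simp
  qed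
  then show ?thesis using left_mult_one_mat[OF GL_carrier[OF GL_closure_GL[OF g]]] by simp
qed

text \<open>The two exceptional points of the line either coincide, and then both types go down at once,
  or they are distinct, and then each type goes down at one of them.\<close>

lemma descent_split:
  assumes t: "types n h w v" and k: "Suc k < n"
    and desc: "w (Suc (Suc k)) < w (Suc k)" "v (Suc (Suc k)) < v (Suc k)"
  obtains (unramified) q where "q \<in> minimal_parabolic n k" "types n (h * q) (w \<circ> simple k) (v \<circ> simple k)"
  | (ramified) q q' where "q \<in> minimal_parabolic n k" "q' \<in> minimal_parabolic n k"
      "types n (h * q) (w \<circ> simple k) v" "types n (h * q') w (v \<circ> simple k)"
proof -
  obtain p p' where p: "p \<in> minimal_parabolic n k" "p' \<in> minimal_parabolic n k"
    and generic: "\<And>q. q \<in> minimal_parabolic n k \<Longrightarrow> types n (h * q) (if p * q \<in> upper_GL n then w \<circ> simple k else w)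
      (if p' * q \<in> upper_GL n then v \<circ> simple k else v)"
    using types_parabolic_descent[OF t k desc] by blast
  obtain q where q: "q \<in> minimal_parabolic n k" "p * q = 1\<^sub>m n" "q * p = 1\<^sub>m n" by (rule minimal_parabolic_inverse[OF p(1)])
  obtain q' where q': "q' \<in> minimal_parabolic n k" "p' * q' = 1\<^sub>m n" "q' * p' = 1\<^sub>m n"
    by (rule minimal_parabolic_inverse[OF p(2)])
  note c = minimal_parabolic_D(2)[OF p(1)] minimal_parabolic_D(2)[OF p(2)] minimal_parabolic_D(2)[OF q(1)]
    minimal_parabolic_D(2)[OF q'(1)]
  show thesis
  proof (cases "p' * q \<in> upper_GL n")
    case True
    then show thesis using unramified[OF q(1)] generic[OF q(1)] q(2) upper_GL_one by simp
  next
    case False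
    have "p * q' \<notin> upper_GL n"
    proof
      assume u: "p * q' \<in> upper_GL n"
      have "p' * q * (p * q') = p' * (q * (p * q'))" using c by (simp only: square_assoc[where n = n] square_mult)
      also have "q * (p * q') = q'" by (rule cancel_left_inverse[OF q(3) c(3,1,4)])
      finally have "p * q' * (p' * q) = 1\<^sub>m n"
        using mat_mult_left_right_inverse[of "p' * q" n "p * q'"] c q'(2) by (simp add: square_mult)
      then have "p' * q \<in> upper_GL n"
        using upper_GL_inverse[OF u, of "p' * q"] GL_mult minimal_parabolic_D(1) p(2) q(1) by blast
      then show False using False by simp
    qed
    then show thesis
      using ramified[OF q(1) q'(1)] generic[OF q(1)] generic[OF q'(1)] q(2) q'(2) False upper_GL_one by simp
  qed
qed

lemma cell_parabolic_raise:
  assumes g: "in_cell n g w" and k: "Suc k < n"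
  shows "\<exists>p\<in>minimal_parabolic n k. \<forall>q\<in>minimal_parabolic n k. p * q \<notin> upper_GL n \<longrightarrow>
    in_cell n (g * q) (if w (Suc (Suc k)) < w (Suc k) then w else w \<circ> simple k)"
proof (cases "w (Suc (Suc k)) < w (Suc k)")
  case True
  then show ?thesis using cell_parabolic_descent[OF g k True] by auto
next
  case False
  then have asc: "w (Suc k) < w (Suc (Suc k))"
    using permutes_neq[OF in_cellD(1)[OF g], of "Suc k" "Suc (Suc k)"] by auto
  have "in_cell n (g * q) (w \<circ> simple k)" if "q \<in> minimal_parabolic n k" "1\<^sub>m n * q \<notin> upper_GL n" for q
    using cell_ascent[OF g asc that(1)] that(2) left_mult_one_mat[OF minimal_parabolic_D(2)[OF that(1)]] by simp
  moreover have "1\<^sub>m n \<in> minimal_parabolic n k" using upper_GL_one upper_subset_parabolic by blast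
  ultimately show ?thesis using False by auto
qed

text \<open>The generic point of a line carries the larger one of the two possible permutations in both
  types.\<close>

lemma types_raise:
  assumes t: "types n h w v" and k: "Suc k < n"
  shows "\<exists>q\<in>minimal_parabolic n k. types n (h * q) (if w (Suc (Suc k)) < w (Suc k) then w else w \<circ> simple k)
    (if v (Suc (Suc k)) < v (Suc k) then v else v \<circ> simple k)"
proof -
  have cells: "in_cell n h w" "in_cell n (rot_mat n * h) v" using t by (auto simp: types_def)
  note hc = GL_carrier[OF in_cellD(2)[OF cells(1)]]
  obtain p where p: "p \<in> minimal_parabolic n k" "\<And>q. q \<in> minimal_parabolic n k \<Longrightarrow> p * q \<notin> upper_GL n \<Longrightarrow>
    in_cell n (h * q) (if w (Suc (Suc k)) < w (Suc k) then w else w \<circ> simple k)"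
    using cell_parabolic_raise[OF cells(1) k] by blast
  obtain p' where p': "p' \<in> minimal_parabolic n k" "\<And>q. q \<in> minimal_parabolic n k \<Longrightarrow> p' * q \<notin> upper_GL n \<Longrightarrow>
    in_cell n (rot_mat n * h * q) (if v (Suc (Suc k)) < v (Suc k) then v else v \<circ> simple k)"
    using cell_parabolic_raise[OF cells(2) k] by blast
  obtain s where s: "p * transvection n (Suc k) k s \<notin> upper_GL n" "p' * transvection n (Suc k) k s \<notin> upper_GL n"
    using infinite_generic_line[OF p(1) p'(1) k] by (metis (mono_tags, lifting) empty_Collect_eq finite.emptyI)
  let ?q = "transvection n (Suc k) k s"
  have q: "?q \<in> minimal_parabolic n k" by (rule transvection_parabolic[OF k])
  have "rot_mat n * h * ?q = rot_mat n * (h * ?q)" by (rule square_assoc[OF rot_mat_carrier hc transvection_carrier])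
  then show ?thesis unfolding types_def using p(2)[OF q s(1)] p'(2)[OF q s(2)] q by (intro bexI[OF _ q]) simp
qed

lemma dominated_simple_self: "w (Suc (Suc k)) < w (Suc k) \<Longrightarrow> dominated (w \<circ> simple k) w"
  by (rule dominated_simple_lift[OF dominated_refl])

section \<open>Orbits of coordinate flags\<close>

lemma normal_mat_singleton:
  assumes "decorated n w {p}"
  shows "normal_mat n w {p} = perm_mat n w"
proof -
  have w: "w permutes {1..n}" "w p = n" using assms by (auto simp: decorated_def)
  show ?thesis
  proof (rule eq_matI)
    fix r c assume "r < dim_row (perm_mat n w)" "c < dim_col (perm_mat n w)"
    then have rc: "r < n" "c < n" using carrier_matD[OF perm_mat_carrier] by metis+
    show "normal_mat n w {p} $$ (r, c) = perm_mat n w $$ (r, c)"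
      using normal_mat_entry[OF w(1) rc] perm_mat_entry[OF w(1) rc] w(2) by auto
  qed (use carrier_matD[OF perm_mat_carrier] carrier_matD[OF GL_carrier[OF in_cellD(2)[OF normal_mat_in_cell[OF w(1)]]]]
    in \<open>simp_all\<close>)
qed

lemma perm_mat_types:
  assumes "1 \<le> n" "decorated n w {p}"
  shows "types n (perm_mat n w) w (partner n w {p})"
  using normal_mat_types[OF assms(2,1)] normal_mat_singleton[OF assms(2)] by simp

lemma partner_singleton:
  assumes "c \<in> {1..n}"
  shows "partner n w {p} c = (if c = p then 1 else Suc (w c))"
proof -
  have empty: "{c \<in> {p}. p < c} = {}" by auto
  have "next_value w {p} p = 0" unfolding next_value_def empty by simp
  then show ?thesis using assms by (simp add: partner_def)
qed

text \<open>The flags with \<open>e_{y(a)} + t e_{y(b)}\<close> in place of \<open>e_{y(a)}\<close> have, for \<open>t \<noteq> 0\<close>, the types of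
  the permutation \<open>y\<close> with \<open>y a\<close> and \<open>y b\<close> exchanged, and they tend to the flag of \<open>y\<close>. The vector
  \<open>e_n\<close> takes no part in this, since \<open>a\<close> and \<open>b\<close> differ from its position \<open>p\<close>; so the types for
  \<open>E*\<close> change in the same way.\<close>

lemma transposition_degeneration:
  assumes n: "1 \<le> n" and dec: "decorated n y {p}" and ab: "1 \<le> a" "a < b" "b \<le> n" "y a < y b" "a \<noteq> p" "b \<noteq> p"
  shows "perm_mat n y \<in> GL_closure n (double_coset n (perm_mat n (y \<circ> Transposition.transpose a b)))"
proof -
  let ?z = "y \<circ> Transposition.transpose a b"
  have y: "y permutes {1..n}" and yp: "y p = n" "p \<in> {1..n}" using dec by (auto simp: decorated_def)
  have z: "?z permutes {1..n}" using ab by (intro permutes_comp_transpose y) auto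
  have zp: "?z p = n" using yp ab by simp
  have decz: "decorated n ?z {p}" using z zp yp by (auto simp: decorated_def)
  let ?A = "perm_mat n y"
  let ?M = "\<lambda>t. ?A * transvection n (b - 1) (a - 1) t"
  have idx: "a - 1 < n" "b - 1 < n" "a - 1 \<noteq> b - 1" "Suc (a - 1) = a" "Suc (b - 1) = b" using ab by auto
  have "?M t \<in> double_coset n (perm_mat n ?z)" if t: "t \<noteq> 0" for t
  proof -
    have MG: "?M t \<in> carrier (GL n)" by (intro GL_mult perm_mat_GL[OF y] transvection_GL idx)
    note Mc = GL_carrier[OF MG]
    (* Subtracting 1/t times column a from column b removes the leading entry of column b. *)
    let ?B = "transvection n (a - 1) (b - 1) (- 1 / t)"
    have B: "?B \<in> upper_GL n"
    proof (rule upper_GL_I[OF transvection_carrier])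
    qed (use idx ab in \<open>auto simp: transvection_def row_op_def\<close>)
    have M: "?M t $$ (r, c) = (if y (Suc c) = Suc r then 1 else 0) + (if Suc c = a \<and> y b = Suc r then t else 0)"
      if "r < n" "c < n" for r c
    proof -
      have "c = a - 1 \<longleftrightarrow> Suc c = a" using ab by auto
      then show ?thesis
        using mult_transvection_entry[OF perm_mat_carrier that idx(2)] perm_mat_entry[OF y that]
          perm_mat_entry[OF y that(1) idx(2)] idx by simp
    qed
    have yab: "y a \<noteq> y b" using ab by simp
    have MB: "(?M t * ?B) $$ (r, c) = (if Suc c = b then (if y a = Suc r then - 1 / t else 0)
        else (if y (Suc c) = Suc r then 1 else 0) + (if Suc c = a \<and> y b = Suc r then t else 0))"
      if "r < n" "c < n" for r c
    proof -
      have "c = b - 1 \<longleftrightarrow> Suc c = b" using ab by auto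
      then show ?thesis
        using mult_transvection_entry[OF Mc that idx(1)] M[OF that] M[OF that(1) idx(1)] idx t ab yab by auto
    qed
    have pattern: "(?M t * ?B) $$ (r, c) = 0" if "r < n" "c < n" "?z (Suc c) < Suc r" for r c
    proof -
      consider "Suc c = a" | "Suc c = b" | "Suc c \<noteq> a" "Suc c \<noteq> b" by blast
      then show ?thesis unfolding MB[OF that(1,2)] using that(3) ab by cases auto
    qed
    have pcol: "(?M t * ?B) $$ (r, c) = 0" if "r < n" "c < n" "Suc c = p" "Suc r \<noteq> n" for r c
      unfolding MB[OF that(1,2)] using that(3,4) ab yp by auto
    have 1: "in_cell n (?M t) ?z" by (rule in_cell_pattern[OF z MG B pattern])
    have RM: "rot_mat n * ?M t \<in> carrier (GL n)" by (rule GL_mult[OF rot_mat_GL[OF n] MG])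
    note Bc = upper_GL_D(2)[OF B]
    have 2: "in_cell n (rot_mat n * ?M t) (partner n ?z {p})"
    proof (rule in_cell_pattern[OF partner_permutes[OF decz] RM B])
      fix r c assume rc: "r < n" "c < n" "partner n ?z {p} (Suc c) < Suc r"
      have "rot_mat n * ?M t * ?B = rot_mat n * (?M t * ?B)" by (rule square_assoc[OF rot_mat_carrier Mc Bc])
      then have e: "(rot_mat n * ?M t * ?B) $$ (r, c) = (if r = 0 then (?M t * ?B) $$ (n - 1, c) else (?M t * ?B) $$ (r - 1, c))"
        using rot_mat_mult_entry[OF square_mult[OF Mc Bc] rc(1,2)] by simp
      have r0: "r \<noteq> 0" using rc(3) partner_singleton[of "Suc c" n ?z p] rc(2) by (auto split: if_splits)
      have "(?M t * ?B) $$ (r - 1, c) = 0"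
      proof (cases "Suc c = p")
        case True
        then show ?thesis using r0 rc by (intro pcol) auto
      next
        case False
        then have "?z (Suc c) < Suc (r - 1)" using rc partner_singleton[of "Suc c" n ?z p] r0 by simp
        then show ?thesis using rc by (intro pattern) auto
      qed
      then show "(rot_mat n * ?M t * ?B) $$ (r, c) = 0" using e r0 by simp
    qed
    have "types n (?M t) ?z (partner n ?z {p})" using 1 2 by (simp only: types_def)
    then show ?thesis by (rule types_determine_coset[OF n perm_mat_types[OF n decz]])
  qed
  then have "UNIV - {0} \<subseteq> {t. ?M t \<in> double_coset n (perm_mat n ?z)}" by blast
  moreover have "infinite (UNIV - {0 :: complex})" using infinite_UNIV_char_0 by (simp add: infinite_remove)
  ultimately have "infinite {t. ?M t \<in> double_coset n (perm_mat n ?z)}" using finite_subset by blast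
  then show ?thesis by (rule closure_along_line[OF perm_mat_GL[OF y] idx(2)])
qed

text \<open>The transpositions of \<open>dominated_step\<close> lead from \<open>y\<close> to \<open>w\<close>, and none of them moves the value
  \<open>n\<close>, which both permutations have at \<open>p\<close>.\<close>

lemma singleton_closure:
  assumes n: "1 \<le> n" and "decorated n y {p}" and w: "decorated n w {p}" and "dominated y w"
  shows "perm_mat n y \<in> GL_closure n (double_coset n (perm_mat n w))"
  using assms(2,4)
proof (induction "n * n - card (inversions n y)" arbitrary: y rule: less_induct)
  case less
  have pw: "w permutes {1..n}" "w p = n" using w by (auto simp: decorated_def)
  have py: "y permutes {1..n}" "y p = n" "p \<in> {1..n}" using less.prems by (auto simp: decorated_def)
  have wG: "perm_mat n w \<in> carrier (GL n)" by (rule perm_mat_GL[OF pw(1)])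
  show ?case
  proof (cases "y = w")
    case True
    then show ?thesis
      using GL_closure_superset[OF double_coset_GL[OF n wG]] double_coset_self[OF n wG] by blast
  next
    case False
    then obtain a b where ab: "1 \<le> a" "a < b" "b \<le> n" "y a < y b" "y b \<le> w a" "y a \<noteq> w a"
      and dom: "dominated (y \<circ> Transposition.transpose a b) w"
      using dominated_step[OF py(1) pw(1) less.prems(2)] by metis
    have ap: "a \<noteq> p" using ab py pw by auto
    have bp: "b \<noteq> p"
    proof
      assume "b = p"
      then have "n \<le> w a" using ab(5) py(2) by simp
      then have "w a = w p" using permutes_ivl_le[OF pw(1), of a] ab pw(2) by simp
      then show False using permutes_neq[OF pw(1) ap] by simp
    qed
    let ?z = "y \<circ> Transposition.transpose a b"
    have z: "?z permutes {1..n}" using ab by (intro permutes_comp_transpose py) auto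
    have decz: "decorated n ?z {p}" using z py ap bp by (auto simp: decorated_def)
    have "card (inversions n y) < card (inversions n ?z)"
      using ab by (intro inversions_comp_transpose[OF py(1)])
    then have "n * n - card (inversions n ?z) < n * n - card (inversions n y)"
      using card_inversions_le[of n ?z] by linarith
    then have zw: "perm_mat n ?z \<in> GL_closure n (double_coset n (perm_mat n w))"
      using less.hyps decz dom by blast
    show ?thesis
      by (rule closure_double_coset_trans[OF n wG zw transposition_degeneration[OF n less.prems(1) ab(1-4) ap bp]])
  qed
qed

section \<open>The closure order on double cosets\<close>

text \<open>Induction on the total number of inversions of \<open>w\<close> and \<open>v\<close>. At a common descent the closure
  is a union of projective lines, so \<open>g\<close> may be replaced by a generic point of its line, which
  keeps its types below \<open>w\<close> and \<open>v\<close> by lifting, and then both points by exceptional points of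
  their lines, to which the induction hypothesis applies. Without a common descent both orbits
  contain coordinate flags.\<close>

lemma dominated_imp_closure:
  assumes n: "1 \<le> n"
  shows "types n h w v \<Longrightarrow> types n g y u \<Longrightarrow> dominated y w \<Longrightarrow> dominated u v
    \<Longrightarrow> g \<in> GL_closure n (double_coset n h)"
proof (induction "card (inversions n w) + card (inversions n v)" arbitrary: h w v g y u rule: less_induct)
  case less
  note t = less.prems(1) and t' = less.prems(2)
  note hG = typesD(3)[OF t]
  have h_cl: "h \<in> GL_closure n (double_coset n h)"
    using GL_closure_superset[OF double_coset_GL[OF n hG]] double_coset_self[OF n hG] by blast
  show ?case
  proof (cases "\<exists>k. Suc k < n \<and> w (Suc (Suc k)) < w (Suc k) \<and> v (Suc (Suc k)) < v (Suc k)")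
    case True
    then obtain k where k: "Suc k < n" and desc: "w (Suc (Suc k)) < w (Suc k)" "v (Suc (Suc k)) < v (Suc k)" by blast
    let ?s = "simple k"
    note sat = closure_parabolic_saturated[OF n t k desc]
    define y' where "y' = (if y (Suc (Suc k)) < y (Suc k) then y else y \<circ> ?s)"
    define u' where "u' = (if u (Suc (Suc k)) < u (Suc k) then u else u \<circ> ?s)"
    obtain r where r: "r \<in> minimal_parabolic n k" and tr: "types n (g * r) y' u'"
      using types_raise[OF t' k] unfolding y'_def u'_def by blast
    have undo: "f \<in> GL_closure n (double_coset n h)"
      if q: "q \<in> minimal_parabolic n k" and f: "f * q \<in> GL_closure n (double_coset n h)" "f \<in> carrier (GL n)" for f q
    proof -
      obtain q' where q': "q' \<in> minimal_parabolic n k" "q * q' = 1\<^sub>m n" by (rule minimal_parabolic_inverse[OF q])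
      have "f * q * q' = f"
        by (rule cancel_right_inverse[OF q'(2) minimal_parabolic_D(2)[OF q'(1)] minimal_parabolic_D(2)[OF q]
              GL_carrier[OF f(2)]])
      then show ?thesis using sat[OF f(1) q'(1)] by simp
    qed
    have ydom: "dominated y' w" unfolding y'_def
      using less.prems(3) dominated_simple_lift[OF less.prems(3) desc(1)] by simp
    have udom: "dominated u' v" unfolding u'_def
      using less.prems(4) dominated_simple_lift[OF less.prems(4) desc(2)] by simp
    have ydesc: "y' (Suc (Suc k)) < y' (Suc k)"
      using permutes_neq[OF typesD(1)[OF t'], of "Suc k" "Suc (Suc k)"] by (auto simp: y'_def)
    have udesc: "u' (Suc (Suc k)) < u' (Suc k)"
      using permutes_neq[OF typesD(2)[OF t'], of "Suc k" "Suc (Suc k)"] by (auto simp: u'_def)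
    have invw: "card (inversions n (w \<circ> ?s)) < card (inversions n w)"
      using inversions_comp_simple_descent[of w k n, OF desc(1) k] by simp
    have invv: "card (inversions n (v \<circ> ?s)) < card (inversions n v)"
      using inversions_comp_simple_descent[of v k n, OF desc(2) k] by simp
    have reduce: "g * r \<in> GL_closure n (double_coset n h)"
      if "q \<in> minimal_parabolic n k" "types n (h * q) w1 v1" "q' \<in> minimal_parabolic n k" "types n (g * r * q') y1 u1"
        "card (inversions n w1) + card (inversions n v1) < card (inversions n w) + card (inversions n v)"
        "dominated y1 w1" "dominated u1 v1" for q w1 v1 q' y1 u1
    proof -
      have "g * r * q' \<in> GL_closure n (double_coset n (h * q))"
        by (rule less.hyps[OF that(5) that(2) that(4) that(6) that(7)])
      then have "g * r * q' \<in> GL_closure n (double_coset n h)"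
        by (rule closure_double_coset_trans[OF n hG sat[OF h_cl that(1)]])
      then show ?thesis by (rule undo[OF that(3) _ typesD(3)[OF tr]])
    qed
    note down = dominated_simple_down
    (* Which exceptional points are compared depends on how many there are on either line. *)
    have "g * r \<in> GL_closure n (double_coset n h)"
      using tr k ydesc udesc
    proof (cases rule: descent_split)
      case g: (unramified q')
      from t k desc show ?thesis
      proof (cases rule: descent_split)
        case (unramified q)
        show ?thesis
          by (rule reduce[OF unramified g]) (use invw invv down[OF ydom desc(1) ydesc] down[OF udom desc(2) udesc] in auto)
      next
        case (ramified q q2)
        show ?thesis
          by (rule reduce[OF ramified(1,3) g])
            (use invw down[OF ydom desc(1) ydesc] dominated_trans[OF dominated_simple_self udom] udesc in auto)
      qed
    next
      case g: (ramified q' q'')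
      from t k desc show ?thesis
      proof (cases rule: descent_split)
        case (unramified q)
        note il = types_interlaced[OF n]
        have "dominated y' (w \<circ> ?s) \<or> dominated u' (v \<circ> ?s)"
          by (rule interlaced_descent[OF k typesD(1)[OF t] typesD(2)[OF t] typesD(1)[OF tr] typesD(2)[OF tr]
                desc ydesc udesc ydom udom il[OF t] il[OF unramified(2)] il[OF tr] il[OF g(3)] il[OF g(4)]])
        then show ?thesis
        proof
          assume *: "dominated y' (w \<circ> ?s)"
          show ?thesis
            by (rule reduce[OF unramified g(2,4)]) (use invw invv * down[OF udom desc(2) udesc] in auto)
        next
          assume *: "dominated u' (v \<circ> ?s)"
          show ?thesis
            by (rule reduce[OF unramified g(1,3)]) (use invw invv * down[OF ydom desc(1) ydesc] in auto)
        qed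
      next
        case (ramified q q2)
        show ?thesis
          by (rule reduce[OF ramified(1,3) g(1,3)]) (use invw udom down[OF ydom desc(1) ydesc] in auto)
      qed
    qed
    then show ?thesis by (rule undo[OF r _ typesD(3)[OF t']])
  next
    case False
    obtain P where P: "decorated n w P" "v = partner n w P" "h \<in> double_coset n (normal_mat n w P)"
      by (rule types_normal_form[OF n t])
    obtain P' where P': "decorated n y P'" "u = partner n y P'" "g \<in> double_coset n (normal_mat n y P')"
      by (rule types_normal_form[OF n t'])
    obtain p where p: "p \<in> P" "w p = n" using P(1) by (auto simp: decorated_def)
    have Pp: "P = {p}"
      by (rule no_common_descent_imp_singleton[OF P(1) p]) (use False P(2) in blast)
    have P'p: "P' = {p}"
      using dominated_singleton[OF P(1)[unfolded Pp] P'(1) less.prems(3)] less.prems(4) P(2) P'(2) Pp by simp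
    note dw = P(1)[unfolded Pp] and dy = P'(1)[unfolded P'p]
    have wG: "perm_mat n w \<in> carrier (GL n)" and yG: "perm_mat n y \<in> carrier (GL n)"
      using perm_mat_GL typesD(1)[OF t] typesD(1)[OF t'] by auto
    have h: "h \<in> double_coset n (perm_mat n w)" using P(3) unfolding Pp normal_mat_singleton[OF dw] .
    have g: "g \<in> double_coset n (perm_mat n y)" using P'(3) unfolding P'p normal_mat_singleton[OF dy] .
    have wh: "perm_mat n w \<in> GL_closure n (double_coset n h)"
      using double_coset_sym[OF n wG h] GL_closure_superset[OF double_coset_GL[OF n hG]] by blast
    have gy: "g \<in> GL_closure n (double_coset n (perm_mat n y))"
      using g GL_closure_superset[OF double_coset_GL[OF n yG]] by blast
    have "perm_mat n y \<in> GL_closure n (double_coset n (perm_mat n w))"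
      by (rule singleton_closure[OF n dy dw less.prems(3)])
    from closure_double_coset_trans[OF n wG this gy] show ?thesis by (rule closure_double_coset_trans[OF n hG wh])
  qed
qed

theorem closure_iff_dominated:
  assumes n: "1 \<le> n" and t: "types n h w v" "types n g y u"
  shows "g \<in> GL_closure n (double_coset n h) \<longleftrightarrow> dominated y w \<and> dominated u v"
proof
  assume g: "g \<in> GL_closure n (double_coset n h)"
  note h = typesD(3)[OF t(1)]
  have Z: "in_cell n z w" "in_cell n (rot_mat n * z) v" "z \<in> carrier_mat n n" if "z \<in> double_coset n h" for z
    using types_double_coset[OF n t(1) that] GL_carrier in_cellD(2) by (auto simp: types_def)
  have "dominated y w"
    by (rule cell_closure_dominated[OF Z(1) g _ typesD(1)[OF t(1)]]) (use t(2) in \<open>auto simp: types_def\<close>)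
  moreover have "rot_mat n * g * 1\<^sub>m n \<in> GL_closure n {rot_mat n * z | z. z \<in> double_coset n h}"
  proof (rule GL_closure_translate[OF g _ rot_mat_GL[OF n] GL_one])
    show "double_coset n h \<subseteq> carrier_mat n n" using Z(3) by blast
    fix z assume z: "z \<in> double_coset n h"
    have "rot_mat n * z \<in> carrier (GL n)" using Z(2)[OF z] in_cellD(2) by blast
    then have "rot_mat n * z \<in> GL_closure n {rot_mat n * z | z. z \<in> double_coset n h}"
      using z unfolding GL_closure_def by blast
    moreover have "rot_mat n * z * 1\<^sub>m n = rot_mat n * z"
      by (rule right_mult_one_mat[OF square_mult[OF rot_mat_carrier Z(3)[OF z]]])
    ultimately show "rot_mat n * z * 1\<^sub>m n \<in> GL_closure n {rot_mat n * z | z. z \<in> double_coset n h}" by simp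
  qed
  then have "rot_mat n * g \<in> GL_closure n {rot_mat n * z | z. z \<in> double_coset n h}"
    using right_mult_one_mat[OF square_mult[OF rot_mat_carrier GL_carrier[OF typesD(3)[OF t(2)]]]] by simp
  then have "dominated u v"
    by (rule cell_closure_dominated[rotated 1]) (use t(2) Z(2) typesD(2)[OF t(1)] in \<open>auto simp: types_def\<close>)
  ultimately show "dominated y w \<and> dominated u v" by blast
next
  assume "dominated y w \<and> dominated u v"
  then show "g \<in> GL_closure n (double_coset n h)" using dominated_imp_closure[OF n t] by blast
qed

abbreviation complex_space :: "nat \<Rightarrow> (complex, complex vec) module" where
  "complex_space n \<equiv> module_vec TYPE(complex) n"

section \<open>Flags as cosets\<close>

text \<open>The span of \<open>e_1, \<dots>, e_i\<close>, described by coordinates so that invariance under triangular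
  matrices is an entrywise computation.\<close>

definition coord_space :: "nat \<Rightarrow> nat \<Rightarrow> complex vec set" where
  "coord_space n i = {v \<in> carrier_vec n. \<forall>k. i \<le> k \<and> k < n \<longrightarrow> v $ k = 0}"

lemma coord_space_mono: "i \<le> j \<Longrightarrow> coord_space n i \<subseteq> coord_space n j"
  by (auto simp: coord_space_def)

lemma mult_unit_vec:
  fixes g :: "complex mat"
  assumes "g \<in> carrier_mat n n" "c < n"
  shows "g *\<^sub>v unit_vec n c = col g c"
  by (rule eq_vecI) (use assms in auto)

lemma subspace_image_coord:
  fixes g :: "complex mat"
  assumes g: "g \<in> carrier_mat n n"
  shows "subspace class_ring ((\<lambda>v. g *\<^sub>v v) ` coord_space n i) (complex_space n)"
proof -
  interpret vec_space "TYPE(complex)" n .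
  show ?thesis
    unfolding subspace_def
  proof
    show "vectorspace class_ring V" by (rule vectorspace_axioms)
    show "submodule class_ring ((\<lambda>v. g *\<^sub>v v) ` coord_space n i) V"
    proof (rule LinearCombinations.submodule.intro)
      show "module class_ring V" by (rule module_axioms)
      show "(\<lambda>v. g *\<^sub>v v) ` coord_space n i \<subseteq> carrier V" using g by (auto simp: coord_space_def)
      have "0\<^sub>v n = g *\<^sub>v 0\<^sub>v n" using g by auto
      then show "\<zero>\<^bsub>V\<^esub> \<in> (\<lambda>v. g *\<^sub>v v) ` coord_space n i" by (auto simp: coord_space_def)
      fix v w assume "v \<in> (\<lambda>v. g *\<^sub>v v) ` coord_space n i" "w \<in> (\<lambda>v. g *\<^sub>v v) ` coord_space n i"
      then obtain a b where ab: "a \<in> coord_space n i" "b \<in> coord_space n i" "v = g *\<^sub>v a" "w = g *\<^sub>v b" by blast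
      have "g *\<^sub>v (a + b) = v + w" using g ab by (auto simp: coord_space_def mult_add_distrib_mat_vec)
      moreover have "a + b \<in> coord_space n i" using ab by (auto simp: coord_space_def)
      ultimately have "v + w \<in> (\<lambda>v. g *\<^sub>v v) ` coord_space n i" by (metis imageI)
      then show "v \<oplus>\<^bsub>V\<^esub> w \<in> (\<lambda>v. g *\<^sub>v v) ` coord_space n i" by simp
    next
      fix c :: complex and v assume "v \<in> (\<lambda>v. g *\<^sub>v v) ` coord_space n i"
      then obtain a where a: "a \<in> coord_space n i" "v = g *\<^sub>v a" by blast
      have "g *\<^sub>v (c \<cdot>\<^sub>v a) = c \<cdot>\<^sub>v v" using g a by (auto simp: coord_space_def mult_mat_vec)
      moreover have "c \<cdot>\<^sub>v a \<in> coord_space n i" using a by (auto simp: coord_space_def)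
      ultimately have "c \<cdot>\<^sub>v v \<in> (\<lambda>v. g *\<^sub>v v) ` coord_space n i" by (metis imageI)
      then show "c \<odot>\<^bsub>V\<^esub> v \<in> (\<lambda>v. g *\<^sub>v v) ` coord_space n i" by simp
    qed
  qed
qed

text \<open>The span of the first \<open>i\<close> columns is the image of the \<open>i\<close>-th coordinate space; peel off the
  last coordinate.\<close>

lemma span_columns:
  fixes g :: "complex mat"
  assumes g: "g \<in> carrier_mat n n" and i: "i \<le> n"
  shows "LinearCombinations.module.span class_ring (complex_space n) (col g ` {..<i}) = (\<lambda>v. g *\<^sub>v v) ` coord_space n i"
proof -
  interpret vec_space "TYPE(complex)" n .
  have cols: "col g ` {..<i} \<subseteq> carrier_vec n" using g by auto
  show ?thesis
  proof
    have "col g ` {..<i} \<subseteq> (\<lambda>v. g *\<^sub>v v) ` coord_space n i"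
    proof
      fix x assume "x \<in> col g ` {..<i}"
      then obtain c where c: "c < i" "x = col g c" by blast
      then have "x = g *\<^sub>v unit_vec n c" using mult_unit_vec[OF g, of c] i by simp
      moreover have "unit_vec n c \<in> coord_space n i" using c i by (auto simp: coord_space_def unit_vec_def)
      ultimately show "x \<in> (\<lambda>v. g *\<^sub>v v) ` coord_space n i" by blast
    qed
    then show "span (col g ` {..<i}) \<subseteq> (\<lambda>v. g *\<^sub>v v) ` coord_space n i"
      using subspace_image_coord[OF g, of i] by (intro span_is_subset) (auto simp: subspace_def)
    have "g *\<^sub>v v \<in> span (col g ` {..<i})" if "j \<le> i" "v \<in> coord_space n j" for v j
      using that
    proof (induction j arbitrary: v)
      case 0
      then have "v = 0\<^sub>v n" by (intro eq_vecI) (auto simp: coord_space_def)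
      then have "g *\<^sub>v v = 0\<^sub>v n" using g by auto
      then show ?case using span_zero by simp
    next
      case (Suc j)
      have v: "v \<in> carrier_vec n" using Suc.prems by (simp add: coord_space_def)
      let ?w = "v - v $ j \<cdot>\<^sub>v unit_vec n j"
      have w: "?w \<in> coord_space n j"
        unfolding coord_space_def
      proof (intro CollectI conjI allI impI)
        show "?w \<in> carrier_vec n" using v by simp
        show "?w $ k = 0" if "j \<le> k \<and> k < n" for k
          using that v Suc.prems(2) by (cases "k = j") (auto simp: coord_space_def)
      qed
      then have wc: "?w \<in> carrier_vec n" by (simp add: coord_space_def)
      have "v = ?w + v $ j \<cdot>\<^sub>v unit_vec n j" using v by (intro eq_vecI) auto
      then have "g *\<^sub>v v = g *\<^sub>v ?w + v $ j \<cdot>\<^sub>v (g *\<^sub>v unit_vec n j)"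
        using g wc by (metis mult_add_distrib_mat_vec mult_mat_vec smult_carrier_vec unit_vec_carrier)
      also have "g *\<^sub>v unit_vec n j = col g j" using mult_unit_vec[OF g, of j] Suc.prems i by simp
      finally have eq: "g *\<^sub>v v = g *\<^sub>v ?w + v $ j \<cdot>\<^sub>v col g j" .
      have "col g j \<in> span (col g ` {..<i})" using Suc.prems cols in_own_span[of "col g ` {..<i}"] by auto
      then have "v $ j \<cdot>\<^sub>v col g j \<in> span (col g ` {..<i})" by (rule smult_in_span[OF cols])
      moreover have "g *\<^sub>v ?w \<in> span (col g ` {..<i})" using Suc.IH[OF _ w] Suc.prems by simp
      ultimately show ?case unfolding eq using span_add1[OF cols] by simp
    qed
    then show "(\<lambda>v. g *\<^sub>v v) ` coord_space n i \<subseteq> span (col g ` {..<i})" by blast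
  qed
qed

lemma card_columns:
  assumes "g \<in> carrier (GL n)" "i \<le> n"
  shows "card (col g ` {..<i}) = i"
proof -
  obtain h where h: "h \<in> carrier (GL n)" "h * g = 1\<^sub>m n" using GL_inverse[OF assms(1)] by blast
  note c = GL_carrier[OF assms(1)] GL_carrier[OF h(1)]
  have "inj_on (col g) {..<i}"
  proof (rule inj_onI)
    fix a b assume ab: "a \<in> {..<i}" "b \<in> {..<i}" "col g a = col g b"
    have "h *\<^sub>v col g x = unit_vec n x" if "x < n" for x
      using col_mult2[of h n n g n x] c h(2) that col_one[OF that, where 'a = complex] by simp
    then have "unit_vec n a = (unit_vec n b :: complex vec)" using ab assms(2) by (metis lessThan_iff order_less_le_trans)
    then show "a = b" using ab assms(2) by (metis index_unit_vec(1) lessThan_iff order_less_le_trans zero_neq_one)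
  qed
  then show ?thesis by (simp add: card_image)
qed

lemma lin_indpt_columns:
  assumes "g \<in> carrier (GL n)" "i \<le> n"
  shows "\<not> LinearCombinations.module.lin_dep class_ring (complex_space n) (col g ` {..<i})"
proof -
  interpret vec_space "TYPE(complex)" n .
  have g: "g \<in> carrier_mat n n" "det g \<noteq> 0" using assms by (auto simp: GL_iff)
  have "lin_indpt (set (cols g))" using lin_dep_cols_imp_det_0[OF g(1)] g(2) by blast
  moreover have "col g ` {..<i} \<subseteq> set (cols g)" using g(1) assms(2) by (auto simp: cols_def)
  ultimately show ?thesis using subset_li_is_li by blast
qed

text \<open>The first \<open>i\<close> columns of an invertible matrix are a basis of the image.\<close>

lemma dim_image_coord:
  assumes "g \<in> carrier (GL n)" "i \<le> n"
  shows "vectorspace.dim class_ring ((complex_space n)\<lparr>carrier := (\<lambda>v. g *\<^sub>v v) ` coord_space n i\<rparr>) = i"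
proof -
  interpret vec_space "TYPE(complex)" n .
  note gc = GL_carrier[OF assms(1)]
  let ?W = "(\<lambda>v. g *\<^sub>v v) ` coord_space n i" and ?S = "col g ` {..<i}"
  have sub: "subspace class_ring ?W V" by (rule subspace_image_coord[OF gc])
  then have sm: "submodule class_ring ?W V" by (simp add: subspace_def)
  interpret W: vectorspace class_ring "vs ?W" by (rule subspace_is_vs[OF sub])
  have span: "span ?S = ?W" by (rule span_columns[OF gc assms(2)])
  have SV: "?S \<subseteq> carrier_vec n" using gc by auto
  have S: "?S \<subseteq> ?W" using span in_own_span[OF SV] by simp
  have "W.basis ?S"
    unfolding W.basis_def
    using span_li_not_depend[OF S sm] lin_indpt_columns[OF assms] span S by simp
  then have "W.dim = card ?S" by (intro W.dim_basis) auto
  then show ?thesis using card_columns[OF assms] by simp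
qed

text \<open>The given columns are independent and there are as many as the dimension of \<open>W\<close>, so they form
  a basis of \<open>W\<close>. That \<open>W\<close> is finite-dimensional follows because its independent sets are
  independent in the whole space.\<close>

lemma subspace_eq_of_dim:
  assumes sub: "subspace class_ring W (complex_space n)"
    and dim: "vectorspace.dim class_ring ((complex_space n)\<lparr>carrier := W\<rparr>) = i"
    and g: "g \<in> carrier (GL n)" and i: "i \<le> n" and le: "col g ` {..<i} \<subseteq> W"
  shows "W = (\<lambda>v. g *\<^sub>v v) ` coord_space n i"
proof -
  interpret vec_space "TYPE(complex)" n .
  let ?S = "col g ` {..<i}"
  have sm: "submodule class_ring W V" using sub by (simp add: subspace_def)
  have WV: "W \<subseteq> carrier V" using sm by (simp add: LinearCombinations.submodule_def)
  interpret W: vectorspace class_ring "vs W" by (rule subspace_is_vs[OF sub])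
  have li: "W.lin_dep A \<longleftrightarrow> lin_dep A" if "A \<subseteq> W" for A by (rule span_li_not_depend(2)[OF that sm])
  have "\<exists>A. finite A \<and> maximal A (\<lambda>S. S \<subseteq> carrier (vs W) \<and> W.lin_indpt S)"
  proof (rule maximal_exists)
    show "finite A \<and> card A \<le> dim" if "A \<subseteq> carrier (vs W) \<and> W.lin_indpt A" for A
      using that li[of A] li_le_dim[of A] WV by auto
    have "lin_indpt {}" using subset_li_is_li lin_indpt_columns[OF g i] by blast
    then show "{} \<subseteq> carrier (vs W) \<and> W.lin_indpt {}" using li[of "{}"] by simp
  qed
  then obtain A where A: "finite A" "W.basis A" using W.max_li_is_basis by blast
  then have fd: "W.fin_dim" unfolding W.fin_dim_def W.basis_def by blast
  have "W.basis ?S"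
    using le li[OF le] lin_indpt_columns[OF g i] card_columns[OF g i] dim
    by (intro W.dim_li_is_basis[OF fd]) auto
  then have "W.span ?S = W" by (simp add: W.basis_def)
  then show ?thesis
    using span_li_not_depend(1)[OF le sm] span_columns[OF GL_carrier[OF g] i] by simp
qed

lemma span_flag_columns:
  assumes g: "g \<in> carrier_mat n n" and vs: "length vs = n" "\<And>c. c < n \<Longrightarrow> vs ! c = col g c"
  shows "span_flag n vs = map (\<lambda>i. (\<lambda>v. g *\<^sub>v v) ` coord_space n i) [1..<n + 1]"
  unfolding span_flag_def
proof (intro map_cong refl)
  fix i assume "i \<in> set [1..<n + 1]"
  then have i: "i \<le> n" by auto
  have "set (take i vs) = (!) vs ` {..<i}" using nth_image[of i vs] i vs(1) by (simp add: lessThan_atLeast0)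
  also have "\<dots> = col g ` {..<i}" using vs(2) i by (intro image_cong) auto
  finally show "LinearCombinations.module.span class_ring (complex_space n) (set (take i vs)) = (\<lambda>v. g *\<^sub>v v) ` coord_space n i"
    using span_columns[OF g i] by simp
qed

lemma E_plus_eq: "E_plus n = map (coord_space n) [1..<n + 1]"
proof -
  have nth: "map (std_vec n) [1..<n + 1] ! c = col (1\<^sub>m n) c" if "c < n" for c
  proof -
    have "[1..<n + 1] ! c = Suc c" using that by (subst nth_upt) auto
    then show ?thesis using that nth_map[of c "[1..<n + 1]" "std_vec n"] by (simp add: std_vec_def)
  qed
  have "(\<lambda>v. (1\<^sub>m n :: complex mat) *\<^sub>v v) ` coord_space n i = coord_space n i" for i
    by (force simp: coord_space_def image_iff)
  then show ?thesis unfolding E_plus_def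
    using span_flag_columns[of "1\<^sub>m n" n, OF _ _ nth] by simp
qed

definition std_flag :: "nat \<Rightarrow> complex mat \<Rightarrow> flag" where
  "std_flag n g = flag_act g (E_plus n)"

lemma std_flag_eq: "std_flag n g = map (\<lambda>i. (\<lambda>v. g *\<^sub>v v) ` coord_space n i) [1..<n + 1]"
  by (simp add: std_flag_def flag_act_def E_plus_eq comp_def del: upt_Suc)

lemma std_flag_nth:
  assumes "i < n"
  shows "std_flag n g ! i = (\<lambda>v. g *\<^sub>v v) ` coord_space n (Suc i)"
proof -
  have "[1..<n + 1] ! i = Suc i" using assms by (subst nth_upt) auto
  then show ?thesis unfolding std_flag_eq using assms by (subst nth_map) auto
qed

lemma flag_act_std_flag:
  assumes "g \<in> carrier_mat n n" "h \<in> carrier_mat n n"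
  shows "flag_act g (std_flag n h) = std_flag n (g * h)"
proof -
  have "(\<lambda>v. g *\<^sub>v v) ` (\<lambda>v. h *\<^sub>v v) ` coord_space n i = (\<lambda>v. g * h *\<^sub>v v) ` coord_space n i" for i
    unfolding image_image using assms by (intro image_cong) (auto simp: coord_space_def assoc_mult_mat_vec)
  then show ?thesis by (simp add: std_flag_eq flag_act_def comp_def del: upt_Suc)
qed

lemma std_flag_upper:
  assumes "b \<in> upper_GL n"
  shows "std_flag n b = E_plus n"
proof -
  have into: "d *\<^sub>v v \<in> coord_space n i" if d: "d \<in> upper_GL n" and v: "v \<in> coord_space n i" for d v i
  proof -
    note D = upper_GL_D[OF d]
    have vc: "v \<in> carrier_vec n" using v by (simp add: coord_space_def)
    have "(d *\<^sub>v v) $ k = 0" if k: "i \<le> k" "k < n" for k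
    proof -
      have "(d *\<^sub>v v) $ k = (\<Sum>m<n. d $$ (k, m) * v $ m)"
        using D(2) vc k by (simp add: scalar_prod_def lessThan_atLeast0)
      also have "\<dots> = 0"
      proof (intro sum.neutral ballI)
        fix m assume "m \<in> {..<n}"
        then show "d $$ (k, m) * v $ m = 0" using D(3)[of m k] v k by (cases "m < k") (auto simp: coord_space_def)
      qed
      finally show ?thesis .
    qed
    then show ?thesis using D(2) vc by (simp add: coord_space_def)
  qed
  obtain h where h: "h \<in> upper_GL n" "b * h = 1\<^sub>m n" using upper_GL_inverse_obtain[OF assms] by blast
  have "(\<lambda>v. b *\<^sub>v v) ` coord_space n i = coord_space n i" for i
  proof (intro equalityI subsetI)
    fix v assume v: "v \<in> coord_space n i"
    then have vc: "v \<in> carrier_vec n" by (simp add: coord_space_def)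
    have "v = b *\<^sub>v (h *\<^sub>v v)"
      using assoc_mult_mat_vec[OF upper_GL_D(2)[OF assms] upper_GL_D(2)[OF h(1)] vc] h(2) vc by simp
    then show "v \<in> (\<lambda>v. b *\<^sub>v v) ` coord_space n i" using into[OF h(1) v] by blast
  qed (use into[OF assms] in blast)
  then show ?thesis by (simp add: std_flag_eq E_plus_eq)
qed

lemma std_flag_stabilizer:
  assumes "g \<in> carrier (GL n)" "std_flag n g = E_plus n"
  shows "g \<in> upper_GL n"
proof -
  note gc = GL_carrier[OF assms(1)]
  have "g $$ (r, c) = 0" if rc: "c < r" "r < n" for r c
  proof -
    have "(\<lambda>v. g *\<^sub>v v) ` coord_space n (Suc c) = coord_space n (Suc c)"
      using std_flag_nth[of c n g] std_flag_nth[of c n "1\<^sub>m n"] assms(2) std_flag_upper[OF upper_GL_one, of n] rc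
      by (force simp: coord_space_def image_iff)
    moreover have "unit_vec n c \<in> coord_space n (Suc c)" using rc by (auto simp: coord_space_def unit_vec_def)
    ultimately have "col g c \<in> coord_space n (Suc c)"
      using mult_unit_vec[OF gc, of c] rc by (metis imageI order_less_trans)
    then show ?thesis using rc gc by (simp add: coord_space_def)
  qed
  then have "upper_triangular g" using gc by auto
  then show ?thesis using assms(1) by (simp add: upper_GL_def)
qed

lemma std_flag_eq_iff:
  assumes g: "g \<in> carrier (GL n)" and h: "h \<in> carrier (GL n)"
  shows "std_flag n g = std_flag n h \<longleftrightarrow> (\<exists>b\<in>upper_GL n. h = g * b)"
proof
  obtain k where k: "k \<in> carrier (GL n)" "g * k = 1\<^sub>m n" "k * g = 1\<^sub>m n" by (rule GL_inverse[OF g])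
  note c = GL_carrier[OF g] GL_carrier[OF h] GL_carrier[OF k(1)]
  assume "std_flag n g = std_flag n h"
  then have "flag_act k (std_flag n g) = flag_act k (std_flag n h)" by simp
  then have "std_flag n (k * h) = E_plus n"
    using flag_act_std_flag[OF c(3,1)] flag_act_std_flag[OF c(3,2)] k(3) std_flag_upper[OF upper_GL_one] by simp
  then have "k * h \<in> upper_GL n" by (rule std_flag_stabilizer[OF GL_mult[OF k(1) h]])
  moreover have "h = g * (k * h)" using cancel_left_inverse[OF k(2) c(1,3,2)] by simp
  ultimately show "\<exists>b\<in>upper_GL n. h = g * b" by blast
next
  assume "\<exists>b\<in>upper_GL n. h = g * b"
  then obtain b where b: "b \<in> upper_GL n" "h = g * b" by blast
  have "std_flag n h = flag_act g (std_flag n b)"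
    using flag_act_std_flag[OF GL_carrier[OF g] upper_GL_D(2)[OF b(1)]] b(2) by simp
  then show "std_flag n g = std_flag n h" using std_flag_upper[OF b(1)] by (simp add: std_flag_def)
qed

lemma std_flag_in_flags:
  assumes g: "g \<in> carrier (GL n)"
  shows "std_flag n g \<in> flags n"
proof -
  note gc = GL_carrier[OF g]
  have "(\<lambda>v. g *\<^sub>v v) ` coord_space n (Suc i) \<subset> (\<lambda>v. g *\<^sub>v v) ` coord_space n (Suc j)" if ij: "i < j" "j < n" for i j
  proof
    show "(\<lambda>v. g *\<^sub>v v) ` coord_space n (Suc i) \<subseteq> (\<lambda>v. g *\<^sub>v v) ` coord_space n (Suc j)"
      using coord_space_mono[of "Suc i" "Suc j" n] ij by auto
    show "(\<lambda>v. g *\<^sub>v v) ` coord_space n (Suc i) \<noteq> (\<lambda>v. g *\<^sub>v v) ` coord_space n (Suc j)"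
      using dim_image_coord[OF g, of "Suc i"] dim_image_coord[OF g, of "Suc j"] ij by auto
  qed
  then show ?thesis
    unfolding flags_def
    using std_flag_nth[of _ n g] subspace_image_coord[OF gc] dim_image_coord[OF g]
    by (auto simp: std_flag_eq simp del: upt_Suc)
qed

text \<open>Choose a vector in each member of the flag outside the preceding one. A relation among these
  vectors would put the last vector involved into the preceding member, so they are the columns of
  an invertible matrix.\<close>

lemma flag_adapted_basis:
  assumes F: "F \<in> flags n"
  shows "\<exists>g\<in>carrier (GL n). F = std_flag n g"
proof -
  interpret vec_space "TYPE(complex)" n .
  have len: "length F = n" and sub: "\<And>i. i < n \<Longrightarrow> subspace class_ring (F ! i) V"
    and dim: "\<And>i. i < n \<Longrightarrow> vectorspace.dim class_ring (vs (F ! i)) = i + 1"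
    and chain: "\<And>i j. i < j \<Longrightarrow> j < n \<Longrightarrow> F ! i \<subset> F ! j"
    using F unfolding flags_def by auto
  (* Index the members by dimension, with the zero space in front. *)
  define G where "G i = (if i = 0 then {0\<^sub>v n} else F ! (i - 1))" for i
  have subG: "submodule class_ring (G i) V" if "i \<le> n" for i
  proof (cases i)
    case 0
    have "submodule class_ring {0\<^sub>v n :: complex vec} V"
      by (rule LinearCombinations.submodule.intro[OF module_axioms]) auto
    then show ?thesis using 0 by (simp add: G_def)
  next
    case (Suc j)
    then show ?thesis using sub[of j] that by (simp add: G_def subspace_def)
  qed
  have GV: "G i \<subseteq> carrier_vec n" if "i \<le> n" for i using subG[OF that] by (simp add: LinearCombinations.submodule_def)
  have zero: "0\<^sub>v n \<in> G i" if "i \<le> n" for i using subG[OF that] by (simp add: LinearCombinations.submodule_def)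
  have step: "G i \<subset> G (Suc i)" if "i < n" for i
  proof (cases i)
    case 0
    have "G 1 \<noteq> {0\<^sub>v n}"
    proof
      assume eq: "G 1 = {0\<^sub>v n}"
      have s: "subspace class_ring {0\<^sub>v n :: complex vec} V" using sub[of 0] that 0 eq by (simp add: G_def)
      interpret W: vectorspace class_ring "vs {0\<^sub>v n :: complex vec}" by (rule subspace_is_vs[OF s])
      have sm: "submodule class_ring {0\<^sub>v n :: complex vec} V" using s by (simp add: subspace_def)
      have "span {} = {0\<^sub>v n}" by (rule span_empty)
      then have "W.gen_set {}" using span_li_not_depend(1)[OF _ sm, of "{}"] by simp
      then have "W.dim \<le> card ({} :: complex vec set)" using W.gen_ge_dim[of "{}"] by simp
      then show False using dim[of 0] that 0 eq by (simp add: G_def)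
    qed
    then show ?thesis using zero[of 1] that 0 by (auto simp: G_def)
  next
    case (Suc j)
    then show ?thesis using chain[of j i] that by (simp add: G_def)
  qed
  have mono: "G i \<subseteq> G j" if "i \<le> j" "j \<le> n" for i j
    using that
  proof (induction j)
    case (Suc j)
    then show ?case using step[of j] by (cases "i = Suc j") auto
  qed simp
  have "\<forall>i. \<exists>v. i < n \<longrightarrow> v \<in> G (Suc i) - G i" using step by blast
  then obtain v where v: "\<And>i. i < n \<Longrightarrow> v i \<in> G (Suc i) - G i" by metis
  have vc: "v i \<in> carrier_vec n" if "i < n" for i using v[OF that] GV[of "Suc i"] that by auto
  define g where "g = mat n n (\<lambda>(r, c). v c $ r)"
  have gc: "g \<in> carrier_mat n n" by (simp add: g_def)
  have colg: "col g i = v i" if "i < n" for i using vc[OF that] that by (intro eq_vecI) (auto simp: g_def)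
  have partial: "g *\<^sub>v x \<in> G i" if "x \<in> coord_space n i" "i \<le> n" for x i
    using that
  proof (induction i arbitrary: x)
    case 0
    then have "x = 0\<^sub>v n" by (intro eq_vecI) (auto simp: coord_space_def)
    then have "g *\<^sub>v x = 0\<^sub>v n" using gc by auto
    then show ?case by (simp add: G_def)
  next
    case (Suc i)
    have x: "x \<in> carrier_vec n" using Suc.prems by (simp add: coord_space_def)
    let ?w = "x - x $ i \<cdot>\<^sub>v unit_vec n i"
    have w: "?w \<in> coord_space n i"
      unfolding coord_space_def
    proof (intro CollectI conjI allI impI)
      show "?w \<in> carrier_vec n" using x by simp
      show "?w $ k = 0" if "i \<le> k \<and> k < n" for k
        using that x Suc.prems(1) by (cases "k = i") (auto simp: coord_space_def)
    qed
    then have wc: "?w \<in> carrier_vec n" by (simp add: coord_space_def)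
    have "x = ?w + x $ i \<cdot>\<^sub>v unit_vec n i" using x by (intro eq_vecI) auto
    then have "g *\<^sub>v x = g *\<^sub>v ?w + x $ i \<cdot>\<^sub>v (g *\<^sub>v unit_vec n i)"
      using gc wc by (metis mult_add_distrib_mat_vec mult_mat_vec smult_carrier_vec unit_vec_carrier)
    then have eq: "g *\<^sub>v x = g *\<^sub>v ?w + x $ i \<cdot>\<^sub>v v i"
      using mult_unit_vec[OF gc, of i] colg[of i] Suc.prems by simp
    have "g *\<^sub>v ?w \<in> G (Suc i)" using Suc.IH[OF w] Suc.prems mono[of i "Suc i"] by auto
    moreover have "v i \<in> G (Suc i)" using v[of i] Suc.prems by simp
    ultimately show ?case unfolding eq using subG[OF Suc.prems(2)] by (simp add: LinearCombinations.submodule_def)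
  qed
  have "det g \<noteq> 0"
  proof
    assume "det g = 0"
    then obtain x where x: "x \<in> carrier_vec n" "x \<noteq> 0\<^sub>v n" "g *\<^sub>v x = 0\<^sub>v n"
      using det_0_iff_vec_prod_zero_field[OF gc] by blast
    define m where "m = Max {i. i < n \<and> x $ i \<noteq> 0}"
    have ne: "{i. i < n \<and> x $ i \<noteq> 0} \<noteq> {}"
    proof
      assume "{i. i < n \<and> x $ i \<noteq> 0} = {}"
      then have "x = 0\<^sub>v n" using x(1) by (intro eq_vecI) auto
      then show False using x(2) by simp
    qed
    have "m \<in> {i. i < n \<and> x $ i \<noteq> 0}" unfolding m_def by (intro Max_in ne) simp
    then have m: "m < n" "x $ m \<noteq> 0" by auto
    have above: "x $ k = 0" if "m < k" "k < n" for k
    proof (rule ccontr)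
      assume "x $ k \<noteq> 0"
      then have "k \<le> m" unfolding m_def using that(2) by (intro Max_ge) auto
      then show False using that(1) by simp
    qed
    let ?w = "unit_vec n m - (1 / x $ m) \<cdot>\<^sub>v x"
    have w: "?w \<in> coord_space n m"
      unfolding coord_space_def
    proof (intro CollectI conjI allI impI)
      show "?w \<in> carrier_vec n" using x(1) by simp
      show "?w $ k = 0" if "m \<le> k \<and> k < n" for k
        using that x(1) m above[of k] by (cases "k = m") auto
    qed
    have "g *\<^sub>v ?w = g *\<^sub>v unit_vec n m - (1 / x $ m) \<cdot>\<^sub>v (g *\<^sub>v x)"
      using gc x(1) by (simp add: mult_minus_distrib_mat_vec mult_mat_vec)
    also have "\<dots> = v m" using mult_unit_vec[OF gc m(1)] colg[OF m(1)] x(3) vc[OF m(1)] by simp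
    finally have "v m \<in> G m" using partial[OF w] m(1) by simp
    then show False using v[OF m(1)] by simp
  qed
  then have gG: "g \<in> carrier (GL n)" using gc by (simp add: GL_iff)
  have "F ! i = std_flag n g ! i" if i: "i < n" for i
    unfolding std_flag_nth[OF i]
  proof (rule subspace_eq_of_dim[OF sub[OF i] _ gG])
    show "vectorspace.dim class_ring (vs (F ! i)) = Suc i" using dim[OF i] by simp
    show "col g ` {..<Suc i} \<subseteq> F ! i"
    proof
      fix x assume "x \<in> col g ` {..<Suc i}"
      then obtain c where c: "c < Suc i" "x = col g c" by blast
      then have "x \<in> G (Suc c)" using colg[of c] v[of c] i by simp
      then show "x \<in> F ! i" using mono[of "Suc c" "Suc i"] c i by (auto simp: G_def)
    qed
  qed (use i in simp)
  then have "F = std_flag n g" using len by (intro nth_equalityI) (auto simp: std_flag_eq simp del: upt_Suc)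
  then show ?thesis using gG by blast
qed

section \<open>Orbits, closures and saturations of flags\<close>

lemma std_flag_mult_upper:
  assumes "g \<in> carrier (GL n)" "b \<in> upper_GL n"
  shows "std_flag n (g * b) = std_flag n g"
  using std_flag_eq_iff[OF assms(1) GL_mult[OF assms(1) upper_GL_D(1)[OF assms(2)]]] assms(2) by auto

lemma Borel_eq: "Borel n = upper_GL n"
  unfolding Borel_def stabilizer_def
  using std_flag_stabilizer[of _ n] std_flag_upper[of _ n] upper_GL_D(1)[of _ n]
  unfolding std_flag_def by blast

lemma double_coset_flags:
  assumes n: "1 \<le> n" and h: "h \<in> carrier (GL n)"
  shows "{flag_act x (std_flag n h) | x. x \<in> Borel_minor n} = std_flag n ` double_coset n h"
proof -
  have act: "flag_act x (std_flag n h) = std_flag n (x * h)" "x * h \<in> carrier (GL n)" if "x \<in> Borel_minor n" for x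
  proof -
    note x = upper_GL_D(1,2)[OF Borel_minor_upper[OF n that]]
    show "flag_act x (std_flag n h) = std_flag n (x * h)" by (rule flag_act_std_flag[OF x(2) GL_carrier[OF h]])
    show "x * h \<in> carrier (GL n)" by (rule GL_mult[OF x(1) h])
  qed
  have "std_flag n (x * h) \<in> std_flag n ` double_coset n h" if x: "x \<in> Borel_minor n" for x
  proof -
    have "x * h = x * h * 1\<^sub>m n" using right_mult_one_mat[OF GL_carrier[OF act(2)[OF x]]] by simp
    then have "x * h \<in> double_coset n h" unfolding double_coset_def using x upper_GL_one by blast
    then show ?thesis by blast
  qed
  moreover have "std_flag n (x * h * b) = std_flag n (x * h)" if "x \<in> Borel_minor n" "b \<in> upper_GL n" for x b
    by (rule std_flag_mult_upper[OF act(2)[OF that(1)] that(2)])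
  ultimately show ?thesis using act(1) unfolding double_coset_def by (auto simp: image_iff) metis+
qed

lemma Borel_minor_orbit_cases:
  assumes n: "1 \<le> n" and Q: "Q \<in> Borel_minor_orbits n"
  obtains h where "h \<in> carrier (GL n)" "Q = std_flag n ` double_coset n h"
proof -
  obtain F where F: "F \<in> flags n" and Q': "Q = {flag_act x F | x. x \<in> Borel_minor n}"
    using Q unfolding Borel_minor_orbits_def orbits_def orbit_def by auto
  obtain h where "h \<in> carrier (GL n)" "F = std_flag n h" using flag_adapted_basis[OF F] by blast
  then show thesis using that Q' double_coset_flags[OF n] by blast
qed

text \<open>The closure in the quotient topology has the closure of the preimage as preimage, since the
  latter is stable under right multiplication by triangular matrices.\<close>

lemma flag_closure_iff:
  assumes n: "1 \<le> n" and h: "h \<in> carrier (GL n)" and g: "g \<in> carrier (GL n)"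
  shows "std_flag n g \<in> flag_closure n (std_flag n ` double_coset n h) \<longleftrightarrow> g \<in> GL_closure n (double_coset n h)"
proof
  let ?D = "double_coset n h"
  let ?C = "GL_closure n ?D"
  have stable: "y \<in> ?C" if xC: "x \<in> ?C" and yG: "y \<in> carrier (GL n)" and eq: "std_flag n x = std_flag n y" for x y
  proof -
    have xG: "x \<in> carrier (GL n)" by (rule GL_closure_GL[OF xC])
    obtain b where b: "b \<in> upper_GL n" "y = x * b" using std_flag_eq_iff[OF xG yG] eq by blast
    have one: "1\<^sub>m n \<in> Borel_minor n" using upper_GL_one by (auto simp: Borel_minor_iff[OF n])
    have "1\<^sub>m n * x * b \<in> ?C" by (rule closure_double_coset_stable[OF n h xC one b(1)])
    then show ?thesis using left_mult_one_mat[OF GL_carrier[OF xG]] b(2) by simp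
  qed
  have "closed_in_flags n (std_flag n ` ?C)"
    unfolding closed_in_flags_def
  proof
    show "std_flag n ` ?C \<subseteq> flags n" using std_flag_in_flags GL_closure_GL by blast
    have "{x \<in> carrier (GL n). flag_act x (E_plus n) \<in> std_flag n ` ?C} = ?C"
      using stable GL_closure_GL unfolding std_flag_def[symmetric] by (auto simp: image_iff)
    also have "\<dots> = {x \<in> carrier (GL n). \<forall>p\<in>{p \<in> poly_funs n. \<forall>z\<in>?D. p z = 0}. p x = 0}"
      by (auto simp: GL_closure_def)
    finally have eq: "{x \<in> carrier (GL n). flag_act x (E_plus n) \<in> std_flag n ` ?C} =
      {x \<in> carrier (GL n). \<forall>p\<in>{p \<in> poly_funs n. \<forall>z\<in>?D. p z = 0}. p x = 0}" .
    show "closed_in_GL n {x \<in> carrier (GL n). flag_act x (E_plus n) \<in> std_flag n ` ?C}"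
      unfolding closed_in_GL_def
      by (rule exI[of _ "{p \<in> poly_funs n. \<forall>z\<in>?D. p z = 0}"]) (simp only: eq, blast)
  qed
  moreover have "std_flag n ` ?D \<subseteq> std_flag n ` ?C"
    using GL_closure_superset[OF double_coset_GL[OF n h]] by blast
  moreover assume "std_flag n g \<in> flag_closure n (std_flag n ` ?D)"
  ultimately have "std_flag n g \<in> std_flag n ` ?C" unfolding flag_closure_def hull_def by blast
  then show "g \<in> ?C" using stable g by (metis imageE)
next
  let ?D = "double_coset n h"
  assume gC: "g \<in> GL_closure n ?D"
  have "std_flag n g \<in> Z" if Z: "closed_in_flags n Z" "std_flag n ` ?D \<subseteq> Z" for Z
  proof -
    obtain P where P: "P \<subseteq> poly_funs n"
      and eq: "{x \<in> carrier (GL n). std_flag n x \<in> Z} = {x \<in> carrier (GL n). \<forall>p\<in>P. p x = 0}"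
      using Z(1) unfolding closed_in_flags_def closed_in_GL_def std_flag_def by blast
    have "p z = 0" if "p \<in> P" "z \<in> ?D" for p z
    proof -
      have "z \<in> {x \<in> carrier (GL n). std_flag n x \<in> Z}" using that(2) Z(2) double_coset_GL[OF n h] by blast
      then show ?thesis unfolding eq using that(1) by blast
    qed
    then have "\<forall>p\<in>P. p g = 0" using gC P unfolding GL_closure_def by blast
    then have "g \<in> {x \<in> carrier (GL n). std_flag n x \<in> Z}" unfolding eq using g by blast
    then show ?thesis by blast
  qed
  then show "std_flag n g \<in> flag_closure n (std_flag n ` ?D)" unfolding flag_closure_def hull_def by blast
qed

text \<open>Two saturations under a conjugate of the upper triangular matrices are equal if and only if
  the flags lie in the same cell, up to the translation \<open>r\<close> by which the subgroup is conjugated.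
  The cases are \<open>r = 1\<close> for \<open>B\<close> and \<open>r = rot_mat n\<close> for \<open>B*\<close>.\<close>

lemma saturation_eq_iff:
  assumes n: "1 \<le> n" and r: "r \<in> carrier (GL n)" "r' \<in> carrier (GL n)" "r * r' = 1\<^sub>m n" "r' * r = 1\<^sub>m n"
    and H: "H = {r' * b * r | b. b \<in> upper_GL n}"
    and conj: "\<And>x. x \<in> Borel_minor n \<Longrightarrow> \<exists>y\<in>upper_GL n. r * x = y * r"
    and h: "h \<in> carrier (GL n)" and g: "g \<in> carrier (GL n)"
  shows "saturation n H (std_flag n ` double_coset n h) = saturation n H {std_flag n g} \<longleftrightarrow>
    (\<exists>a\<in>upper_GL n. \<exists>b\<in>upper_GL n. r * h = a * (r * g) * b)"
proof -
  define S where "S x = {a * (r * x) * b | a b. a \<in> upper_GL n \<and> b \<in> upper_GL n}" for x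
  have rc: "r \<in> carrier_mat n n" "r' \<in> carrier_mat n n" using r GL_carrier by auto
  have S_GL: "z \<in> carrier (GL n)" if "z \<in> S x" "x \<in> carrier (GL n)" for z x
    using that r upper_GL_D(1) GL_mult unfolding S_def by blast
  have S_closed: "a * z * b \<in> S x" if "z \<in> S x" "a \<in> upper_GL n" "b \<in> upper_GL n" "x \<in> carrier (GL n)" for a b z x
  proof -
    obtain c d where cd: "c \<in> upper_GL n" "d \<in> upper_GL n" "z = c * (r * x) * d" using \<open>z \<in> S x\<close> by (auto simp: S_def)
    have cc: "a \<in> carrier_mat n n" "b \<in> carrier_mat n n" "c \<in> carrier_mat n n" "d \<in> carrier_mat n n" "x \<in> carrier_mat n n"
      using that cd upper_GL_D(2) GL_carrier by blast+
    have "a * z * b = (a * c) * (r * x) * (d * b)"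
      unfolding cd(3) using cc rc by (simp only: square_assoc[where n = n] square_mult)
    then show ?thesis unfolding S_def using upper_GL_mult that(2,3) cd(1,2) by blast
  qed
  have S_self: "r * x \<in> S x" if "x \<in> carrier (GL n)" for x
  proof -
    have "r * x \<in> carrier_mat n n" using GL_carrier[OF GL_mult[OF r(1) that]] .
    then have "r * x = 1\<^sub>m n * (r * x) * 1\<^sub>m n"
      using left_mult_one_mat right_mult_one_mat by metis
    then show ?thesis unfolding S_def using upper_GL_one by blast
  qed
  have act: "flag_act (r' * b * r) (std_flag n x) = std_flag n (r' * (b * (r * x)))"
    if "b \<in> upper_GL n" "x \<in> carrier (GL n)" for b x
  proof -
    have cc: "b \<in> carrier_mat n n" "x \<in> carrier_mat n n" using that upper_GL_D(2) GL_carrier by blast+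
    have "flag_act (r' * b * r) (std_flag n x) = std_flag n (r' * b * r * x)"
      by (intro flag_act_std_flag square_mult cc rc)
    also have "r' * b * r * x = r' * (b * (r * x))" using cc rc by (simp only: square_assoc[where n = n] square_mult)
    finally show ?thesis .
  qed
  have sat: "saturation n H (std_flag n ` X) = {std_flag n (r' * (b * (r * x))) | b x. b \<in> upper_GL n \<and> x \<in> X}"
    if "X \<subseteq> carrier (GL n)" for X
  proof -
    have "saturation n H (std_flag n ` X) = {flag_act (r' * b * r) (std_flag n x) | b x. b \<in> upper_GL n \<and> x \<in> X}"
      unfolding saturation_def orbit_def H by auto
    also have "\<dots> = {std_flag n (r' * (b * (r * x))) | b x. b \<in> upper_GL n \<and> x \<in> X}"
      using act that by (metis (no_types, opaque_lifting) subsetD)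
    finally show ?thesis .
  qed
  have drop: "std_flag n (r' * (z * b)) = std_flag n (r' * z)" if "z \<in> carrier (GL n)" "b \<in> upper_GL n" for z b
  proof -
    have "r' * (z * b) = r' * z * b"
      using square_assoc[OF rc(2) GL_carrier[OF that(1)] upper_GL_D(2)[OF that(2)]] by simp
    then show ?thesis using std_flag_mult_upper[OF GL_mult[OF r(2) that(1)] that(2)] by simp
  qed
  have satS: "saturation n H (std_flag n ` X) = (\<lambda>z. std_flag n (r' * z)) ` S x"
    if x: "x \<in> carrier (GL n)" "x \<in> X" "X \<subseteq> double_coset n x" for x X
  proof -
    have XG: "X \<subseteq> carrier (GL n)" using x(3) double_coset_GL[OF n x(1)] by blast
    have "b * (r * y) \<in> S x" if b: "b \<in> upper_GL n" and y: "y \<in> X" for b y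
    proof -
      obtain u d where ud: "u \<in> Borel_minor n" "d \<in> upper_GL n" "y = u * x * d"
        using y x(3) unfolding double_coset_def by blast
      obtain e where e: "e \<in> upper_GL n" "r * u = e * r" using conj[OF ud(1)] by blast
      have cc: "u \<in> carrier_mat n n" "d \<in> carrier_mat n n" "e \<in> carrier_mat n n" "x \<in> carrier_mat n n" "b \<in> carrier_mat n n"
        using ud Borel_minor_upper[OF n] e b x(1) upper_GL_D(2) GL_carrier by blast+
      have "b * (r * y) = b * (r * u) * x * d"
        unfolding ud(3) using cc rc by (simp only: square_assoc[where n = n] square_mult)
      also have "\<dots> = (b * e) * (r * x) * d"
        unfolding e(2) using cc rc by (simp only: square_assoc[where n = n] square_mult)
      finally show ?thesis unfolding S_def using upper_GL_mult[OF b e(1)] ud(2) by blast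
    qed
    moreover have "std_flag n (r' * z) \<in> saturation n H (std_flag n ` X)" if "z \<in> S x" for z
    proof -
      obtain a b where ab: "a \<in> upper_GL n" "b \<in> upper_GL n" "z = a * (r * x) * b" using \<open>z \<in> S x\<close> by (auto simp: S_def)
      have "std_flag n (r' * z) = std_flag n (r' * (a * (r * x)))"
        unfolding ab(3) by (rule drop[OF GL_mult[OF upper_GL_D(1)[OF ab(1)] GL_mult[OF r(1) x(1)]] ab(2)])
      then show ?thesis unfolding sat[OF XG] using ab(1) x(2) by blast
    qed
    ultimately show ?thesis unfolding sat[OF XG] by blast
  qed
  have eqh: "saturation n H (std_flag n ` double_coset n h) = (\<lambda>z. std_flag n (r' * z)) ` S h"
    by (rule satS[OF h double_coset_self[OF n h] subset_refl])
  have eqg: "saturation n H {std_flag n g} = (\<lambda>z. std_flag n (r' * z)) ` S g"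
    using satS[OF g, of "{g}"] double_coset_self[OF n g] by simp
  have "(\<lambda>z. std_flag n (r' * z)) ` S h = (\<lambda>z. std_flag n (r' * z)) ` S g \<longleftrightarrow> r * h \<in> S g"
  proof
    assume "(\<lambda>z. std_flag n (r' * z)) ` S h = (\<lambda>z. std_flag n (r' * z)) ` S g"
    then obtain z where z: "z \<in> S g" "std_flag n (r' * (r * h)) = std_flag n (r' * z)" using S_self[OF h] by blast
    have zG: "z \<in> carrier (GL n)" by (rule S_GL[OF z(1) g])
    have h': "r' * (r * h) = h" by (rule cancel_left_inverse[OF r(4) rc(2,1) GL_carrier[OF h]])
    obtain b where b: "b \<in> upper_GL n" "h = r' * z * b"
      using std_flag_eq_iff[OF GL_mult[OF r(2) zG] h] z(2) h' by metis
    note bc = upper_GL_D(2)[OF b(1)]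
    have "r * h = r * (r' * (z * b))"
      unfolding b(2) using rc bc GL_carrier[OF zG] by (simp only: square_assoc[where n = n] square_mult)
    also have "\<dots> = z * b" by (intro cancel_left_inverse[OF r(3)] rc square_mult GL_carrier[OF zG] bc)
    also have "\<dots> = 1\<^sub>m n * z * b" using left_mult_one_mat[OF GL_carrier[OF zG]] by simp
    finally show "r * h \<in> S g" using S_closed[OF z(1) upper_GL_one b(1) g] by simp
  next
    assume "r * h \<in> S g"
    then obtain a b where ab: "a \<in> upper_GL n" "b \<in> upper_GL n" "r * h = a * (r * g) * b" by (auto simp: S_def)
    obtain a' where a': "a' \<in> upper_GL n" "a * a' = 1\<^sub>m n" "a' * a = 1\<^sub>m n" by (rule upper_GL_inverse_obtain[OF ab(1)])
    obtain b' where b': "b' \<in> upper_GL n" "b * b' = 1\<^sub>m n" "b' * b = 1\<^sub>m n" by (rule upper_GL_inverse_obtain[OF ab(2)])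
    have cc: "a \<in> carrier_mat n n" "b \<in> carrier_mat n n" "a' \<in> carrier_mat n n" "b' \<in> carrier_mat n n" "g \<in> carrier_mat n n"
      using ab a' b' g upper_GL_D(2) GL_carrier by blast+
    have "a' * (r * h) * b' = a' * (a * (r * g * b * b'))"
      unfolding ab(3) using cc rc by (simp only: square_assoc[where n = n] square_mult)
    also have "r * g * b * b' = r * g" by (intro cancel_right_inverse[OF b'(2)] cc square_mult rc)
    also have "a' * (a * (r * g)) = r * g" by (intro cancel_left_inverse[OF a'(3)] cc square_mult rc)
    finally have "r * g \<in> S h" using S_closed[OF S_self[OF h] a'(1) b'(1) h] by simp
    then have "S g \<subseteq> S h" using S_closed[OF _ _ _ h] unfolding S_def[of g] by blast
    moreover have "S h \<subseteq> S g" using S_closed[OF \<open>r * h \<in> S g\<close> _ _ g] unfolding S_def[of h] by blast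
    ultimately show "(\<lambda>z. std_flag n (r' * z)) ` S h = (\<lambda>z. std_flag n (r' * z)) ` S g" by simp
  qed
  then show ?thesis unfolding eqh eqg by (auto simp: S_def)
qed

definition rot_mat_inv :: "nat \<Rightarrow> complex mat" where
  "rot_mat_inv n = perm_mat n (inv' (rot n))"

lemma rot_mat_inv_facts:
  assumes "1 \<le> n"
  shows "rot_mat_inv n \<in> carrier (GL n)" "rot_mat n * rot_mat_inv n = 1\<^sub>m n" "rot_mat_inv n * rot_mat n = 1\<^sub>m n"
  using perm_mat_GL[OF permutes_inv[OF rot_permutes[OF assms]]] perm_mat_inverse[OF rot_permutes[OF assms]]
  by (simp_all add: rot_mat_inv_def rot_mat_def)

lemma E_star_eq:
  assumes n: "1 \<le> n"
  shows "E_star n = std_flag n (rot_mat_inv n)"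
proof -
  let ?vs = "std_vec n n # map (std_vec n) [1..<n]"
  have p: "inv' (rot n) permutes {1..n}" by (rule permutes_inv[OF rot_permutes[OF n]])
  have "?vs ! c = col (rot_mat_inv n) c" if c: "c < n" for c
  proof (rule eq_vecI)
    have "?vs ! c = std_vec n (if c = 0 then n else c)" using c by (cases c) auto
    also have "(if c = 0 then n else c) = inv' (rot n) (Suc c)" using c by (simp add: inv_rot[OF n])
    finally have e: "?vs ! c = std_vec n (inv' (rot n) (Suc c))" .
    have rng: "1 \<le> inv' (rot n) (Suc c)" using permutes_ivl_le[OF p, of "Suc c"] c by simp
    show "dim_vec (?vs ! c) = dim_vec (col (rot_mat_inv n) c)"
      unfolding e using carrier_matD[OF GL_carrier[OF rot_mat_inv_facts(1)[OF n]]] by (simp add: std_vec_def)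
    fix r assume "r < dim_vec (col (rot_mat_inv n) c)"
    then have r: "r < n" using carrier_matD[OF GL_carrier[OF rot_mat_inv_facts(1)[OF n]]] by simp
    have "col (rot_mat_inv n) c $ r = perm_mat n (inv' (rot n)) $$ (r, c)"
      using r c carrier_matD[OF GL_carrier[OF rot_mat_inv_facts(1)[OF n]]] by (simp add: rot_mat_inv_def)
    then show "(?vs ! c) $ r = col (rot_mat_inv n) c $ r"
      unfolding e using perm_mat_entry[OF p r c] r rng by (auto simp: std_vec_def unit_vec_def)
  qed
  then show ?thesis
    unfolding E_star_def std_flag_eq
    using n by (intro span_flag_columns GL_carrier[OF rot_mat_inv_facts(1)[OF n]]) auto
qed

lemma Borel_star_eq:
  assumes n: "1 \<le> n"
  shows "Borel_star n = {rot_mat_inv n * b * rot_mat n | b. b \<in> upper_GL n}"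
proof -
  note r = rot_mat_inv_facts[OF n]
  note rc = GL_carrier[OF r(1)] rot_mat_carrier[of n]
  have "flag_act g (E_star n) = E_star n \<longleftrightarrow> (\<exists>b\<in>upper_GL n. g = rot_mat_inv n * b * rot_mat n)"
    if g: "g \<in> carrier (GL n)" for g
  proof -
    note gc = GL_carrier[OF g]
    have "flag_act g (E_star n) = E_star n \<longleftrightarrow> std_flag n (rot_mat_inv n) = std_flag n (g * rot_mat_inv n)"
      unfolding E_star_eq[OF n] flag_act_std_flag[OF gc rc(1)] by auto
    also have "\<dots> \<longleftrightarrow> (\<exists>b\<in>upper_GL n. g * rot_mat_inv n = rot_mat_inv n * b)"
      by (rule std_flag_eq_iff[OF r(1) GL_mult[OF g r(1)]])
    also have "\<dots> \<longleftrightarrow> (\<exists>b\<in>upper_GL n. g = rot_mat_inv n * b * rot_mat n)"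
    proof (intro bex_cong refl)
      fix b assume b: "b \<in> upper_GL n"
      note bc = upper_GL_D(2)[OF b]
      show "g * rot_mat_inv n = rot_mat_inv n * b \<longleftrightarrow> g = rot_mat_inv n * b * rot_mat n"
        using cancel_right_inverse[OF r(3) rc(2,1) gc] cancel_right_inverse[OF r(2) rc(1,2) square_mult[OF rc(1) bc]]
        by metis
    qed
    finally show ?thesis .
  qed
  moreover have "rot_mat_inv n * b * rot_mat n \<in> carrier (GL n)" if "b \<in> upper_GL n" for b
    by (intro GL_mult r rot_mat_GL n upper_GL_D(1)[OF that])
  ultimately show ?thesis unfolding Borel_star_def stabilizer_def by blast
qed

definition conj_unrot :: "nat \<Rightarrow> (nat \<Rightarrow> nat) \<Rightarrow> nat \<Rightarrow> nat" where
  "conj_unrot n v = inv' (rot n) \<circ> v \<circ> rot n"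

lemma conj_rot:
  assumes "1 \<le> n"
  shows "v permutes {1..n} \<Longrightarrow> conj_unrot n v permutes {1..n}"
    "u permutes {1..n} \<Longrightarrow> rot n \<circ> u \<circ> inv' (rot n) permutes {1..n}"
    "rot n \<circ> conj_unrot n v \<circ> inv' (rot n) = v" "conj_unrot n (rot n \<circ> u \<circ> inv' (rot n)) = u"
proof -
  note p = rot_permutes[OF assms]
  show "v permutes {1..n} \<Longrightarrow> conj_unrot n v permutes {1..n}"
    unfolding conj_unrot_def by (intro permutes_compose p permutes_inv)
  show "u permutes {1..n} \<Longrightarrow> rot n \<circ> u \<circ> inv' (rot n) permutes {1..n}"
    by (intro permutes_compose p permutes_inv)
  show "rot n \<circ> conj_unrot n v \<circ> inv' (rot n) = v" "conj_unrot n (rot n \<circ> u \<circ> inv' (rot n)) = u"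
    using permutes_inverses[OF p] by (simp_all add: conj_unrot_def fun_eq_iff)
qed

text \<open>Both components are unique by \<open>in_cell_unique\<close>. For the second one, \<open>u(E*)\<close> is the flag of
  \<open>u r^-1\<close>, where \<open>r\<close> is the rotation matrix, so \<open>r h\<close> must lie in the cell of \<open>r u r^-1\<close>.\<close>

lemma Sh_double_coset:
  assumes n: "1 \<le> n" and t: "types n h w v"
  shows "Sh n (std_flag n ` double_coset n h) = (w, conj_unrot n v)"
proof -
  note h = typesD(3)[OF t] and w = typesD(1)[OF t] and v = typesD(2)[OF t]
  let ?Q = "std_flag n ` double_coset n h"
  have 1: "saturation n (Borel n) ?Q = saturation n (Borel n) {perm_act n y (E_plus n)} \<longleftrightarrow> in_cell n h y"
    if y: "y permutes {1..n}" for y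
  proof -
    note G = perm_mat_GL[OF y]
    have oner: "1\<^sub>m n * x = x" "x * 1\<^sub>m n = x" if "x \<in> carrier (GL n)" for x
      using left_mult_one_mat[OF GL_carrier[OF that]] right_mult_one_mat[OF GL_carrier[OF that]] by auto
    have e: "1\<^sub>m n * b * 1\<^sub>m n = b" if "b \<in> upper_GL n" for b
      using oner[OF upper_GL_D(1)[OF that]] by simp
    have H: "upper_GL n = {1\<^sub>m n * b * 1\<^sub>m n | b. b \<in> upper_GL n}"
    proof (intro equalityI subsetI)
      fix x assume x: "x \<in> upper_GL n"
      then show "x \<in> {1\<^sub>m n * b * 1\<^sub>m n | b. b \<in> upper_GL n}" using e[OF x, symmetric] by blast
    next
      fix x assume "x \<in> {1\<^sub>m n * b * 1\<^sub>m n | b. b \<in> upper_GL n}"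
      then obtain b where b: "b \<in> upper_GL n" "x = 1\<^sub>m n * b * 1\<^sub>m n" by blast
      then show "x \<in> upper_GL n" using e[OF b(1)] by simp
    qed
    have "saturation n (upper_GL n) ?Q = saturation n (upper_GL n) {std_flag n (perm_mat n y)} \<longleftrightarrow>
      (\<exists>a\<in>upper_GL n. \<exists>b\<in>upper_GL n. 1\<^sub>m n * h = a * (1\<^sub>m n * perm_mat n y) * b)"
    proof (rule saturation_eq_iff[OF n GL_one GL_one _ _ H _ h G])
      show "\<exists>z\<in>upper_GL n. 1\<^sub>m n * x = z * 1\<^sub>m n" if "x \<in> Borel_minor n" for x
        using Borel_minor_upper[OF n that] oner upper_GL_D(1) by (intro bexI[of _ x]) auto
    qed auto
    then show ?thesis unfolding Borel_eq perm_act_def std_flag_def[symmetric] in_cell_def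
      using y oner(1)[OF h] oner(1)[OF G] by simp
  qed
  have 2: "saturation n (Borel_star n) ?Q = saturation n (Borel_star n) {perm_act n u (E_star n)} \<longleftrightarrow>
      in_cell n (rot_mat n * h) (rot n \<circ> u \<circ> inv' (rot n))" if u: "u permutes {1..n}" for u
  proof -
    note r = rot_mat_inv_facts[OF n] and p = rot_permutes[OF n]
    let ?g = "perm_mat n u * rot_mat_inv n"
    have G: "?g \<in> carrier (GL n)" by (intro GL_mult perm_mat_GL u r)
    have act: "perm_act n u (E_star n) = std_flag n ?g"
      unfolding perm_act_def E_star_eq[OF n] by (intro flag_act_std_flag perm_mat_carrier GL_carrier[OF r(1)])
    have "rot_mat n * ?g = rot_mat n * perm_mat n u * rot_mat_inv n"
      using square_assoc[OF rot_mat_carrier perm_mat_carrier GL_carrier[OF r(1)]] by simp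
    also have "\<dots> = perm_mat n (rot n \<circ> u \<circ> inv' (rot n))"
      unfolding rot_mat_def rot_mat_inv_def
      by (simp only: perm_mat_comp[OF p u] perm_mat_comp[OF permutes_compose[OF u p] permutes_inv[OF p]])
    finally have prod: "rot_mat n * ?g = perm_mat n (rot n \<circ> u \<circ> inv' (rot n))" .
    have "saturation n (Borel_star n) ?Q = saturation n (Borel_star n) {std_flag n ?g} \<longleftrightarrow>
      (\<exists>a\<in>upper_GL n. \<exists>b\<in>upper_GL n. rot_mat n * h = a * (rot_mat n * ?g) * b)"
    proof (rule saturation_eq_iff[OF n rot_mat_GL[OF n] r Borel_star_eq[OF n] _ h G])
      show "\<exists>y\<in>upper_GL n. rot_mat n * x = y * rot_mat n" if "x \<in> Borel_minor n" for x
        using rot_conj_Borel_minor[OF n that] by metis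
    qed
    then show ?thesis unfolding act prod in_cell_def using conj_rot(2)[OF n u] by simp
  qed
  have cells: "in_cell n h w" "in_cell n (rot_mat n * h) v" using t by (auto simp: types_def)
  have "(THE y. y \<in> carrier (sym_group n) \<and>
      saturation n (Borel n) ?Q = saturation n (Borel n) {perm_act n y (E_plus n)}) = w"
  proof (rule the_equality)
    show "w \<in> carrier (sym_group n) \<and> saturation n (Borel n) ?Q = saturation n (Borel n) {perm_act n w (E_plus n)}"
      using 1[OF w] cells(1) w by (simp add: sym_group_carrier)
    fix y assume y: "y \<in> carrier (sym_group n) \<and>
      saturation n (Borel n) ?Q = saturation n (Borel n) {perm_act n y (E_plus n)}"
    then have "in_cell n h y" using 1[of y] unfolding sym_group_carrier by blast
    then show "y = w" using in_cell_unique[OF _ cells(1)] by blast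
  qed
  moreover have "(THE u. u \<in> carrier (sym_group n) \<and>
      saturation n (Borel_star n) ?Q = saturation n (Borel_star n) {perm_act n u (E_star n)}) = conj_unrot n v"
  proof (rule the_equality)
    show "conj_unrot n v \<in> carrier (sym_group n) \<and>
      saturation n (Borel_star n) ?Q = saturation n (Borel_star n) {perm_act n (conj_unrot n v) (E_star n)}"
      using 2[OF conj_rot(1)[OF n v]] cells(2) conj_rot(1,3)[OF n] v by (simp only: sym_group_carrier)
    fix u assume u: "u \<in> carrier (sym_group n) \<and>
      saturation n (Borel_star n) ?Q = saturation n (Borel_star n) {perm_act n u (E_star n)}"
    then have "in_cell n (rot_mat n * h) (rot n \<circ> u \<circ> inv' (rot n))"
      using 2[of u] unfolding sym_group_carrier by blast
    then have "rot n \<circ> u \<circ> inv' (rot n) = v" using in_cell_unique[OF _ cells(2)] by blast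
    then show "u = conj_unrot n v" using conj_rot(4)[OF n, of u] by simp
  qed
  ultimately show ?thesis unfolding Sh_def by simp
qed

section \<open>The Bruhat order under automorphisms\<close>

lemma foldr_hom:
  assumes "group G" "f \<in> hom G G" "f \<one>\<^bsub>G\<^esub> = \<one>\<^bsub>G\<^esub>" "set ss \<subseteq> carrier G"
  shows "foldr (\<otimes>\<^bsub>G\<^esub>) ss \<one>\<^bsub>G\<^esub> \<in> carrier G \<and>
    f (foldr (\<otimes>\<^bsub>G\<^esub>) ss \<one>\<^bsub>G\<^esub>) = foldr (\<otimes>\<^bsub>G\<^esub>) (map f ss) \<one>\<^bsub>G\<^esub>"
proof -
  interpret group G by fact
  show ?thesis using assms(2,3,4) by (induction ss) (auto simp: hom_def)
qed

lemma cox_length_automorphism: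
  assumes G: "group G" and f: "f \<in> iso G G" and S: "S \<subseteq> carrier G" and w: "w \<in> carrier G"
  shows "cox_length G (f ` S) (f w) = cox_length G S w"
proof -
  interpret group G by fact
  have hom: "f \<in> hom G G" and inj: "inj_on f (carrier G)" using f by (auto simp: iso_def bij_betw_def)
  have one: "f \<one>\<^bsub>G\<^esub> = \<one>\<^bsub>G\<^esub>" by (rule hom_one[OF hom G G])
  have "(\<exists>ss. length ss = k \<and> set ss \<subseteq> f ` S \<and> foldr (\<otimes>\<^bsub>G\<^esub>) ss \<one>\<^bsub>G\<^esub> = f w) \<longleftrightarrow>
    (\<exists>ss. length ss = k \<and> set ss \<subseteq> S \<and> foldr (\<otimes>\<^bsub>G\<^esub>) ss \<one>\<^bsub>G\<^esub> = w)" for k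
  proof
    assume "\<exists>ss. length ss = k \<and> set ss \<subseteq> f ` S \<and> foldr (\<otimes>\<^bsub>G\<^esub>) ss \<one>\<^bsub>G\<^esub> = f w"
    then obtain ts where ts: "length ts = k" "set ts \<subseteq> f ` S" "foldr (\<otimes>\<^bsub>G\<^esub>) ts \<one>\<^bsub>G\<^esub> = f w" by blast
    then have "ts \<in> map f ` lists S" unfolding lists_image[symmetric] by auto
    then obtain ss where ss: "set ss \<subseteq> S" "ts = map f ss" by auto
    have "f (foldr (\<otimes>\<^bsub>G\<^esub>) ss \<one>\<^bsub>G\<^esub>) = f w" "foldr (\<otimes>\<^bsub>G\<^esub>) ss \<one>\<^bsub>G\<^esub> \<in> carrier G"
      using foldr_hom[OF G hom one, of ss] ss S ts(3) by auto
    then have "foldr (\<otimes>\<^bsub>G\<^esub>) ss \<one>\<^bsub>G\<^esub> = w" using inj w by (auto dest: inj_onD)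
    then show "\<exists>ss. length ss = k \<and> set ss \<subseteq> S \<and> foldr (\<otimes>\<^bsub>G\<^esub>) ss \<one>\<^bsub>G\<^esub> = w"
      using ss ts(1) by auto
  next
    assume "\<exists>ss. length ss = k \<and> set ss \<subseteq> S \<and> foldr (\<otimes>\<^bsub>G\<^esub>) ss \<one>\<^bsub>G\<^esub> = w"
    then obtain ss where ss: "length ss = k" "set ss \<subseteq> S" "foldr (\<otimes>\<^bsub>G\<^esub>) ss \<one>\<^bsub>G\<^esub> = w" by blast
    then show "\<exists>ss. length ss = k \<and> set ss \<subseteq> f ` S \<and> foldr (\<otimes>\<^bsub>G\<^esub>) ss \<one>\<^bsub>G\<^esub> = f w"
      using foldr_hom[OF G hom one, of ss] S by (intro exI[of _ "map f ss"]) auto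
  qed
  then show ?thesis by (simp add: cox_length_def)
qed

lemma bruhat_le_automorphism:
  assumes G: "group G" and f: "f \<in> iso G G" and S: "S \<subseteq> carrier G" and le: "bruhat_le G S x y"
  shows "bruhat_le G (f ` S) (f x) (f y)"
proof -
  interpret group G by fact
  interpret f: group_hom G G f using f G by (intro group_hom.intro group_hom_axioms.intro) (auto simp: iso_def)
  have refl: "t \<in> carrier G \<and> f t \<in> cox_reflections G (f ` S)" if t: "t \<in> cox_reflections G S" for t
  proof -
    obtain a s where as: "a \<in> carrier G" "s \<in> S" "t = a \<otimes>\<^bsub>G\<^esub> s \<otimes>\<^bsub>G\<^esub> inv\<^bsub>G\<^esub> a"
      using t by (auto simp: cox_reflections_def)
    then have "s \<in> carrier G" using S by blast
    then have "f t = f a \<otimes>\<^bsub>G\<^esub> f s \<otimes>\<^bsub>G\<^esub> inv\<^bsub>G\<^esub> f a" using as by simp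
    moreover have "f a \<in> carrier G" "f s \<in> f ` S" using as(1,2) by auto
    ultimately have "f t \<in> cox_reflections G (f ` S)" unfolding cox_reflections_def by blast
    then show ?thesis using as \<open>s \<in> carrier G\<close> by simp
  qed
  show ?thesis
    using le unfolding bruhat_le_def
  proof (induction rule: converse_rtranclp_induct)
    case (step x z)
    then obtain t where x: "x \<in> carrier G" and t: "t \<in> cox_reflections G S" "z = x \<otimes>\<^bsub>G\<^esub> t"
      and len: "cox_length G S x < cox_length G S z" by blast
    have tc: "t \<in> carrier G" using refl[OF t(1)] by blast
    then have zc: "z \<in> carrier G" using x t(2) by simp
    have "f z = f x \<otimes>\<^bsub>G\<^esub> f t" using t(2) x tc by simp
    moreover have "cox_length G (f ` S) (f x) < cox_length G (f ` S) (f z)"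
      using len cox_length_automorphism[OF G f S x] cox_length_automorphism[OF G f S zc] by simp
    ultimately have "f x \<in> carrier G \<and> (\<exists>t\<in>cox_reflections G (f ` S). f z = f x \<otimes>\<^bsub>G\<^esub> t)
        \<and> cox_length G (f ` S) (f x) < cox_length G (f ` S) (f z)"
      using x refl[OF t(1)] by auto
    then show ?case using step.IH by (intro converse_rtranclp_into_rtranclp[of _ "f x" "f z"])
  qed simp
qed

lemma conj_iso_sym_group:
  assumes "x permutes {1..n}"
  shows "(\<lambda>w. x \<circ> w \<circ> inv' x) \<in> iso (sym_group n) (sym_group n)"
proof -
  have hom: "(\<lambda>w. x \<circ> w \<circ> inv' x) \<in> hom (sym_group n) (sym_group n)"
    unfolding hom_def using assms permutes_inverses(2)[OF assms]
    by (auto simp: sym_group_carrier sym_group_mult fun_eq_iff intro!: permutes_compose permutes_inv)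
  have "bij_betw (\<lambda>w. x \<circ> w \<circ> inv' x) (carrier (sym_group n)) (carrier (sym_group n))"
  proof (rule bij_betw_byWitness[where f' = "\<lambda>w. inv' x \<circ> w \<circ> x"])
    show "(\<lambda>w. x \<circ> w \<circ> inv' x) ` carrier (sym_group n) \<subseteq> carrier (sym_group n)"
      "(\<lambda>w. inv' x \<circ> w \<circ> x) ` carrier (sym_group n) \<subseteq> carrier (sym_group n)"
      using assms by (auto simp: sym_group_carrier intro!: permutes_compose permutes_inv)
  qed (use permutes_inverses[OF assms] in \<open>auto simp: fun_eq_iff\<close>)
  then show ?thesis using hom by (simp add: iso_def)
qed

text \<open>The rotation turns the cyclic order \<open>n, 1, \<dots>, n - 1\<close> into the standard one.\<close>

lemma S_star_conj:
  assumes n: "2 \<le> n"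
  shows "(\<lambda>s. rot n \<circ> s \<circ> inv' (rot n)) ` S_star n = S_std n"
proof -
  have p: "rot n permutes {1..n}" using n by (intro rot_permutes) simp
  have c: "rot n \<circ> Transposition.transpose a b \<circ> inv' (rot n) = Transposition.transpose (rot n a) (rot n b)" for a b
    by (rule comp_transpose_inv[OF p])
  have first: "Transposition.transpose (rot n 1) (rot n n) = simple 0"
    using n by (simp add: rot_def transpose_commute)
  have rest: "Transposition.transpose (rot n (i - 1)) (rot n i) = simple (i - 1)" if "2 \<le> i" "i \<le> n - 1" for i
    using that by (auto simp: rot_def)
  show ?thesis
  proof (intro equalityI subsetI)
    fix x assume "x \<in> (\<lambda>s. rot n \<circ> s \<circ> inv' (rot n)) ` S_star n"
    then consider "x = Transposition.transpose (rot n 1) (rot n n)"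
      | i where "2 \<le> i" "i \<le> n - 1" "x = Transposition.transpose (rot n (i - 1)) (rot n i)"
      unfolding S_star_def using c by auto
    then show "x \<in> S_std n"
      unfolding S_std_eq
    proof cases
      case 1
      then show "x \<in> {simple k |k. Suc k < n}" using first n by auto
    next
      case (2 i)
      then show "x \<in> {simple k |k. Suc k < n}" using rest[of i] by (intro CollectI exI[of _ "i - 1"]) auto
    qed
  next
    fix x assume "x \<in> S_std n"
    then obtain k where k: "x = simple k" "Suc k < n" by (auto simp: S_std_eq)
    show "x \<in> (\<lambda>s. rot n \<circ> s \<circ> inv' (rot n)) ` S_star n"
    proof (cases k)
      case 0
      then have "x = rot n \<circ> Transposition.transpose 1 n \<circ> inv' (rot n)" using k c[of 1 n] first by simp
      moreover have "Transposition.transpose 1 n \<in> S_star n" by (simp add: S_star_def)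
      ultimately show ?thesis by (rule image_eqI)
    next
      case (Suc m)
      then have "x = rot n \<circ> Transposition.transpose (Suc k - 1) (Suc k) \<circ> inv' (rot n)"
        using k c[of "Suc k - 1" "Suc k"] rest[of "Suc k"] by simp
      moreover have "Transposition.transpose (Suc k - 1) (Suc k) \<in> S_star n"
        unfolding S_star_def using Suc k by (intro insertI2 CollectI exI[of _ "Suc k"]) auto
      ultimately show ?thesis by (rule image_eqI)
    qed
  qed
qed

lemma bruhat_le_star:
  assumes n: "2 \<le> n" and perm: "u permutes {1..n}" "v permutes {1..n}"
  shows "bruhat_le (sym_group n) (S_star n) (conj_unrot n u) (conj_unrot n v) \<longleftrightarrow> dominated u v"
proof -
  have n1: "1 \<le> n" using n by simp
  note p = rot_permutes[OF n1]
  have ip: "inv' (rot n) permutes {1..n}" by (rule permutes_inv[OF p])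
  have ii: "inv' (inv' (rot n)) = rot n" by (rule inv_inv_eq[OF permutes_bij[OF p]])
  let ?f = "\<lambda>w. rot n \<circ> w \<circ> inv' (rot n)"
  have f: "?f \<in> iso (sym_group n) (sym_group n)" by (rule conj_iso_sym_group[OF p])
  have f': "conj_unrot n \<in> iso (sym_group n) (sym_group n)"
    using conj_iso_sym_group[OF ip] unfolding ii conj_unrot_def[abs_def] .
  have Sf: "?f ` S_star n = S_std n" by (rule S_star_conj[OF n])
  then have "conj_unrot n ` S_std n = conj_unrot n ` ?f ` S_star n" by simp
  also have "\<dots> = S_star n" unfolding image_image conj_rot(4)[OF n1] by simp
  finally have Sf': "conj_unrot n ` S_std n = S_star n" .
  have Sc: "S_std n \<subseteq> carrier (sym_group n)"
    unfolding S_std_eq using simple_permutes sym_group_carrier by blast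
  have "conj_unrot n ` carrier (sym_group n) \<subseteq> carrier (sym_group n)" using conj_rot(1)[OF n1] by (auto simp: sym_group_carrier)
  then have Sc': "S_star n \<subseteq> carrier (sym_group n)" using Sc unfolding Sf'[symmetric] by blast
  have "bruhat_le (sym_group n) (S_star n) (conj_unrot n u) (conj_unrot n v) \<longleftrightarrow> bruhat_le (sym_group n) (S_std n) u v"
    using bruhat_le_automorphism[OF sym_group_is_group f Sc', of "conj_unrot n u" "conj_unrot n v"]
      bruhat_le_automorphism[OF sym_group_is_group f' Sc, of u v]
    unfolding Sf Sf' conj_rot(3)[OF n1] by blast
  then show ?thesis using bruhat_le_iff_dominated[OF perm] by simp
qed

section \<open>The closure order on orbits of flags\<close>

theorem theorem1p2:
  fixes n :: nat and Q Q' :: "flag set"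
  assumes "n \<ge> 2"
    and "Q \<in> Borel_minor_orbits n" and "Q' \<in> Borel_minor_orbits n"
  shows "Q' \<subseteq> flag_closure n Q \<longleftrightarrow> Sh_le n (Sh n Q') (Sh n Q)"
proof -
  have n: "1 \<le> n" using assms(1) by simp
  obtain h where h: "h \<in> carrier (GL n)" "Q = std_flag n ` double_coset n h"
    by (rule Borel_minor_orbit_cases[OF n assms(2)])
  obtain g where g: "g \<in> carrier (GL n)" "Q' = std_flag n ` double_coset n g"
    by (rule Borel_minor_orbit_cases[OF n assms(3)])
  obtain w v where t: "types n h w v" using types_exist[OF n h(1)] by blast
  obtain y u where t': "types n g y u" using types_exist[OF n g(1)] by blast
  have "Q' \<subseteq> flag_closure n Q \<longleftrightarrow> (\<forall>x\<in>double_coset n g. x \<in> GL_closure n (double_coset n h))"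
    unfolding h(2) g(2) image_subset_iff
    using flag_closure_iff[OF n h(1)] double_coset_GL[OF n g(1)] by blast
  also have "\<dots> \<longleftrightarrow> g \<in> GL_closure n (double_coset n h)"
    using double_coset_self[OF n g(1)] double_coset_in_closure[OF n h(1)] by blast
  also have "\<dots> \<longleftrightarrow> dominated y w \<and> dominated u v" by (rule closure_iff_dominated[OF n t t'])
  also have "\<dots> \<longleftrightarrow> Sh_le n (Sh n Q') (Sh n Q)"
    unfolding Sh_le_def h(2) g(2) Sh_double_coset[OF n t] Sh_double_coset[OF n t'] fst_conv snd_conv
    using bruhat_le_iff_dominated[OF typesD(1)[OF t'] typesD(1)[OF t]]
      bruhat_le_star[OF assms(1) typesD(2)[OF t'] typesD(2)[OF t]] by blast
  finally show ?thesis .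
qed

end
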